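(* Let $f:\mathbb{R}^n\to\mathbb{R}$ be a Borel measurable function with bounded Chebyshev degree $d_f$ and associated constant $A_f$. Let $s<0$ and let $\mu$ be an $s$-concave probability measure on $\mathbb{R}^n$. Denote by $M_f$ the $\mu$-median of $|f|^{1/d_f}$ and let $d_s:=(2^{-s}-1)^{1/s}$. Then for every $t>1$ $$\mu(\{|f|^{1/d_f}\ge A_fM_ft\})\le t^{1/s}\left(2^{-s}-1+\frac1t\right)^{1/s}\le d_s\,t^{1/s},$$ and for every $0<p<-\frac1s$ $$\bigl\||f|^{1/d_f}\bigr\|_{L^p(\mu)}\le A_fM_f\left(1-d_s\,\frac{p}{p+\frac1s}\right)^{1/p}.$$
   Context: A Borel function $f:\mathbb{R}^n\to\mathbb{R}$ has bounded Chebyshev degree if there exist $A>0$ and $d>0$ such that for every interval $I$ in $\mathbb{R}^n$ and every Borel subset $J$ of $I$ (with $|J|>0$) $$\sup_I|f|\le\left(\frac{A|I|}{|J|}\right)^{d}\sup_J|f|.$$ The smallest such power $d$ is called the Chebyshev degree of $f$, denoted $d_f$, and the best (smallest) constant $A$ corresponding to this power is denoted $A_f$. An interval in $\mathbb{R}^n$ is an interval (segment) contained in an affine line, and $|\cdot|$ is one-dimensional Lebesgue measure. $\|g\|_{L^p(\mu)}=\left(\int|g|^p\,d\mu\right)^{1/p}$ for every $p>0$. A median $M$ of a function $g$ satisfies $\mu(g\ge M)\ge\frac12$ and $\mu(g\le M)\ge\frac12$. For $s<0$, a (Borel) measure $\mu$ on $\mathbb{R}^n$ is $s$-concave if $$\mu(\alpha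 A+(1-\alpha)B)\ge[\alpha\mu(A)^s+(1-\alpha)\mu(B)^s]^{1/s}$$ for all compact $A,B\subset\mathbb{R}^n$ with $\mu(A)\mu(B)>0$ and all $\alpha\in[0,1]$, where $\alpha A+(1-\alpha)B=\{\alpha x+(1-\alpha)y: x\in A,\ y\in B\}$.
   Formalization: The first tail inequality is stated for M_f ≠ 0 only: if M_f = 0 the event is all of R^n, of measure 1, while the bound is below 1 (for example f(x) = x and μ the Dirac mass at 0); the other two bounds are stated without this restriction. *)

theory Defs
  imports "HOL-Probability.Probability"
begin

text \<open>
  One-dimensional Lebesgue measure of the part of \<open>J\<close> lying on the line through \<open>a\<close> with
  direction \<open>u\<close>. It is only used for \<open>norm u = 1\<close>, where the parametrisation is an isometry,
  so that the value depends on the line but not on the choice of \<open>a\<close> and \<open>u\<close>.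
\<close>
definition line_measure :: "'a::euclidean_space \<Rightarrow> 'a \<Rightarrow> 'a set \<Rightarrow> real" where
  "line_measure a u J = measure lborel {t. a + t *\<^sub>R u \<in> J}"

text \<open>
  The inequality \<open>sup\<^sub>I |f| \<le> (A |I| / |J|)\<^sup>d sup\<^sub>J |f|\<close> for all intervals \<open>I\<close> (bounded convex
  subsets of a line, with or without their endpoints) and all Borel \<open>J \<subseteq> I\<close> with \<open>|J| > 0\<close>.
  The suprema are taken in the extended nonnegative reals, hence are meaningful for unbounded
  functions.
\<close>
definition chebyshev_bound :: "('a::euclidean_space \<Rightarrow> real) \<Rightarrow> real \<Rightarrow> real \<Rightarrow> bool" where
  "chebyshev_bound f A d \<longleftrightarrow> 0 < A \<and> 0 < d \<and>
     (\<forall>a u I J. norm u = 1 \<longrightarrow> I \<subseteq> range (\<lambda>t. a + t *\<^sub>R u) \<longrightarrow> convex I \<longrightarrow> bounded I \<longrightarrow>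
        J \<in> sets borel \<longrightarrow> J \<subseteq> I \<longrightarrow> 0 < line_measure a u J \<longrightarrow>
        (SUP x\<in>I. ennreal \<bar>f x\<bar>)
          \<le> ennreal ((A * line_measure a u I / line_measure a u J) powr d)
             * (SUP x\<in>J. ennreal \<bar>f x\<bar>))"

text \<open>
  The degree and its constant are minima, not infima, and so are rendered as predicates: a nonzero
  constant function satisfies the inequality for every \<open>d > 0\<close> and has no degree.
\<close>
definition is_chebyshev_degree :: "('a::euclidean_space \<Rightarrow> real) \<Rightarrow> real \<Rightarrow> bool" where
  "is_chebyshev_degree f d \<longleftrightarrow>
     (\<exists>A. chebyshev_bound f A d) \<and> (\<forall>A' d'. chebyshev_bound f A' d' \<longrightarrow> d \<le> d')"

definition is_chebyshev_const :: "('a::euclidean_space \<Rightarrow> real) \<Rightarrow> real \<Rightarrow> real \<Rightarrow> bool" where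
  "is_chebyshev_const f d A \<longleftrightarrow>
     chebyshev_bound f A d \<and> (\<forall>A'. chebyshev_bound f A' d \<longrightarrow> A \<le> A')"

text \<open>
  For finite Borel measures and \<open>s < 0\<close>. Only there do \<open>measure\<close> and \<open>powr\<close> give the intended
  meaning.
\<close>
definition s_concave :: "real \<Rightarrow> 'a::euclidean_space measure \<Rightarrow> bool" where
  "s_concave s \<mu> \<longleftrightarrow>
     (\<forall>A B \<alpha>. compact A \<longrightarrow> compact B \<longrightarrow> 0 < measure \<mu> A * measure \<mu> B \<longrightarrow> \<alpha> \<in> {0..1} \<longrightarrow>
        (\<alpha> * measure \<mu> A powr s + (1 - \<alpha>) * measure \<mu> B powr s) powr (1 / s)
          \<le> measure \<mu> {\<alpha> *\<^sub>R x + (1 - \<alpha>) *\<^sub>R y | x y. x \<in> A \<and> y \<in> B})"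

definition is_median :: "'a measure \<Rightarrow> ('a \<Rightarrow> real) \<Rightarrow> real \<Rightarrow> bool" where
  "is_median \<mu> g M \<longleftrightarrow>
     1 / 2 \<le> measure \<mu> {x \<in> space \<mu>. M \<le> g x} \<and> 1 / 2 \<le> measure \<mu> {x \<in> space \<mu>. g x \<le> M}"

text \<open>
  A real number, equal to the junk value \<open>0\<close> if \<open>|g|\<^sup>p\<close> is not integrable. Finiteness of the norm
  has to be stated separately as integrability.
\<close>
definition Lp_norm :: "'a measure \<Rightarrow> real \<Rightarrow> ('a \<Rightarrow> real) \<Rightarrow> real" where
  "Lp_norm \<mu> p g = (\<integral>x. \<bar>g x\<bar> powr p \<partial>\<mu>) powr (1 / p)"

definition d_const :: "real \<Rightarrow> real" where
  "d_const s = (2 powr (- s) - 1) powr (1 / s)"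

end

theory Submission imports Defs begin

text \<open>
  The tail bound follows from a dilation inequality for an \<open>s\<close>-concave probability measure \<open>\<mu>\<close>:
  if every segment starting in \<open>B\<close> spends at most a fraction \<open>a\<close> of its length in a set \<open>F\<close>
  disjoint from \<open>B\<close>, then \<open>1 - \<mu> F \<ge> (a \<mu>(B)\<^sup>s + 1 - a)\<^bsup>1/s\<^esup>\<close>. It is applied to
  \<open>F = {|f|\<^bsup>1/d\<^esup> \<le> M}\<close>, \<open>B = {|f|\<^bsup>1/d\<^esup> \<ge> A M t}\<close> and \<open>a = 1/t\<close>, the
  Chebyshev inequality being exactly the hypothesis on segments. The moment bound is the integral
  of the tail bound.

  For the dilation inequality, bisect by hyperplanes through the rational axes
  \<open>{x. x\<^sub>i = p, x\<^sub>j = q}\<close>, keeping the relative measure of \<open>B\<close> and not decreasing that of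
  \<open>F\<close>. The resulting nested convex bodies shrink to a segment, near which \<open>B\<close> and \<open>F\<close> are
  governed by slightly fattened subsets of the line. This leaves the one-dimensional inequality for
  the projection of \<open>\<mu>\<close> from a thin body.

  On the line, the complement of \<open>B\<close> splits into gaps. Let \<open>b\<close> be the relative measure of \<open>B\<close>.
  Each gap can be cut so that on either piece the part of the line beyond the \<open>B\<close>-endpoint carries
  at least the fraction \<open>b\<close>. Quasiconcavity of the density and the Brunn-Minkowski inequality for
  half-lines bound the mass of \<open>F\<close> in a piece, and concavity of the power mean makes these bounds
  add up to the claim.
\<close>

subsection \<open>Weighted power means\<close>

text \<open>Two features of \<open>\<mu>\<close> shape the proof: it is not assumed to have a
  density, so it may live on a hyperplane, and \<open>s_concave\<close> speaks of compact sets. A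
  hyperplane charged inside a convex body carries all the mass of that body, so the bisection can
  continue within it. No limit measure on the final segment is formed; a thin body is projected
  instead, since the projection inherits the concavity inequality for intervals directly. The price
  is that \<open>B\<close> and \<open>F\<close> are seen on the line up to an error, so the
  condition on segments has to survive fattening. This takes a fraction \<open>a' > a\<close>, for
  which the strict inequality of an indirect proof leaves room.

  The constants come from a set \<open>F\<close> of measure at least 1/2: the dilation inequality
  then reads \<open>2 powr (- s) \<le> measure \<mu> B powr s / t + 1 - 1 / t\<close>. Solved for
  the measure of \<open>B\<close> this is the tail bound, and dropping \<open>1 / t\<close> produces
  \<open>d_const s\<close>. A median equal to 0 needs its own argument, with zeros of
  \<open>f\<close> as \<open>F\<close> and \<open>a = 0\<close>.\<close>

definition pmean :: "real \<Rightarrow> real \<Rightarrow> real \<Rightarrow> real \<Rightarrow> real" where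
  "pmean s a x y = (a * x powr s + (1 - a) * y powr s) powr (1 / s)"

lemma convex_on_powr_neg:
  fixes s :: real
  assumes "s < 0"
  shows "convex_on {0<..} (\<lambda>x. x powr s)"
proof (rule f''_ge0_imp_convex)
  show "DERIV (\<lambda>x. x powr s) x :> s * x powr (s - 1)" if "x \<in> {0<..}" for x
    using that by (auto intro!: derivative_eq_intros)
  show "DERIV (\<lambda>x. s * x powr (s - 1)) x :> s * ((s - 1) * x powr (s - 1 - 1))" if "x \<in> {0<..}" for x
    using that by (auto intro!: derivative_eq_intros)
  show "0 \<le> s * ((s - 1) * x powr (s - 1 - 1))" if "x \<in> {0<..}" for x
    using that assms by (auto intro!: mult_nonpos_nonpos mult_nonpos_nonneg)
qed auto

lemma wmean_pos:
  fixes a x y :: real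
  assumes "0 \<le> a" "a \<le> 1" "0 < x" "0 < y"
  shows "0 < a * x + (1 - a) * y"
  by (smt (verit, best) assms mult_nonneg_nonneg mult_pos_pos)

lemma powr_neg_le_iff:
  fixes s x y :: real
  assumes "s < 0" "0 < x" "0 < y"
  shows "x powr s \<le> y powr s \<longleftrightarrow> y \<le> x"
  using assms by (smt (verit) powr_less_mono2_neg)

locale neg_power_mean =
  fixes s a :: real
  assumes s_neg: "s < 0" and a_ge: "0 \<le> a" and a_le: "a \<le> 1"
begin

lemma base_pos:
  assumes "0 < x" "0 < y"
  shows "0 < a * x powr s + (1 - a) * y powr s"
  using assms a_ge a_le by (intro wmean_pos) auto

lemma pmean_pos: "0 < pmean s a x y" if "0 < x" "0 < y"
  using base_pos[OF that] by (simp add: pmean_def)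

lemma pmean_powr: "pmean s a x y powr s = a * x powr s + (1 - a) * y powr s"
  if "0 < x" "0 < y"
  using base_pos[OF that] s_neg by (simp add: pmean_def powr_powr)

lemma le_pmean_iff: "z \<le> pmean s a x y \<longleftrightarrow> a * x powr s + (1 - a) * y powr s \<le> z powr s"
  if "0 < x" "0 < y" "0 < z"
  using powr_neg_le_iff[OF s_neg pmean_pos[OF that(1,2)] that(3)] pmean_powr that by simp

lemma pmean_le_iff: "pmean s a x y \<le> z \<longleftrightarrow> z powr s \<le> a * x powr s + (1 - a) * y powr s"
  if "0 < x" "0 < y" "0 < z"
  using powr_neg_le_iff[OF s_neg that(3) pmean_pos[OF that(1,2)]] pmean_powr that by simp

lemma pmean_same [simp]: "pmean s a x x = x" if "0 < x"
  using that s_neg by (simp add: pmean_def algebra_simps powr_powr)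

lemma pmean_mono:
  assumes "0 < x" "x \<le> x'" "0 < y" "y \<le> y'"
  shows "pmean s a x y \<le> pmean s a x' y'"
proof -
  have "x' powr s \<le> x powr s" "y' powr s \<le> y powr s"
    using assms powr_neg_le_iff[OF s_neg] by auto
  then have "a * x' powr s + (1 - a) * y' powr s \<le> a * x powr s + (1 - a) * y powr s"
    using a_ge a_le by (intro add_mono mult_left_mono) auto
  then show ?thesis
    using assms by (subst le_pmean_iff) (auto simp: pmean_powr pmean_pos)
qed

lemma pmean_scale:
  assumes "0 < x" "0 < y" "0 < k"
  shows "pmean s a (k * x) (k * y) = k * pmean s a x y"
proof -
  have "pmean s a (k * x) (k * y) = (k powr s * (a * x powr s + (1 - a) * y powr s)) powr (1 / s)"
    using assms by (simp add: pmean_def powr_mult algebra_simps)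
  also have "\<dots> = k * pmean s a x y"
    using assms s_neg base_pos[of x y] by (simp add: powr_mult powr_powr pmean_def)
  finally show ?thesis .
qed

lemma pmean_ge_min:
  assumes "0 < x" "0 < y"
  shows "min x y \<le> pmean s a x y"
  using pmean_mono[of "min x y" x "min x y" y] assms by auto

lemma pmean_le_arith:
  assumes "0 < x" "0 < y"
  shows "pmean s a x y \<le> a * x + (1 - a) * y"
proof -
  have "(a * x + (1 - a) * y) powr s \<le> a * x powr s + (1 - a) * y powr s"
    using convex_onD[OF convex_on_powr_neg[OF s_neg], of "1 - a" x y] assms a_ge a_le
    by simp
  then show ?thesis
    using assms a_ge a_le wmean_pos[of a x y] by (subst pmean_le_iff) auto
qed

text \<open>Minkowski's inequality in its reverse form. Divided by their means \<open>m\<close> and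
  \<open>m'\<close>, both pairs have mean 1; convexity of \<open>z powr s\<close> with weights
  \<open>m / (m + m')\<close> and \<open>m' / (m + m')\<close> shows that the normalised sum has
  mean at least 1, and homogeneity removes the denominator.\<close>

lemma pmean_superadd:
  assumes "0 < x" "0 < y" "0 < x'" "0 < y'"
  shows "pmean s a x y + pmean s a x' y' \<le> pmean s a (x + x') (y + y')"
proof -
  define m m' where "m = pmean s a x y" and "m' = pmean s a x' y'"
  have m: "0 < m" "0 < m'" using pmean_pos assms by (auto simp: m_def m'_def)
  define t where "t = m / (m + m')"
  have t: "0 \<le> t" "t \<le> 1" "1 - t = m' / (m + m')"
    using m by (auto simp: t_def field_simps)
  have conv: "((z + z') / (m + m')) powr s \<le> t * (z powr s / m powr s) + (1 - t) * (z' powr s / m' powr s)"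
    if z: "0 < z" "0 < z'" for z z'
  proof -
    have "(z + z') / (m + m') = t * (z / m) + (1 - t) * (z' / m')"
      using m by (simp add: t(3)) (simp add: t_def add_divide_distrib)
    then have "((z + z') / (m + m')) powr s \<le> t * (z / m) powr s + (1 - t) * (z' / m') powr s"
      using convex_onD[OF convex_on_powr_neg[OF s_neg], of "1 - t" "z/m" "z'/m'"] z m t(1,2)
      by (simp only:) simp
    then show ?thesis using z m by (simp add: powr_divide)
  qed
  have u1: "a * (x powr s / m powr s) + (1 - a) * (y powr s / m powr s) = 1"
    unfolding times_divide_eq_right add_divide_distrib[symmetric]
      pmean_powr[OF assms(1,2), folded m_def, symmetric]
    using m by simp
  have u2: "a * (x' powr s / m' powr s) + (1 - a) * (y' powr s / m' powr s) = 1"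
    unfolding times_divide_eq_right add_divide_distrib[symmetric]
      pmean_powr[OF assms(3,4), folded m'_def, symmetric]
    using m by simp
  have "a * ((x + x') / (m + m')) powr s + (1 - a) * ((y + y') / (m + m')) powr s
     \<le> a * (t * (x powr s / m powr s) + (1 - t) * (x' powr s / m' powr s))
      + (1 - a) * (t * (y powr s / m powr s) + (1 - t) * (y' powr s / m' powr s))"
    using a_ge a_le conv assms by (intro add_mono mult_left_mono) auto
  also have "\<dots> = t * (a * (x powr s / m powr s) + (1 - a) * (y powr s / m powr s))
      + (1 - t) * (a * (x' powr s / m' powr s) + (1 - a) * (y' powr s / m' powr s))"
    by (simp add: algebra_simps)
  also have "\<dots> = 1" by (simp only: u1 u2) simp
  finally have "1 \<le> pmean s a ((x + x') / (m + m')) ((y + y') / (m + m'))"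
    using assms m by (subst le_pmean_iff) auto
  also have "\<dots> = pmean s a (x + x') (y + y') / (m + m')"
    using pmean_scale[of "x + x'" "y + y'" "1 / (m + m')"] assms m by simp
  finally show ?thesis using m by (simp add: m_def m'_def field_simps)
qed

lemma pmean_concave:
  assumes "0 < x" "0 < y" "0 < x'" "0 < y'" "0 \<le> t" "t \<le> 1"
  shows "t * pmean s a x y + (1 - t) * pmean s a x' y'
    \<le> pmean s a (t * x + (1 - t) * x') (t * y + (1 - t) * y')"
proof (cases "t = 0 \<or> t = 1")
  case False
  then have "0 < t" "0 < 1 - t" using assms by auto
  then show ?thesis
    using pmean_superadd[of "t * x" "t * y" "(1 - t) * x'" "(1 - t) * y'"] assms
    by (simp add: pmean_scale)
qed auto

text \<open>By concavity in the second argument the slope over \<open>[p, c]\<close> is at most the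
  one over \<open>[x, c]\<close>, where the mean starts at \<open>x\<close> and ends below the
  arithmetic mean. In \<open>one_sided_bound\<close> this trades an unknown point \<open>y\<close>
  for the given end \<open>c\<close>.\<close>

lemma pmean_snd_slope:
  assumes "0 < x" "x \<le> p" "p \<le> c"
  shows "pmean s a x c - pmean s a x p \<le> (1 - a) * (c - p)"
proof (cases "x = c")
  case False
  then have "x < c" using assms by auto
  define t where "t = (c - p) / (c - x)"
  have t: "0 \<le> t" "t \<le> 1" "t * (c - x) = c - p" using assms \<open>x < c\<close> by (auto simp: t_def field_simps)
  then have p: "p = t * x + (1 - t) * c" by (simp add: algebra_simps)
  have "t * x + (1 - t) * pmean s a x c \<le> pmean s a x p"
    using pmean_concave[of x x x c t] assms t by (simp add: p[symmetric]) (simp add: algebra_simps)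
  then have "pmean s a x c - pmean s a x p \<le> t * (pmean s a x c - x)" by (simp add: algebra_simps)
  also have "\<dots> \<le> t * ((1 - a) * (c - x))"
    using pmean_le_arith[of x c] assms t by (intro mult_left_mono) (auto simp: algebra_simps)
  also have "\<dots> = (1 - a) * (c - p)" using t(3) by (metis mult.left_commute)
  finally show ?thesis .
qed (use assms in auto)

text \<open>The mean is concave in its first argument, hence lies above its chord over
  \<open>[b, 1]\<close>. The chord turns the bound for one gap into a multiple of the mass of that
  gap, and such bounds can be added.\<close>

lemma pmean_chord:
  assumes "0 < b" "b < 1" "b \<le> q" "q \<le> 1"
  shows "q + (pmean s a b 1 - b) / (1 - b) * (1 - q) \<le> pmean s a q 1"
proof -
  define t where "t = (1 - q) / (1 - b)"
  have t: "0 \<le> t" "t \<le> 1" "t * (1 - b) = 1 - q" using assms by (auto simp: t_def field_simps)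
  then have q: "q = t * b + (1 - t) * 1" by (simp add: algebra_simps)
  have "t * pmean s a b 1 + (1 - t) * 1 \<le> pmean s a q 1"
    using pmean_concave[of b 1 1 1 t] assms t q by simp
  moreover have "t * pmean s a b 1 + (1 - t) * 1 = q + (pmean s a b 1 - b) / (1 - b) * (1 - q)"
    using assms by (simp add: t_def divide_simps) (simp add: algebra_simps)
  ultimately show ?thesis by simp
qed

end

subsection \<open>Quasiconcave densities on the line\<close>

lemma indicator_mult_integrable_on:
  fixes \<psi> :: "real \<Rightarrow> real"
  assumes "X \<in> sets borel" "continuous_on UNIV \<psi>"
  shows "set_integrable lborel {a..b} (\<lambda>x. indicator X x * \<psi> x)"
    and "(\<lambda>x. indicator X x * \<psi> x) integrable_on {a..b}"
proof -
  have "integrable lborel (\<lambda>x. indicator {a..b} x *\<^sub>R \<psi> x)"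
    using borel_integrable_atLeastAtMost'[of a b \<psi>] continuous_on_subset[OF assms(2)]
    by (auto simp: set_integrable_def)
  from integrable_mult_indicator[OF _ this, of X] assms(1)
  show *: "set_integrable lborel {a..b} (\<lambda>x. indicator X x * \<psi> x)"
    by (simp add: set_integrable_def mult.left_commute)
  then show "(\<lambda>x. indicator X x * \<psi> x) integrable_on {a..b}"
    by (rule set_borel_integral_eq_integral)
qed

lemma integral_indicator_eq_measure:
  fixes X :: "real set"
  assumes "X \<in> sets borel"
  shows "(indicator X :: real \<Rightarrow> real) integrable_on {a..b}"
    and "integral {a..b} (indicator X :: real \<Rightarrow> real) = measure lborel (X \<inter> {a..b})"
proof -
  have i: "set_integrable lborel {a..b} (indicator X :: real \<Rightarrow> real)"
    using indicator_mult_integrable_on(1)[OF assms, of "\<lambda>_. 1"] by simp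
  show "(indicator X :: real \<Rightarrow> real) integrable_on {a..b}"
    using set_borel_integral_eq_integral(1)[OF i] .
  have "integral {a..b} (indicator X :: real \<Rightarrow> real) = (LINT x:{a..b}|lborel. indicator X x)"
    using set_borel_integral_eq_integral(2)[OF i] by simp
  also have "\<dots> = (LINT x|lborel. indicator (X \<inter> {a..b}) x)"
    unfolding set_lebesgue_integral_def
    by (intro Bochner_Integration.integral_cong) (auto simp: indicator_def)
  also have "\<dots> = measure lborel (X \<inter> {a..b})" by simp
  finally show "integral {a..b} (indicator X :: real \<Rightarrow> real) = measure lborel (X \<inter> {a..b})" .
qed

text \<open>
  Beyond \<open>y\<close> the function is largest on the initial fraction \<open>a\<close> of \<open>[y, d]\<close>: in the
  typical case \<open>y\<close> is chosen so that both ends of that piece lie on the level \<open>t\<close>.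
\<close>
lemma quasiconcave_interval_selection:
  fixes \<psi> :: "real \<Rightarrow> real"
  assumes cont: "continuous_on UNIV \<psi>"
    and qc: "\<And>x y z. x \<le> y \<Longrightarrow> y \<le> z \<Longrightarrow> min (\<psi> x) (\<psi> z) \<le> \<psi> y"
    and "c \<le> d" and a: "0 \<le> a" "a < 1"
  obtains y t where "c \<le> y" "y \<le> d"
    "\<And>x. y \<le> x \<Longrightarrow> x \<le> y + a * (d - y) \<Longrightarrow> t \<le> \<psi> x"
    "\<And>x. y + a * (d - y) \<le> x \<Longrightarrow> x \<le> d \<Longrightarrow> \<psi> x \<le> t"
    "\<And>x x'. c \<le> x \<Longrightarrow> x \<le> x' \<Longrightarrow> x' \<le> y \<Longrightarrow> \<psi> x \<le> \<psi> x'"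
    "c < y \<Longrightarrow> \<psi> y \<le> t"
proof -
  note select = that
  have "continuous_on {c..d} \<psi>" using cont continuous_on_subset by blast
  then obtain p where p: "p \<in> {c..d}" "\<And>x. x \<in> {c..d} \<Longrightarrow> \<psi> x \<le> \<psi> p"
    using continuous_attains_sup[of "{c..d}" \<psi>] \<open>c \<le> d\<close> by auto
  have incr: "\<psi> x \<le> \<psi> x'" if "c \<le> x" "x \<le> x'" "x' \<le> p" for x x'
    using qc[of x x' p] p that by force
  have decr: "\<psi> x' \<le> \<psi> x" if "p \<le> x" "x \<le> x'" "x' \<le> d" for x x'
    using qc[of p x x'] p that by force
  define z where "z y = y + a * (d - y)" for y
  have z_le: "z y \<le> d" if "y \<le> d" for y
    using that a mult_right_mono[of a 1 "d - y"] by (simp add: z_def)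
  have z_ge: "y \<le> z y" if "y \<le> d" for y
    using that a by (simp add: z_def)
  \<comment> \<open>\<open>(p - a * d) / (1 - a)\<close> solves \<open>z y = p\<close>, so
    \<open>y0\<close> is the least point from \<open>c\<close> on whose initial piece
    \<open>[y, z y]\<close> reaches the maximiser \<open>p\<close>.\<close>
  define y0 where "y0 = max c ((p - a * d) / (1 - a))"
  have y0_le: "y0 \<le> p"
  proof -
    have "p - a * d \<le> p * (1 - a)" using p a mult_left_mono[of p d a] by (simp add: algebra_simps)
    then show ?thesis using p a by (auto simp: y0_def field_simps)
  qed
  have z_y: "p \<le> z y" if "y0 \<le> y" for y
  proof -
    have "(p - a * d) / (1 - a) \<le> y" using that by (simp add: y0_def)
    then have "p - a * d \<le> y * (1 - a)" using a by (simp add: divide_le_eq)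
    then show ?thesis by (simp add: z_def algebra_simps)
  qed
  have main: "thesis" if y: "y0 \<le> y" "y \<le> p" and le: "\<psi> (z y) \<le> \<psi> y" and eq: "c < y \<Longrightarrow> \<psi> y = \<psi> (z y)" for y
  proof (rule select[of y "\<psi> (z y)"])
    show "c \<le> y" "y \<le> d" using y p by (auto simp: y0_def)
    then show "\<psi> (z y) \<le> \<psi> x" if "y \<le> x" "x \<le> y + a * (d - y)" for x
      using qc[of y x "z y"] that le by (simp add: z_def)
    show "\<psi> x \<le> \<psi> (z y)" if "y + a * (d - y) \<le> x" "x \<le> d" for x
      using decr[of "z y" x] z_y[OF y(1)] that by (simp add: z_def)
    show "\<psi> x \<le> \<psi> x'" if "c \<le> x" "x \<le> x'" "x' \<le> y" for x x'
      using incr that y by auto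
    show "\<psi> y \<le> \<psi> (z y)" if "c < y" using eq[OF that] by simp
  qed
  \<comment> \<open>A zero of \<open>g\<close> puts both ends of the piece on one level. If
    \<open>g y0\<close> is already nonpositive, then either \<open>y0 = c\<close>, where equal
    levels are not demanded, or \<open>z y0 = p\<close> and maximality of \<open>p\<close> makes
    \<open>g y0 = 0\<close>.\<close>
  define g where "g y = \<psi> (z y) - \<psi> y" for y
  have gp: "g p \<le> 0" using decr[of p "z p"] z_ge[of p] z_le[of p] p by (simp add: g_def)
  show thesis
  proof (cases "g y0 \<le> 0")
    case True
    have "\<psi> y0 = \<psi> (z y0)" if "c < y0"
    proof -
      have "y0 = (p - a * d) / (1 - a)" using that by (auto simp: y0_def max_def split: if_splits)
      then have "y0 * (1 - a) = p - a * d" using a by simp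
      then have "z y0 = p" by (simp add: z_def algebra_simps)
      moreover have "\<psi> y0 \<le> \<psi> p" using y0_le p by (simp add: y0_def)
      ultimately show ?thesis using True by (simp add: g_def)
    qed
    then show thesis using main[of y0] y0_le True by (simp add: g_def)
  next
    case False
    have "continuous_on {y0..p} g"
      unfolding g_def z_def
      by (intro continuous_intros continuous_on_subset[OF cont] continuous_on_compose2[OF cont]) auto
    then obtain y where "y0 \<le> y" "y \<le> p" "g y = 0"
      using IVT2'[of g p 0 y0] gp False y0_le by auto
    then show thesis using main[of y] by (simp add: g_def)
  qed
qed

text \<open>
  The extremal \<open>X\<close> has density \<open>a\<close> up to \<open>y\<close> and fills the initial fraction \<open>a\<close> of
  \<open>[y, d]\<close>. To the right of \<open>y\<close> compare with the level \<open>t\<close>; to the left the function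
  increases, and the second mean value theorem turns the bounds on \<open>X \<inter> [x, d]\<close> into one on the
  integral.
\<close>
lemma quasiconcave_integral_bound:
  fixes \<psi> :: "real \<Rightarrow> real"
  assumes cont: "continuous_on UNIV \<psi>" and nonneg: "\<And>x. 0 \<le> \<psi> x"
    and qc: "\<And>x y z. x \<le> y \<Longrightarrow> y \<le> z \<Longrightarrow> min (\<psi> x) (\<psi> z) \<le> \<psi> y"
    and "c \<le> d" and a: "0 \<le> a" "a < 1"
    and X: "X \<in> sets borel" "\<And>y. c \<le> y \<Longrightarrow> y \<le> d \<Longrightarrow> measure lborel (X \<inter> {y..d}) \<le> a * (d - y)"
  obtains y where "c \<le> y" "y \<le> d"
    "integral {c..d} (\<lambda>x. indicator X x * \<psi> x)
       \<le> a * integral {c..y} \<psi> + integral {y..y + a * (d - y)} \<psi>"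
proof -
  from quasiconcave_interval_selection[OF cont qc \<open>c \<le> d\<close> a]
  obtain y t where y: "c \<le> y" "y \<le> d"
    and ge: "\<And>x. y \<le> x \<Longrightarrow> x \<le> y + a * (d - y) \<Longrightarrow> t \<le> \<psi> x"
    and le: "\<And>x. y + a * (d - y) \<le> x \<Longrightarrow> x \<le> d \<Longrightarrow> \<psi> x \<le> t"
    and incr: "\<And>x x'. c \<le> x \<Longrightarrow> x \<le> x' \<Longrightarrow> x' \<le> y \<Longrightarrow> \<psi> x \<le> \<psi> x'"
    and t: "c < y \<Longrightarrow> \<psi> y \<le> t" by blast
  define z where "z = y + a * (d - y)"
  have z: "y \<le> z" "z \<le> d" using y a mult_right_mono[of a 1 "d - y"] by (auto simp: z_def)
  have \<psi>_int: "\<psi> integrable_on {u..v}" for u v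
    using cont continuous_on_subset integrable_continuous_interval by blast
  note ind_int = integral_indicator_eq_measure
  define m where "m u v = measure lborel (X \<inter> {u..v})" for u v
  have m_int: "integral {u..v} (indicator X) = m u v" for u v
    using ind_int(2)[OF X(1)] by (simp add: m_def)
  have m_add: "m u v + m v w = m u w" if "u \<le> v" "v \<le> w" for u v w
    using Henstock_Kurzweil_Integration.integral_combine[OF that ind_int(1)[OF X(1)]]
    by (simp add: m_int)
  define e where "e = m y d"
  \<comment> \<open>Pointwise, \<open>(indicator X x - indicator {y..z} x) * (\<psi> x - t)\<close>
    is nonpositive: \<open>\<psi>\<close> is at least \<open>t\<close> on \<open>{y..z}\<close> and
    at most \<open>t\<close> on the rest of \<open>{y..d}\<close>.\<close>
  have right: "integral {y..d} (\<lambda>x. indicator X x * \<psi> x) - integral {y..z} \<psi> \<le> t * (e - (z - y))"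
  proof -
    have 1: "integral {y..z} \<psi> = integral {y..d} (\<lambda>x. indicator {y..z} x * \<psi> x)"
    proof -
      have "integral {y..d} (\<lambda>x. indicator {y..z} x * \<psi> x) = integral {y..d} (\<lambda>x. if x \<in> {y..z} then \<psi> x else 0)"
        by (intro integral_cong) auto
      also have "\<dots> = integral {y..z} \<psi>"
        using z by (simp only: integral_restrict_Int) (simp add: Int_absorb1)
      finally show ?thesis by simp
    qed
    have "integral {y..d} (\<lambda>x. (indicator X x - indicator {y..z} x) * \<psi> x)
       = integral {y..d} (\<lambda>x. indicator X x * \<psi> x) - integral {y..d} (\<lambda>x. indicator {y..z} x * \<psi> x)"
      using integral_diff[OF indicator_mult_integrable_on(2)[OF X(1) cont]
          indicator_mult_integrable_on(2)[OF _ cont], of "{y..z}" y d]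
      by (simp add: left_diff_distrib)
    moreover have "integral {y..d} (\<lambda>x. (indicator X x - indicator {y..z} x) * \<psi> x)
      \<le> integral {y..d} (\<lambda>x. (indicator X x - indicator {y..z} x) * t)"
    proof (rule integral_le)
      show "(\<lambda>x. (indicator X x - indicator {y..z} x) * \<psi> x) integrable_on {y..d}"
        using integrable_diff[OF indicator_mult_integrable_on(2)[OF X(1) cont]
            indicator_mult_integrable_on(2)[OF _ cont], of "{y..z}" y d]
        by (simp add: left_diff_distrib)
      show "(\<lambda>x. (indicator X x - indicator {y..z} x) * t) integrable_on {y..d}"
        using integrable_diff[OF indicator_mult_integrable_on(2)[OF X(1), of "\<lambda>_. t"]
            indicator_mult_integrable_on(2)[of "{y..z}" "\<lambda>_. t"], of y d]
        by (simp add: left_diff_distrib)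
      show "(indicator X x - indicator {y..z} x) * \<psi> x \<le> (indicator X x - indicator {y..z} x) * t"
        if "x \<in> {y..d}" for x
        using that ge[of x] le[of x] by (auto simp: z_def indicator_def)
    qed
    moreover have "integral {y..d} (\<lambda>x. (indicator X x - indicator {y..z} x) * t) = t * (e - (z - y))"
    proof -
      have "((\<lambda>x. indicator X x - indicator {y..z} x :: real) has_integral (e - (z - y))) {y..d}"
        using has_integral_diff[OF integrable_integral integrable_integral,
            OF ind_int(1)[OF X(1)] ind_int(1)[of "{y..z}"], of y d]
        using ind_int(2)[of "{y..z}" y d] z
        by (simp add: m_int e_def Int_absorb1 inf.absorb1)
      from integral_unique[OF has_integral_mult_left[OF this, of t]] show ?thesis
        by (simp add: mult.commute[of t "e - (z - y)"])
    qed
    ultimately show ?thesis using 1 by linarith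
  qed
  \<comment> \<open>\<open>z - y - e\<close> is the length by which \<open>X\<close> falls short of
    filling the initial piece of \<open>[y, d]\<close>. By \<open>slack\<close> it also bounds the
    excess of \<open>X\<close> over density \<open>a\<close> on every \<open>[u, y]\<close>, and
    these final segments are what the second mean value theorem tests for increasing
    \<open>\<psi>\<close>. The errors on the two sides of \<open>y\<close> then cancel.\<close>
  have left: "integral {c..y} (\<lambda>x. indicator X x * \<psi> x) - a * integral {c..y} \<psi> \<le> t * (z - y - e)"
  proof (cases "c = y")
    case True
    have "\<psi> z \<le> t" "t \<le> \<psi> z" using ge[of z] le[of z] z by (auto simp: z_def)
    then have "0 \<le> t" using nonneg[of z] by linarith
    moreover have "e \<le> z - y" using X(2)[of y] y by (simp add: e_def m_def z_def)
    ultimately show ?thesis using True by simp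
  next
    case False
    then have "c < y" using y by simp
    define \<rho> where "\<rho> x = indicator X x - a" for x :: real
    have \<rho>_has: "(\<rho> has_integral (m u v - a * (v - u))) {u..v}" if "u \<le> v" for u v
    proof -
      have "((\<lambda>x. a) has_integral a * (v - u)) {u..v}"
        using has_integral_const_real[of a u v] that by (simp add: mult.commute)
      then show ?thesis
        unfolding \<rho>_def
        using has_integral_diff[OF integrable_integral[OF ind_int(1)[OF X(1)]]] by (simp add: m_int)
    qed
    have slack: "m u y - a * (y - u) \<le> z - y - e" if "c \<le> u" "u \<le> y" for u
    proof -
      have "m u y + e \<le> a * (d - u)"
        using m_add[of u y d] X(2)[of u] that y by (simp add: e_def m_def)
      then show ?thesis by (simp add: z_def algebra_simps)
    qed
    obtain \<xi> where \<xi>: "\<xi> \<in> {c..y}"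
      and eq: "((\<lambda>x. \<psi> x * \<rho> x) has_integral (\<psi> c * integral {c..\<xi>} \<rho> + \<psi> y * integral {\<xi>..y} \<rho>)) {c..y}"
      using second_mean_value_theorem_full[of \<rho> c y \<psi>] \<rho>_has[OF y(1)] incr y(1) by blast
    have i\<rho>: "integral {u..v} \<rho> = m u v - a * (v - u)" if "u \<le> v" for u v
      using \<rho>_has[OF that] by (rule integral_unique)
    have i1: "integral {c..\<xi>} \<rho> = (m c y - a * (y - c)) - (m \<xi> y - a * (y - \<xi>))"
      using i\<rho>[of c \<xi>] m_add[of c \<xi> y] \<xi> by (simp add: algebra_simps)
    have "\<psi> c * integral {c..\<xi>} \<rho> + \<psi> y * integral {\<xi>..y} \<rho>
      = \<psi> c * (m c y - a * (y - c)) + (\<psi> y - \<psi> c) * (m \<xi> y - a * (y - \<xi>))"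
      using \<xi> by (simp only: i1 i\<rho>[of \<xi> y] atLeastAtMost_iff) (simp add: algebra_simps)
    also have "\<dots> \<le> \<psi> c * (z - y - e) + (\<psi> y - \<psi> c) * (z - y - e)"
      using slack[of c] slack[of \<xi>] \<xi> y nonneg[of c] incr[of c y]
      by (intro add_mono mult_left_mono) auto
    also have "\<dots> = \<psi> y * (z - y - e)" by (simp add: algebra_simps)
    also have "\<dots> \<le> t * (z - y - e)"
      using t[OF \<open>c < y\<close>] X(2)[of y] y by (intro mult_right_mono) (auto simp: e_def m_def z_def)
    finally have "integral {c..y} (\<lambda>x. \<psi> x * \<rho> x) \<le> t * (z - y - e)"
      using eq by (simp add: integral_unique)
    moreover have "integral {c..y} (\<lambda>x. \<psi> x * \<rho> x)
      = integral {c..y} (\<lambda>x. indicator X x * \<psi> x) - a * integral {c..y} \<psi>"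
    proof -
      have "(\<lambda>x. \<psi> x * \<rho> x) = (\<lambda>x. indicator X x * \<psi> x - a * \<psi> x)"
        by (auto simp: \<rho>_def algebra_simps)
      then show ?thesis
        using integral_diff[OF indicator_mult_integrable_on(2)[OF X(1) cont, of c y] integrable_on_cmult_left[OF \<psi>_int, of a c y]]
        by simp
    qed
    ultimately show ?thesis by simp
  qed
  have "integral {c..d} (\<lambda>x. indicator X x * \<psi> x)
     = integral {c..y} (\<lambda>x. indicator X x * \<psi> x) + integral {y..d} (\<lambda>x. indicator X x * \<psi> x)"
    using Henstock_Kurzweil_Integration.integral_combine[OF y indicator_mult_integrable_on(2)[OF X(1) cont]] by simp
  moreover have "t * (z - y - e) + t * (e - (z - y)) = 0" by (simp add: algebra_simps)
  ultimately have "integral {c..d} (\<lambda>x. indicator X x * \<psi> x) \<le> a * integral {c..y} \<psi> + integral {y..z} \<psi>"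
    using left right by linarith
  then show thesis using that[OF y] by (simp add: z_def)
qed

subsection \<open>The dilation inequality on the line\<close>

text \<open>The sentinels \<open>-R\<close> and \<open>R\<close> keep the two sets nonempty, so that
  supremum and infimum are attained. The last clause says that all points of a gap have the same
  gap, hence two gaps are equal or disjoint.\<close>

lemma gap_around:
  fixes B :: "real set" and R :: real
  assumes "compact B" "B \<subseteq> {-R<..<R}"
  defines "lo \<equiv> \<lambda>x. Sup (insert (-R) (B \<inter> {..x}))" and "hi \<equiv> \<lambda>x. Inf (insert R (B \<inter> {x..}))"
  assumes x: "x \<notin> B" "-R < x" "x < R"
  shows "lo x < x" "x < hi x" "lo x \<in> insert (-R) B" "hi x \<in> insert R B"
    "B \<inter> {lo x<..<hi x} = {}"
    "\<And>y. lo x < y \<Longrightarrow> y < hi x \<Longrightarrow> lo y = lo x \<and> hi y = hi x"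
proof -
  have cl: "closed (insert (-R) (B \<inter> {..x}))" "closed (insert R (B \<inter> {x..}))"
    by (intro closed_insert closed_Int compact_imp_closed[OF assms(1)] closed_atMost closed_atLeast)+
  have bd: "bdd_above (insert (-R) (B \<inter> {..x}))" "bdd_below (insert R (B \<inter> {x..}))"
    by auto
  have lo: "lo x \<in> insert (-R) (B \<inter> {..x})" unfolding lo_def
    using closed_contains_Sup[OF _ bd(1) cl(1)] by simp
  have hi: "hi x \<in> insert R (B \<inter> {x..})" unfolding hi_def
    using closed_contains_Inf[OF _ bd(2) cl(2)] by simp
  show "lo x < x" "x < hi x" using lo hi x by (auto simp: less_le)
  show "lo x \<in> insert (-R) B" "hi x \<in> insert R B" using lo hi by auto
  have le_lo: "z \<le> lo x" if "z \<in> B" "z \<le> x" for z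
    unfolding lo_def using that bd by (intro cSup_upper) auto
  have hi_le: "hi x \<le> z" if "z \<in> B" "x \<le> z" for z
    unfolding hi_def using that bd by (intro cInf_lower) auto
  show disj: "B \<inter> {lo x<..<hi x} = {}"
    using le_lo hi_le by (force simp: disjoint_iff)
  show "lo y = lo x \<and> hi y = hi x" if y: "lo x < y" "y < hi x" for y
  proof -
    have "z \<le> x \<longleftrightarrow> z \<le> y" "x \<le> z \<longleftrightarrow> y \<le> z" if "z \<in> B" for z
      using le_lo[OF that] hi_le[OF that] y \<open>lo x < x\<close> \<open>x < hi x\<close> x that by force+
    then have "B \<inter> {..y} = B \<inter> {..x}" "B \<inter> {y..} = B \<inter> {x..}" by auto
    then show ?thesis by (simp add: lo_def hi_def)
  qed
qed

text \<open>What a body passes on to its projection. The concavity inequality is stated for closed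
  intervals because their preimages in a compact body are compact; \<open>no_atoms\<close> lets
  adjacent pieces share an endpoint, and the bounded support lets half-lines be cut to
  intervals.\<close>

locale interval_concave = finite_measure \<nu> for \<nu> :: "real measure" +
  fixes s R :: real
  assumes s_neg: "s < 0" and R_pos: "0 < R"
    and sets_eq [simp, measurable_cong]: "sets \<nu> = sets borel"
    and no_atoms: "measure \<nu> {x} = 0"
    and support: "measure \<nu> (- {-R..R}) = 0"
    and brunn: "x \<le> x' \<Longrightarrow> y \<le> y' \<Longrightarrow> 0 \<le> a \<Longrightarrow> a \<le> 1 \<Longrightarrow>
      0 < measure \<nu> {x..x'} \<Longrightarrow> 0 < measure \<nu> {y..y'} \<Longrightarrow>
      pmean s a (measure \<nu> {x..x'}) (measure \<nu> {y..y'})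
        \<le> measure \<nu> {a * x + (1 - a) * y..a * x' + (1 - a) * y'}"
begin

lemma space_eq [simp]: "space \<nu> = UNIV"
  using sets_eq_imp_space_eq[OF sets_eq] by simp

lemma measure_mono:
  assumes "A \<subseteq> B" "B \<in> sets borel"
  shows "measure \<nu> A \<le> measure \<nu> B"
  using finite_measure_mono[of A B] assms by simp

lemma measure_Un_null:
  assumes "A \<in> sets borel" "N \<in> sets borel" "measure \<nu> N = 0"
  shows "measure \<nu> (A \<union> N) = measure \<nu> A"
  using measure_Un_le[of A \<nu> N] measure_mono[of A "A \<union> N"] assms by auto

lemma measure_split:
  assumes "X \<in> sets borel" "p \<le> (q::real)"
  shows "measure \<nu> (X \<inter> {p..}) = measure \<nu> (X \<inter> {p..q}) + measure \<nu> (X \<inter> {q..})"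
proof -
  have "measure \<nu> (X \<inter> {p..}) = measure \<nu> ((X \<inter> {p..<q}) \<union> (X \<inter> {q..}))"
    using assms by (intro arg_cong[where f="measure \<nu>"]) auto
  also have "\<dots> = measure \<nu> (X \<inter> {p..<q}) + measure \<nu> (X \<inter> {q..})"
    using assms by (intro finite_measure_Union) auto
  also have "measure \<nu> (X \<inter> {p..<q}) = measure \<nu> (X \<inter> {p..q})"
  proof (rule antisym)
    have "measure \<nu> (X \<inter> {p..q}) \<le> measure \<nu> (X \<inter> {p..<q} \<union> {q})"
      using assms by (intro measure_mono) auto
    then show "measure \<nu> (X \<inter> {p..q}) \<le> measure \<nu> (X \<inter> {p..<q})"
      using measure_Un_null[of "X \<inter> {p..<q}" "{q}"] assms no_atoms by simp
  qed (use assms in \<open>auto intro!: measure_mono\<close>)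
  finally show ?thesis .
qed

lemma measure_split_interval:
  assumes "X \<in> sets borel" "p \<le> (q::real)" "q \<le> r"
  shows "measure \<nu> (X \<inter> {p..r}) = measure \<nu> (X \<inter> {p..q}) + measure \<nu> (X \<inter> {q..r})"
proof -
  have "{..r} \<inter> {p..} = {p..r}" "{..r} \<inter> {q..} = {q..r}" by auto
  then show ?thesis
    using measure_split[of "X \<inter> {..r}" p q] assms
    by (simp add: Int_assoc)
qed

lemma measure_tail_Int: "measure \<nu> {x..R} = measure \<nu> {x..}"
proof (rule antisym)
  have "measure \<nu> {x..} \<le> measure \<nu> ({x..R} \<union> - {-R..R})"
    by (intro measure_mono) auto
  then show "measure \<nu> {x..} \<le> measure \<nu> {x..R}"
    using measure_Un_null[of "{x..R}" "- {-R..R}"] support by simp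
qed (auto intro!: measure_mono)

text \<open>Without atoms the distribution function is continuous, hence uniformly continuous on
  \<open>{-R..R}\<close>; it is constant on either side of this interval, so clamping by
  \<open>cl\<close> changes nothing.\<close>

lemma uniformly_small:
  assumes "0 < e"
  obtains w0 where "0 < w0" "\<And>x w. 0 \<le> w \<Longrightarrow> w \<le> w0 \<Longrightarrow> measure \<nu> {x..x + w} < e"
proof -
  interpret finite_borel_measure \<nu> by unfold_locales auto
  define cl where "cl x = max (-R) (min R x)" for x
  have F: "measure \<nu> {x..y} = cdf \<nu> y - cdf \<nu> x" if "x \<le> y" for x y
  proof -
    have "measure \<nu> {x..y} = measure \<nu> ({x<..y} \<union> {x})"
      using that by (intro arg_cong[where f="measure \<nu>"]) auto
    then show ?thesis
      using measure_Un_null[of "{x<..y}" "{x}"] no_atoms cdf_diff_eq[of x y] that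
      by (cases "x = y") auto
  qed
  have sub: "measure \<nu> X = 0" if "X \<subseteq> - {-R<..<R}" "X \<in> sets borel" for X
  proof -
    have "measure \<nu> X \<le> measure \<nu> (- {-R..R} \<union> {-R} \<union> {R})"
      using that by (intro measure_mono) auto
    also have "\<dots> = 0" using support no_atoms measure_Un_null[of "- {-R..R}" "{-R}"]
        measure_Un_null[of "- {-R..R} \<union> {-R}" "{R}"] by simp
    finally show ?thesis by (simp add: measure_le_0_iff)
  qed
  have cl: "cdf \<nu> (cl x) = cdf \<nu> x" for x
  proof -
    consider "x < -R" | "x > R" | "-R \<le> x \<and> x \<le> R" by linarith
    then show ?thesis
    proof cases
      case 1
      then have "cl x = -R" using R_pos by (simp add: cl_def)
      moreover have "measure \<nu> {x..-R} = 0" using R_pos by (intro sub) auto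
      ultimately show ?thesis using F[of x "-R"] 1 by simp
    next
      case 2
      then have "cl x = R" using R_pos by (simp add: cl_def)
      moreover have "measure \<nu> {R..x} = 0" by (intro sub) auto
      ultimately show ?thesis using F[of R x] 2 by simp
    next
      case 3
      then show ?thesis by (simp add: cl_def)
    qed
  qed
  have "isCont (cdf \<nu>) x" for x using isCont_cdf no_atoms by simp
  then have "uniformly_continuous_on {-R..R} (cdf \<nu>)"
    by (intro compact_uniformly_continuous continuous_at_imp_continuous_on) auto
  then obtain d where d: "d > 0"
    and dd: "\<And>x y. x \<in> {-R..R} \<Longrightarrow> y \<in> {-R..R} \<Longrightarrow> dist y x < d \<Longrightarrow> dist (cdf \<nu> y) (cdf \<nu> x) < e"
    using assms unfolding uniformly_continuous_on_def by metis
  show thesis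
  proof (rule that[of "d / 2"])
    show "measure \<nu> {x..x + w} < e" if "0 \<le> w" "w \<le> d / 2" for x w
    proof -
      have "dist (cl (x + w)) (cl x) < d" using that d by (auto simp: cl_def dist_real_def)
      then have "dist (cdf \<nu> (cl (x + w))) (cdf \<nu> (cl x)) < e"
        using R_pos by (intro dd) (auto simp: cl_def)
      then show ?thesis using F[of x "x + w"] that by (simp add: cl dist_real_def)
    qed
  qed (use d in auto)
qed

lemma continuous_measure_tail:
  assumes "X \<in> sets borel"
  shows "continuous_on A (\<lambda>p. measure \<nu> (X \<inter> {p..}))"
proof (rule uniformly_continuous_imp_continuous, unfold uniformly_continuous_on_def, safe)
  fix e :: real assume "0 < e"
  then obtain w0 where w0: "0 < w0" "\<And>x w. 0 \<le> w \<Longrightarrow> w \<le> w0 \<Longrightarrow> measure \<nu> {x..x + w} < e"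
    using uniformly_small by blast
  have *: "\<bar>measure \<nu> (X \<inter> {p..}) - measure \<nu> (X \<inter> {q..})\<bar> < e" if "p \<le> q" "q \<le> p + w0" for p q
  proof -
    have "measure \<nu> (X \<inter> {p..q}) \<le> measure \<nu> {p..q}" by (intro measure_mono) auto
    moreover have "measure \<nu> {p..q} < e" using w0(2)[of "q - p" p] that by simp
    ultimately show ?thesis using measure_split[OF assms that(1)] by simp
  qed
  have "dist (measure \<nu> (X \<inter> {q..})) (measure \<nu> (X \<inter> {p..})) < e" if "dist q p < w0" for p q
    using *[of p q] *[of q p] that by (cases "p \<le> q") (auto simp: dist_real_def)
  then show "\<exists>d>0. \<forall>x\<in>A. \<forall>x'\<in>A. dist x' x < d \<longrightarrow>
      dist (measure \<nu> (X \<inter> {x'..})) (measure \<nu> (X \<inter> {x..})) < e"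
    using w0(1) by blast
qed

section \<open>Masses of windows of fixed length\<close>

lemma continuous_window:
  assumes "0 \<le> w"
  shows "continuous_on A (\<lambda>x. measure \<nu> {x..x + w})"
proof -
  have "measure \<nu> {x..x + w} = measure \<nu> (UNIV \<inter> {x..}) - measure \<nu> (UNIV \<inter> {x + w..})" for x
    using measure_split[of UNIV x "x + w"] assms by simp
  moreover have "continuous_on A (\<lambda>x. measure \<nu> (UNIV \<inter> {x + w..}))"
    by (rule continuous_on_compose2[OF continuous_measure_tail[of UNIV UNIV]]) (auto intro!: continuous_intros)
  ultimately show ?thesis
    using continuous_measure_tail[of UNIV A] by (simp add: continuous_on_diff)
qed

text \<open>\<open>{y..y + w}\<close> is the Minkowski combination of the two outer windows with
  weight \<open>a\<close>, and a power mean is at least the minimum.\<close>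

lemma quasiconcave_window:
  assumes "0 \<le> w" "x \<le> y" "y \<le> z"
  shows "min (measure \<nu> {x..x + w}) (measure \<nu> {z..z + w}) \<le> measure \<nu> {y..y + w}"
proof (cases "x < z \<and> 0 < measure \<nu> {x..x + w} \<and> 0 < measure \<nu> {z..z + w}")
  case True
  define a where "a = (z - y) / (z - x)"
  have a: "0 \<le> a" "a \<le> 1" "a * (z - x) = z - y" using assms True by (auto simp: a_def field_simps)
  then have y: "a * x + (1 - a) * z = y" by (simp add: algebra_simps)
  then have y': "a * (x + w) + (1 - a) * (z + w) = y + w" by (simp add: algebra_simps)
  interpret neg_power_mean s a using s_neg a by unfold_locales
  show ?thesis
    using brunn[of x "x + w" z "z + w" a] pmean_ge_min[of "measure \<nu> {x..x + w}" "measure \<nu> {z..z + w}"]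
      True a assms(1) by (simp add: y y')
next
  case False
  then have "x = z \<or> measure \<nu> {x..x + w} = 0 \<or> measure \<nu> {z..z + w} = 0"
    using assms by (auto simp: zero_less_measure_iff)
  then show ?thesis using assms by auto
qed

text \<open>Integrating window masses over left ends in \<open>X\<close> weights a point
  \<open>y\<close> by the length of \<open>X\<close> in \<open>{y - w..y}\<close>. The weight never
  exceeds \<open>w\<close> and equals \<open>w\<close> when that interval lies in \<open>X\<close>;
  up to a strip of width \<open>w\<close> and the factor \<open>w\<close>, window integrals
  therefore stand for values of \<open>\<nu>\<close>.\<close>

lemma window_Fubini:
  assumes X: "X \<in> sets borel"
  shows "(\<integral>\<^sup>+x. indicator X x * emeasure \<nu> {x..x + w} \<partial>lborel)
       = (\<integral>\<^sup>+y. emeasure lborel (X \<inter> {y - w..y}) \<partial>\<nu>)"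
proof -
  interpret P: pair_sigma_finite lborel \<nu>
    by unfold_locales
  define f :: "real \<Rightarrow> real \<Rightarrow> ennreal" where "f x y = indicator X x * indicator {x..x + w} y" for x y
  have "f = (\<lambda>x y. indicator X x * indicator {p. fst p \<le> snd p \<and> snd p \<le> fst p + w} (x, y))"
    by (auto simp: f_def fun_eq_iff indicator_def)
  then have "(\<lambda>(x, y). f x y) = (\<lambda>p. indicator X (fst p) * indicator {p. fst p \<le> snd p \<and> snd p \<le> fst p + w} p)"
    by (auto simp: fun_eq_iff)
  also have "\<dots> \<in> borel_measurable (borel \<Otimes>\<^sub>M borel)"
    using X by measurable
  finally have "(\<lambda>(x, y). f x y) \<in> borel_measurable (lborel \<Otimes>\<^sub>M \<nu>)"
    by (simp cong: measurable_cong_sets add: sets_pair_measure_cong[of lborel borel \<nu> borel])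
  from P.Fubini'[OF this]
  have "(\<integral>\<^sup>+ x. (\<integral>\<^sup>+ y. f x y \<partial>\<nu>) \<partial>lborel) = (\<integral>\<^sup>+ y. (\<integral>\<^sup>+ x. f x y \<partial>lborel) \<partial>\<nu>)" by simp
  moreover have "(\<integral>\<^sup>+ y. f x y \<partial>\<nu>) = indicator X x * emeasure \<nu> {x..x + w}" for x
    by (simp add: f_def nn_integral_cmult)
  moreover have "(\<integral>\<^sup>+ x. f x y \<partial>lborel) = emeasure lborel (X \<inter> {y - w..y})" for y
  proof -
    have "(\<integral>\<^sup>+ x. f x y \<partial>lborel) = (\<integral>\<^sup>+ x. indicator (X \<inter> {y - w..y}) x \<partial>lborel)"
      by (intro nn_integral_cong) (auto simp: f_def indicator_def)
    then show ?thesis using X by simp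
  qed
  ultimately show ?thesis by simp
qed

lemma window_integral:
  assumes X: "X \<in> sets borel" and "0 \<le> w"
  shows "ennreal (integral {c..d} (\<lambda>x. indicator X x * measure \<nu> {x..x + w}))
    = (\<integral>\<^sup>+y. emeasure lborel (X \<inter> {c..d} \<inter> {y - w..y}) \<partial>\<nu>)"
proof -
  let ?f = "\<lambda>x. indicator X x * measure \<nu> {x..x + w}"
  have i: "set_integrable lborel {c..d} ?f"
    by (rule indicator_mult_integrable_on(1)[OF X continuous_window[OF assms(2)]])
  have "ennreal (integral {c..d} ?f) = ennreal (LINT x|lborel. indicator {c..d} x *\<^sub>R ?f x)"
    using set_borel_integral_eq_integral(2)[OF i] by (simp add: set_lebesgue_integral_def)
  also have "\<dots> = (\<integral>\<^sup>+x. ennreal (indicator {c..d} x *\<^sub>R ?f x) \<partial>lborel)"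
    using i by (intro nn_integral_eq_integral[symmetric]) (auto simp: set_integrable_def)
  also have "\<dots> = (\<integral>\<^sup>+x. indicator (X \<inter> {c..d}) x * emeasure \<nu> {x..x + w} \<partial>lborel)"
    by (intro nn_integral_cong) (auto simp: indicator_def emeasure_eq_measure)
  also have "\<dots> = (\<integral>\<^sup>+y. emeasure lborel (X \<inter> {c..d} \<inter> {y - w..y}) \<partial>\<nu>)"
    using X by (intro window_Fubini) auto
  finally show ?thesis .
qed

lemma window_integral_le:
  assumes "0 \<le> w" "u \<le> v"
  shows "integral {u..v} (\<lambda>x. measure \<nu> {x..x + w}) \<le> w * measure \<nu> {u..v + w}"
proof -
  have "ennreal (integral {u..v} (\<lambda>x. measure \<nu> {x..x + w}))
    = (\<integral>\<^sup>+y. emeasure lborel ({u..v} \<inter> {y - w..y}) \<partial>\<nu>)"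
    using window_integral[of UNIV w u v] assms by simp
  also have "\<dots> \<le> (\<integral>\<^sup>+y. ennreal w * indicator {u..v + w} y \<partial>\<nu>)"
  proof (intro nn_integral_mono)
    fix y
    show "emeasure lborel ({u..v} \<inter> {y - w..y}) \<le> ennreal w * indicator {u..v + w} y"
    proof (cases "y \<in> {u..v + w}")
      case True
      have "emeasure lborel ({u..v} \<inter> {y - w..y}) \<le> emeasure lborel {y - w..y}"
        by (intro emeasure_mono) auto
      then show ?thesis using True assms by simp
    next
      case False
      then have "{u..v} \<inter> {y - w..y} = {}" by auto
      then show ?thesis by simp
    qed
  qed
  also have "\<dots> = ennreal (w * measure \<nu> {u..v + w})"
    using assms by (simp add: nn_integral_cmult emeasure_eq_measure ennreal_mult)
  finally show ?thesis using assms by (simp add: ennreal_le_iff)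
qed

lemma window_integral_ge:
  assumes "0 \<le> w" and X: "X \<in> sets borel" and F: "F \<in> sets borel"
    and sub: "\<And>y. y \<in> F \<Longrightarrow> {y - w..y} \<subseteq> X \<inter> {c..d}"
  shows "w * measure \<nu> F \<le> integral {c..d} (\<lambda>x. indicator X x * measure \<nu> {x..x + w})"
proof -
  have "ennreal (w * measure \<nu> F) = (\<integral>\<^sup>+y. ennreal w * indicator F y \<partial>\<nu>)"
    using assms by (simp add: nn_integral_cmult emeasure_eq_measure ennreal_mult)
  also have "\<dots> \<le> (\<integral>\<^sup>+y. emeasure lborel (X \<inter> {c..d} \<inter> {y - w..y}) \<partial>\<nu>)"
  proof (intro nn_integral_mono)
    fix y
    show "ennreal w * indicator F y \<le> emeasure lborel (X \<inter> {c..d} \<inter> {y - w..y})"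
      using sub[of y] assms(1) by (cases "y \<in> F") (auto simp: Int_absorb1)
  qed
  also have "\<dots> = ennreal (integral {c..d} (\<lambda>x. indicator X x * measure \<nu> {x..x + w}))"
    by (rule window_integral[OF X assms(1), symmetric])
  finally show ?thesis
    by (subst (asm) ennreal_le_iff)
      (auto intro!: integral_nonneg indicator_mult_integrable_on(2) X continuous_window assms(1))
qed

section \<open>Half-lines and the bound for one side of a gap\<close>

lemma tail_mono: "p \<le> q \<Longrightarrow> measure \<nu> {q..} \<le> measure \<nu> {p..}"
  by (intro measure_mono) auto

lemma measure_interval_tail: "p \<le> q \<Longrightarrow> measure \<nu> {p..q} = measure \<nu> {p..} - measure \<nu> {q..}"
  using measure_split[of UNIV p q] by simp

text \<open>Both half-lines are cut at \<open>R\<close>. The combination of two right ends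
  \<open>R\<close> is again \<open>R\<close>, so the interval inequality returns a
  half-line.\<close>

lemma brunn_tail:
  assumes "0 < measure \<nu> {d..}" "y \<le> d" "0 \<le> a" "a \<le> 1"
  shows "pmean s a (measure \<nu> {d..}) (measure \<nu> {y..}) \<le> measure \<nu> {y + a * (d - y)..}"
proof -
  have "d \<le> R"
  proof (rule ccontr)
    assume "\<not> d \<le> R"
    then have "{d..R} = {}" by simp
    then show False using assms(1) measure_tail_Int[of d] by simp
  qed
  moreover have "0 < measure \<nu> {y..R}"
    using tail_mono[OF assms(2)] assms(1) by (simp add: measure_tail_Int)
  ultimately have "pmean s a (measure \<nu> {d..R}) (measure \<nu> {y..R})
    \<le> measure \<nu> {a * d + (1 - a) * y..a * R + (1 - a) * R}"
    using assms by (intro brunn) (auto simp: measure_tail_Int)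
  moreover have "a * d + (1 - a) * y = y + a * (d - y)" "a * R + (1 - a) * R = R"
    by (simp_all add: algebra_simps)
  ultimately show ?thesis by (simp add: measure_tail_Int)
qed

text \<open>
  The measure need not be given by a density here, so the window measures \<open>\<nu> [x, x + w]\<close>, which
  are quasiconcave in \<open>x\<close>, replace it. Averaging over a window spreads \<open>F\<close> by \<open>w\<close>, whence the
  thicker set \<open>X\<close>.
\<close>
lemma one_sided_bound:
  assumes "c \<le> d" and a: "0 \<le> a" "a < 1" and F: "F \<in> sets borel" and X: "X \<in> sets borel"
    and "0 < \<epsilon>" and thick: "\<And>y. y \<in> F \<Longrightarrow> {y - \<epsilon>..y} \<subseteq> X"
    and sparse: "\<And>y. c \<le> y \<Longrightarrow> y \<le> d \<Longrightarrow> measure lborel (X \<inter> {y..d}) \<le> a * (d - y)"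
    and pos: "0 < measure \<nu> {d..}"
  shows "measure \<nu> (F \<inter> {c..d})
    \<le> measure \<nu> {c..} - pmean s a (measure \<nu> {d..}) (measure \<nu> {c..})"
proof (rule field_le_epsilon)
  \<comment> \<open>Three errors of at most \<open>e / 3\<close> occur: the part of \<open>F\<close>
    in \<open>{c..c + w}\<close>, whose windows may start to the left of \<open>c\<close>, and the
    overhangs of the windows beyond \<open>y\<close> and \<open>z\<close>.\<close>
  fix e :: real assume "0 < e"
  then obtain w0 where w0: "0 < w0"
    and small: "\<And>x w. 0 \<le> w \<Longrightarrow> w \<le> w0 \<Longrightarrow> measure \<nu> {x..x + w} < e / 3"
    using uniformly_small[of "e / 3"] by auto
  define w where "w = min w0 \<epsilon>"
  have w: "0 < w" "w \<le> w0" "w \<le> \<epsilon>" using w0 \<open>0 < \<epsilon>\<close> by (auto simp: w_def)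
  obtain y where y: "c \<le> y" "y \<le> d"
    and le: "integral {c..d} (\<lambda>x. indicator X x * measure \<nu> {x..x + w})
       \<le> a * integral {c..y} (\<lambda>x. measure \<nu> {x..x + w})
         + integral {y..y + a * (d - y)} (\<lambda>x. measure \<nu> {x..x + w})"
    using quasiconcave_integral_bound[of "\<lambda>x. measure \<nu> {x..x + w}" c d a X]
      continuous_window quasiconcave_window w assms(1) a X sparse by (auto simp: less_imp_le)
  define z where "z = y + a * (d - y)"
  have z: "y \<le> z" using y a by (simp add: z_def)
  have "w * measure \<nu> (F \<inter> {c + w..d}) \<le> integral {c..d} (\<lambda>x. indicator X x * measure \<nu> {x..x + w})"
    using w F X thick by (intro window_integral_ge) force+
  also note le[folded z_def]
  also have "a * integral {c..y} (\<lambda>x. measure \<nu> {x..x + w}) + integral {y..z} (\<lambda>x. measure \<nu> {x..x + w})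
     \<le> a * (w * measure \<nu> {c..y + w}) + w * measure \<nu> {y..z + w}"
    using w y z a by (intro add_mono mult_left_mono window_integral_le) auto
  finally have "w * measure \<nu> (F \<inter> {c + w..d}) \<le> w * (a * measure \<nu> {c..y + w} + measure \<nu> {y..z + w})"
    by (simp add: z_def algebra_simps)
  then have 1: "measure \<nu> (F \<inter> {c + w..d}) \<le> a * measure \<nu> {c..y + w} + measure \<nu> {y..z + w}"
    using w by simp
  have ext: "measure \<nu> {p..q + w} \<le> measure \<nu> {p..q} + e / 3" if "p \<le> q" for p q
    using measure_split_interval[of UNIV p q "q + w"] small[of w q] that w by simp
  have "measure \<nu> (F \<inter> {c..d}) \<le> measure \<nu> (F \<inter> {c + w..d} \<union> {c..c + w})"
    using F by (intro measure_mono) auto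
  also have "\<dots> \<le> measure \<nu> (F \<inter> {c + w..d}) + measure \<nu> {c..c + w}"
    using F by (intro measure_Un_le) auto
  also have "\<dots> \<le> a * (measure \<nu> {c..y} + e / 3) + (measure \<nu> {y..z} + e / 3) + e / 3"
    using ext[OF y(1)] ext[OF z] small[of w c] w 1 a mult_left_mono[OF ext[OF y(1)], of a] by linarith
  also have "\<dots> \<le> a * measure \<nu> {c..y} + measure \<nu> {y..z} + e"
    using a \<open>0 < e\<close> mult_right_mono[of a 1 "e / 3"] unfolding distrib_left by linarith
  finally have 2: "measure \<nu> (F \<inter> {c..d}) \<le> a * measure \<nu> {c..y} + measure \<nu> {y..z} + e" .
  interpret neg_power_mean s a using s_neg a by unfold_locales auto
  have "pmean s a (measure \<nu> {d..}) (measure \<nu> {y..}) \<le> measure \<nu> {z..}"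
    using brunn_tail[OF pos y(2)] a by (simp add: z_def)
  \<comment> \<open>Moving the mean from \<open>y\<close> to \<open>c\<close> costs at most
    \<open>1 - a\<close> times the mass between them. The bound already charges
    \<open>{c..y}\<close> with the factor \<open>a\<close>, so the two add up to a bound in which
    \<open>y\<close> no longer occurs.\<close>
  moreover have "pmean s a (measure \<nu> {d..}) (measure \<nu> {c..}) - pmean s a (measure \<nu> {d..}) (measure \<nu> {y..})
      \<le> (1 - a) * (measure \<nu> {c..} - measure \<nu> {y..})"
    using pos y tail_mono by (intro pmean_snd_slope) auto
  ultimately have "a * measure \<nu> {c..y} + measure \<nu> {y..z}
     \<le> measure \<nu> {c..} - pmean s a (measure \<nu> {d..}) (measure \<nu> {c..})"
    unfolding measure_interval_tail[OF y(1)] measure_interval_tail[OF z] by (simp add: algebra_simps)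
  then show "measure \<nu> (F \<inter> {c..d})
    \<le> measure \<nu> {c..} - pmean s a (measure \<nu> {d..}) (measure \<nu> {c..}) + e"
    using 2 by linarith
qed

text \<open>As \<open>B\<close> has no mass in \<open>{p..d}\<close>, the assumption
  \<open>dense\<close> says that the half-line beyond \<open>d\<close> carries a fraction
  \<open>q \<ge> b\<close> of the one beyond \<open>p\<close>. On \<open>[b, 1]\<close> the chord
  replaces the mean. The alternative to \<open>d \<in> B\<close> covers the sentinel
  \<open>R\<close>, beyond which there is no mass.\<close>

lemma right_gap_bound:
  assumes "p \<le> d" and a: "0 \<le> a" "a < 1" and F: "F \<in> sets borel" and X: "X \<in> sets borel"
    and "0 < \<epsilon>" and thick: "\<And>y. y \<in> F \<Longrightarrow> {y - \<epsilon>..y} \<subseteq> X"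
    and B: "B \<in> sets borel" "B \<inter> {p<..<d} = {}" "d \<in> B \<or> measure \<nu> {d..} = 0"
    and sparse: "\<And>x y. x \<in> B \<Longrightarrow> y \<le> x \<Longrightarrow> measure lborel (X \<inter> {y..x}) \<le> a * (x - y)"
    and b: "0 < b" "b < 1" and dense: "b * measure \<nu> {p..} \<le> measure \<nu> (B \<inter> {p..})"
  shows "measure \<nu> (F \<inter> {p..d}) \<le> (1 - (pmean s a b 1 - b) / (1 - b)) * measure \<nu> {p..d}"
proof (cases "measure \<nu> {p..} = 0")
  case True
  have "measure \<nu> {p..d} \<le> measure \<nu> {p..}" "measure \<nu> (F \<inter> {p..d}) \<le> measure \<nu> {p..}"
    by (auto intro!: measure_mono)
  then show ?thesis using True by (simp add: measure_le_0_iff)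
next
  case False
  then have Np: "0 < measure \<nu> {p..}" by (simp add: zero_less_measure_iff)
  have "measure \<nu> (B \<inter> {p..d}) \<le> measure \<nu> ({p} \<union> {d})"
    proof (rule measure_mono)
    show "B \<inter> {p..d} \<subseteq> {p} \<union> {d}" using B(2) by (auto simp: disjoint_iff)
  qed simp
  also have "\<dots> = 0" using measure_Un_null[of "{p}" "{d}"] no_atoms by simp
  finally have "measure \<nu> (B \<inter> {p..d}) = 0" by (simp add: measure_le_0_iff)
  then have "measure \<nu> (B \<inter> {p..}) = measure \<nu> (B \<inter> {d..})"
    using measure_split[OF B(1) \<open>p \<le> d\<close>] by simp
  also have "\<dots> \<le> measure \<nu> {d..}" by (intro measure_mono) auto
  finally have le: "b * measure \<nu> {p..} \<le> measure \<nu> {d..}" using dense by simp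
  then have Nd: "0 < measure \<nu> {d..}"
    using b Np by (smt (verit) mult_pos_pos)
  then have "d \<in> B" using B(3) by simp
  then have "measure \<nu> (F \<inter> {p..d}) \<le> measure \<nu> {p..} - pmean s a (measure \<nu> {d..}) (measure \<nu> {p..})"
    using assms Nd by (intro one_sided_bound[where X = X and \<epsilon> = \<epsilon>]) auto
  also have "\<dots> \<le> (1 - (pmean s a b 1 - b) / (1 - b)) * (measure \<nu> {p..} - measure \<nu> {d..})"
  proof -
    interpret neg_power_mean s a using s_neg a by unfold_locales auto
    define k where "k = (pmean s a b 1 - b) / (1 - b)"
    define q where "q = measure \<nu> {d..} / measure \<nu> {p..}"
    have q: "b \<le> q" "q \<le> 1" "measure \<nu> {d..} = measure \<nu> {p..} * q"
      using le Np tail_mono[OF \<open>p \<le> d\<close>] by (auto simp: q_def field_simps)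
    have "q + k * (1 - q) \<le> pmean s a q 1"
      using pmean_chord[of b q] b q by (simp add: k_def)
    then have "measure \<nu> {p..} * (q + k * (1 - q)) \<le> measure \<nu> {p..} * pmean s a q 1"
      using Np by simp
    also have "\<dots> = pmean s a (measure \<nu> {d..}) (measure \<nu> {p..})"
      using pmean_scale[of q 1 "measure \<nu> {p..}"] Np q b by simp
    finally show ?thesis
      unfolding k_def[symmetric] q(3) by (simp add: algebra_simps)
  qed
  also have "measure \<nu> {p..} - measure \<nu> {d..} = measure \<nu> {p..d}"
    using measure_interval_tail[OF \<open>p \<le> d\<close>] by simp
  finally show ?thesis .
qed

section \<open>Reflection, and gaps cut in two\<close>

lemma measure_uminus:
  "S \<in> sets borel \<Longrightarrow> measure (distr \<nu> borel uminus) S = measure \<nu> (uminus -` S)"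
  by (simp add: measure_distr)

lemma mirror: "interval_concave (distr \<nu> borel uminus) s R"
proof -
  have "finite_measure (distr \<nu> borel uminus)" by (rule finite_measure_distr) simp
  moreover have vi: "uminus -` {x..y} = {-y..-x}" for x y :: real by auto
  ultimately show ?thesis
    unfolding interval_concave_def interval_concave_axioms_def
  proof (intro conjI allI impI, goal_cases)
    case (5 x)
    have "uminus -` {x} = {-x}" by auto
    then show ?case using no_atoms by (simp add: measure_uminus)
  next
    case 6
    have "uminus -` (- {-R..R}) = - {-R..R}" by auto
    then show ?case using support by (simp add: measure_uminus)
  next
    case (7 x x' y y' a)
    then show ?case
      using brunn[of "-x'" "-x" "-y'" "-y" a] by (simp add: measure_uminus vi algebra_simps)
  qed (use s_neg R_pos in auto)
qed

lemma left_gap_bound: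
  assumes "c \<le> p" and a: "0 \<le> a" "a < 1" and F: "F \<in> sets borel" and X: "X \<in> sets borel"
    and "0 < \<epsilon>" and thick: "\<And>y. y \<in> F \<Longrightarrow> {y..y + \<epsilon>} \<subseteq> X"
    and B: "B \<in> sets borel" "B \<inter> {c<..<p} = {}" "c \<in> B \<or> measure \<nu> {..c} = 0"
    and sparse: "\<And>x y. x \<in> B \<Longrightarrow> x \<le> y \<Longrightarrow> measure lborel (X \<inter> {x..y}) \<le> a * (y - x)"
    and b: "0 < b" "b < 1" and dense: "b * measure \<nu> {..p} \<le> measure \<nu> (B \<inter> {..p})"
  shows "measure \<nu> (F \<inter> {c..p}) \<le> (1 - (pmean s a b 1 - b) / (1 - b)) * measure \<nu> {c..p}"
proof -
  interpret M: interval_concave "distr \<nu> borel uminus" s R by (rule mirror)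
  have bor: "uminus -` S \<in> sets borel" if "S \<in> sets borel" for S :: "real set"
    using measurable_sets[of uminus borel borel S] that by simp
  have v: "uminus -` {-p..-c} = {c..p}" "uminus -` {-p..} = {..p}" "uminus -` {-c..} = {..c}"
    "uminus -` (uminus -` S) = S" for S :: "real set" by auto
  have "measure (distr \<nu> borel uminus) (uminus -` F \<inter> {-p..-c})
    \<le> (1 - (pmean s a b 1 - b) / (1 - b)) * measure (distr \<nu> borel uminus) {-p..-c}"
  proof (rule M.right_gap_bound[where X = "uminus -` X" and \<epsilon> = \<epsilon> and B = "uminus -` B"])
    show "{y - \<epsilon>..y} \<subseteq> uminus -` X" if "y \<in> uminus -` F" for y
    proof
      fix x assume "x \<in> {y - \<epsilon>..y}"
      then have "- x \<in> {- y..- y + \<epsilon>}" by auto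
      then show "x \<in> uminus -` X" using thick[of "-y"] that by auto
    qed
    show "uminus -` B \<inter> {- p<..<- c} = {}" using B(2) by (auto simp: disjoint_iff)
    show "- c \<in> uminus -` B \<or> measure (distr \<nu> borel uminus) {- c..} = 0"
      using B(3) by (auto simp: measure_uminus v)
    show "measure lborel (uminus -` X \<inter> {y..x}) \<le> a * (x - y)" if "x \<in> uminus -` B" "y \<le> x" for x y
    proof -
      have "measure lborel (uminus -` X \<inter> {y..x}) = measure (distr lborel borel uminus) (X \<inter> {-x..-y})"
        using X by (subst measure_distr) (auto intro!: arg_cong[where f="measure lborel"])
      also have "\<dots> = measure lborel (X \<inter> {-x..-y})"
        by (simp add: lborel_distr_uminus)
      also have "\<dots> \<le> a * (x - y)" using sparse[of "-x" "-y"] that by simp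
      finally show ?thesis .
    qed
    show "b * measure (distr \<nu> borel uminus) {- p..} \<le> measure (distr \<nu> borel uminus) (uminus -` B \<inter> {- p..})"
      using dense B(1) by (simp add: measure_uminus bor v)
  qed (use assms bor in auto)
  then show ?thesis using F by (simp add: measure_uminus bor v)
qed

lemma measure_lower_tail:
  assumes "S \<in> sets borel"
  shows "measure \<nu> (S \<inter> {..p}) = measure \<nu> S - measure \<nu> (S \<inter> {p..})"
proof -
  have "S = S \<inter> {..<p} \<union> S \<inter> {p..}" by auto
  then have "measure \<nu> S = measure \<nu> (S \<inter> {..<p} \<union> S \<inter> {p..})" by simp
  also have "\<dots> = measure \<nu> (S \<inter> {..<p}) + measure \<nu> (S \<inter> {p..})"
    using assms by (intro finite_measure_Union) auto
  also have "measure \<nu> (S \<inter> {..<p}) = measure \<nu> (S \<inter> {..p})"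
  proof (rule antisym)
    have "measure \<nu> (S \<inter> {..p}) \<le> measure \<nu> (S \<inter> {..<p} \<union> {p})"
      using assms by (intro measure_mono) auto
    then show "measure \<nu> (S \<inter> {..p}) \<le> measure \<nu> (S \<inter> {..<p})"
      using measure_Un_null[of "S \<inter> {..<p}" "{p}"] assms no_atoms by simp
  qed (use assms in \<open>auto intro!: measure_mono\<close>)
  finally show ?thesis by simp
qed

lemma gap_bound:
  assumes "c \<le> d" and a: "0 \<le> a" "a < 1" and F: "F \<in> sets borel" and X: "X \<in> sets borel"
    and "0 < \<epsilon>" and thick: "\<And>y. y \<in> F \<Longrightarrow> {y - \<epsilon>..y + \<epsilon>} \<subseteq> X"
    and B: "B \<in> sets borel" "B \<inter> {c<..<d} = {}"
      "c \<in> B \<or> measure \<nu> {..c} = 0" "d \<in> B \<or> measure \<nu> {d..} = 0"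
    and sparse: "\<And>x y. x \<in> B \<Longrightarrow> measure lborel (X \<inter> {min x y..max x y}) \<le> a * \<bar>x - y\<bar>"
    and b: "0 < b" "b < 1" "measure \<nu> B = b * measure \<nu> UNIV"
  shows "measure \<nu> (F \<inter> {c..d}) \<le> (1 - (pmean s a b 1 - b) / (1 - b)) * measure \<nu> {c..d}"
proof -
  \<comment> \<open>The excess of \<open>B\<close> beyond \<open>p\<close> over its share
    \<open>b\<close>. The total excess is 0, so the part before \<open>p\<close> has the opposite
    excess and at a zero both one-sided bounds apply. If the end values exclude a sign change from
    negative to positive, one side alone covers the gap.\<close>
  define \<Phi> where "\<Phi> p = measure \<nu> (B \<inter> {p..}) - b * measure \<nu> (UNIV \<inter> {p..})" for p
  have sparse_le: "measure lborel (X \<inter> {y..x}) \<le> a * (x - y)" if "x \<in> B" "y \<le> x" for x y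
    using sparse[OF that(1), of y] that by (simp add: min_def max_def split: if_splits)
  have sparse_ge: "measure lborel (X \<inter> {x..y}) \<le> a * (y - x)" if "x \<in> B" "x \<le> y" for x y
    using sparse[OF that(1), of y] that by (simp add: min_def max_def)
  have thick_le: "{y - \<epsilon>..y} \<subseteq> X" and thick_ge: "{y..y + \<epsilon>} \<subseteq> X" if "y \<in> F" for y
    using thick[OF that] \<open>0 < \<epsilon>\<close> by (auto simp: subset_iff)
  have right: "measure \<nu> (F \<inter> {p..d}) \<le> (1 - (pmean s a b 1 - b) / (1 - b)) * measure \<nu> {p..d}"
    if "c \<le> p" "p \<le> d" "0 \<le> \<Phi> p" for p
    using that assms thick_le sparse_le
    by (intro right_gap_bound[where X = X and \<epsilon> = \<epsilon> and B = B]) (auto simp: \<Phi>_def disjoint_iff)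
  have left: "measure \<nu> (F \<inter> {c..p}) \<le> (1 - (pmean s a b 1 - b) / (1 - b)) * measure \<nu> {c..p}"
    if "c \<le> p" "p \<le> d" "\<Phi> p \<le> 0" for p
  proof (rule left_gap_bound[where X = X and \<epsilon> = \<epsilon> and B = B])
    show "b * measure \<nu> {..p} \<le> measure \<nu> (B \<inter> {..p})"
    proof -
      have "measure \<nu> {..p} = measure \<nu> UNIV - measure \<nu> {p..}"
        using measure_lower_tail[of UNIV p] by simp
      then have "b * measure \<nu> {..p} = measure \<nu> B - b * measure \<nu> {p..}"
        using b(3) by (simp add: right_diff_distrib)
      then show ?thesis using measure_lower_tail[OF B(1), of p] that by (simp add: \<Phi>_def)
    qed
  qed (use that assms thick_ge sparse_ge in \<open>auto simp: disjoint_iff\<close>)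
  consider "0 \<le> \<Phi> c" | "\<Phi> d \<le> 0" | "\<Phi> c \<le> 0 \<and> 0 \<le> \<Phi> d" by linarith
  then show ?thesis
  proof cases
    case 3
    have "continuous_on {c..d} \<Phi>"
      unfolding \<Phi>_def by (intro continuous_intros continuous_measure_tail) (use B in auto)
    then obtain p where p: "c \<le> p" "p \<le> d" "\<Phi> p = 0"
      using IVT'[of \<Phi> c 0 d] 3 \<open>c \<le> d\<close> by auto
    show ?thesis
      using left[of p] right[of p] p measure_split_interval[OF F p(1,2)] measure_split_interval[of UNIV, OF _ p(1,2)]
      by (simp add: distrib_left)
  qed (use left right \<open>c \<le> d\<close> in auto)
qed

theorem dilation_on_line:
  assumes a: "0 \<le> a" "a < 1" and F: "compact F" "F \<subseteq> {-R<..<R}"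
    and X: "X \<in> sets borel" and "0 < \<epsilon>" and thick: "\<And>y. y \<in> F \<Longrightarrow> {y - \<epsilon>..y + \<epsilon>} \<subseteq> X"
    and B: "compact B" "B \<subseteq> {-R<..<R}" "B \<inter> F = {}"
    and sparse: "\<And>x y. x \<in> B \<Longrightarrow> measure lborel (X \<inter> {min x y..max x y}) \<le> a * \<bar>x - y\<bar>"
    and b: "0 < b" "measure \<nu> B = b * measure \<nu> UNIV" and pos: "0 < measure \<nu> UNIV"
  shows "measure \<nu> F \<le> (1 - pmean s a b 1) * measure \<nu> UNIV"
proof -
  interpret neg_power_mean s a using s_neg a by unfold_locales auto
  have bor: "B \<in> sets borel" "F \<in> sets borel" using B F by (auto intro: borel_compact)
  have compl: "measure \<nu> (- B) = measure \<nu> UNIV - measure \<nu> B"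
    using finite_measure_compl[of B] bor by (simp add: Compl_eq_Diff_UNIV)
  have "measure \<nu> B \<le> measure \<nu> UNIV" by (intro measure_mono) auto
  then have "b \<le> 1" using b pos by simp
  show ?thesis
  proof (cases "b = 1")
    case True
    have "measure \<nu> F \<le> measure \<nu> (- B)" using B bor by (intro measure_mono) auto
    then show ?thesis using compl b True by simp
  next
    case False
    then have "b < 1" using \<open>b \<le> 1\<close> by simp
    \<comment> \<open>\<open>F\<close> will take at most the share \<open>1 - k\<close> of each gap,
      and the gaps together have at most the share \<open>1 - b\<close> of the total mass;
      \<open>k\<close> is the number with \<open>(1 - k) * (1 - b) = 1 - pmean s a b 1\<close>. The
      case \<open>b = 1\<close> is separate because of the denominator.\<close>
    define k where "k = (pmean s a b 1 - b) / (1 - b)"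
    have "pmean s a b 1 \<le> 1" using pmean_mono[of b 1 1 1] b \<open>b < 1\<close> by simp
    then have k: "k \<le> 1" "k * (1 - b) = pmean s a b 1 - b" using \<open>b < 1\<close> by (auto simp: k_def divide_le_eq)
    define lo where "lo x = Sup (insert (-R) (B \<inter> {..x}))" for x
    define hi where "hi x = Inf (insert R (B \<inter> {x..}))" for x
    define G where "G x = {lo x<..<hi x}" for x
    have FB: "x \<notin> B" "-R < x" "x < R" if "x \<in> F" for x
      using that B(3) F(2) by auto
    have gap: "lo x < x" "x < hi x" "lo x \<in> insert (-R) B" "hi x \<in> insert R B"
      "B \<inter> {lo x<..<hi x} = {}"
      "\<And>y. lo x < y \<Longrightarrow> y < hi x \<Longrightarrow> lo y = lo x \<and> hi y = hi x" if "x \<in> F" for x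
      using gap_around(1-5)[OF B(1,2) FB[OF that]] gap_around(6)[OF B(1,2) FB[OF that]]
      unfolding lo_def hi_def by blast+
    \<comment> \<open>The complement of \<open>B\<close> may have infinitely many gaps; compactness
      of \<open>F\<close> leaves finitely many that matter.\<close>
    have "F \<subseteq> (\<Union>x\<in>F. G x)" using gap(1,2) by (auto simp: G_def)
    then obtain C where C: "C \<subseteq> F" "finite C" "F \<subseteq> (\<Union>x\<in>C. G x)"
      using compactE_image[OF F(1), of F G] by (auto simp: G_def)
    have disj: "disjoint_family_on (\<lambda>g. g) (G ` C)"
    proof (clarsimp simp: disjoint_family_on_def)
      fix x y assume xy: "x \<in> C" "y \<in> C" "G x \<noteq> G y"
      have "G z = G x" if "z \<in> G x" "x \<in> F" for x z
        using gap(6)[OF that(2), of z] that(1) by (simp add: G_def)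
      then show "G x \<inter> G y = {}" using xy C(1) by (metis disjoint_iff in_mono)
    qed
    then have disj': "disjoint_family_on (\<lambda>g. F \<inter> g) (G ` C)"
      by (auto simp: disjoint_family_on_def)
    have each: "measure \<nu> (F \<inter> g) \<le> (1 - k) * measure \<nu> g" if "g \<in> G ` C" for g
    proof -
      from that C(1) obtain x where x: "x \<in> F" "g = G x" by auto
      have tails: "measure \<nu> {..-R} = 0" "measure \<nu> {R..} = 0"
      proof -
        have "measure \<nu> {..-R} \<le> measure \<nu> (- {-R..R} \<union> {-R})" "measure \<nu> {R..} \<le> measure \<nu> (- {-R..R} \<union> {R})"
          by (auto intro!: measure_mono)
        then show "measure \<nu> {..-R} = 0" "measure \<nu> {R..} = 0"
          using measure_Un_null[of "- {-R..R}" "{-R}"] measure_Un_null[of "- {-R..R}" "{R}"]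
          by (simp_all add: support no_atoms measure_le_0_iff)
      qed
      have lh: "lo x \<le> hi x" using gap(1,2)[OF x(1)] by simp
      have "measure \<nu> (F \<inter> g) \<le> measure \<nu> (F \<inter> {lo x..hi x})"
        using bor by (intro measure_mono) (auto simp: x G_def)
      also have "\<dots> \<le> (1 - (pmean s a b 1 - b) / (1 - b)) * measure \<nu> {lo x..hi x}"
      proof (rule gap_bound[where X = X and \<epsilon> = \<epsilon> and B = B])
        show "lo x \<in> B \<or> measure \<nu> {..lo x} = 0" "hi x \<in> B \<or> measure \<nu> {hi x..} = 0"
          using gap(3,4)[OF x(1)] tails by auto
      qed (use gap(5)[OF x(1)] lh assms bor \<open>b < 1\<close> in auto)
      also have "measure \<nu> {lo x..hi x} = measure \<nu> g"
      proof -
        have "{lo x..hi x} = (g \<union> {lo x}) \<union> {hi x}" using lh by (auto simp: x G_def)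
        moreover have "g \<in> sets borel" by (simp add: x G_def)
        ultimately show ?thesis
          using measure_Un_null[of g "{lo x}"] measure_Un_null[of "g \<union> {lo x}" "{hi x}"] no_atoms by simp
      qed
      finally show ?thesis by (simp add: k_def)
    qed
    have gs: "g \<in> sets borel" if "g \<in> G ` C" for g using that by (auto simp: G_def)
    have "F = (\<Union>g\<in>G ` C. F \<inter> g)" using C(3) by auto
    then have "measure \<nu> F = measure \<nu> (\<Union>g\<in>G ` C. F \<inter> g)" by simp
    also have "\<dots> = (\<Sum>g\<in>G ` C. measure \<nu> (F \<inter> g))"
      using C(2) disj' gs bor by (intro finite_measure_finite_Union) auto
    also have "\<dots> \<le> (\<Sum>g\<in>G ` C. (1 - k) * measure \<nu> g)" by (intro sum_mono each)
    also have "\<dots> = (1 - k) * measure \<nu> (\<Union>g\<in>G ` C. g)"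
      using C(2) disj gs finite_measure_finite_Union[of "G ` C" "\<lambda>g. g"] by (simp add: sum_distrib_left subset_iff)
    also have "\<dots> \<le> (1 - k) * measure \<nu> (- B)"
    proof (intro mult_left_mono measure_mono)
      show "(\<Union>g\<in>G ` C. g) \<subseteq> - B" using gap(5) C(1) by (fastforce simp: G_def disjoint_iff)
    qed (use k bor in auto)
    also have "\<dots> = (1 - k) * (1 - b) * measure \<nu> UNIV"
      by (simp only: compl b(2)) (simp add: algebra_simps)
    also have "(1 - k) * (1 - b) = 1 - pmean s a b 1" using k(2) by (simp add: algebra_simps)
    finally show ?thesis .
  qed
qed

end

subsection \<open>Sparse sets on lines\<close>

lemma infdist_le_obtain:
  fixes D :: "real set"
  assumes "compact D" "D \<noteq> {}" "infdist x D \<le> e"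
  obtains y where "y \<in> D" "\<bar>x - y\<bar> \<le> e"
  using infdist_attains_inf[of D x] assms compact_imp_closed by (metis dist_real_def)

text \<open>\<open>A\<close> and \<open>D\<close> have a positive distance \<open>\<eta>\<close>. A
  short interval starting near \<open>A\<close> does not reach the neighbourhood of \<open>D\<close>
  at all; on a long one the errors of the fattening are absorbed by the slack
  \<open>(a' - a) * \<bar>x - y\<bar>\<close>. Strictness of \<open>a < a'\<close> is thus what the
  argument lives on.\<close>

lemma sparse_fattening:
  fixes A D :: "real set"
  assumes A: "compact A" "A \<noteq> {}" and D: "compact D" "D \<noteq> {}" and "A \<inter> D = {}"
    and a: "0 \<le> a" "a < a'" "a' < 1"
    and sparse: "\<And>x y. x \<in> A \<Longrightarrow> measure lborel (D \<inter> {min x y..max x y}) \<le> a * \<bar>x - y\<bar>"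
  obtains \<epsilon> where "0 < \<epsilon>"
    "\<And>x. infdist x A \<le> \<epsilon> \<Longrightarrow> 2 * \<epsilon> < infdist x D"
    "\<And>x y. infdist x A \<le> \<epsilon> \<Longrightarrow>
      measure lborel ({t. infdist t D \<le> 2 * \<epsilon>} \<inter> {min x y..max x y}) \<le> a' * \<bar>x - y\<bar>"
proof -
  obtain \<eta> where \<eta>: "0 < \<eta>" "\<And>x y. x \<in> A \<Longrightarrow> y \<in> D \<Longrightarrow> \<eta> \<le> \<bar>x - y\<bar>"
    using separate_compact_closed[of A D] A D assms(5) compact_imp_closed by (metis dist_real_def)
  \<comment> \<open>The slack on an interval of length at least \<open>\<eta> / 2\<close> is at
    least \<open>2 * \<zeta>\<close>: one \<open>\<zeta>\<close> pays for the measure added to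
    \<open>D\<close>, the other for moving \<open>x\<close> to a point of \<open>A\<close>.\<close>
  define \<zeta> where "\<zeta> = (a' - a) * \<eta> / 4"
  have "0 < \<zeta>" using a \<eta> by (simp add: \<zeta>_def)
  define V where "V e = {t. infdist t D \<le> e}" for e
  have cV: "compact (V e)" if "0 < e" for e
    unfolding V_def by (intro compact_infdist_le D that)
  have fin: "emeasure lborel S < \<infinity>" if "compact S" for S :: "real set"
    using that by (rule emeasure_compact_finite)
  have "(\<lambda>n. measure lborel (V (inverse (real (Suc n))))) \<longlonglongrightarrow> measure lborel (\<Inter>n. V (inverse (real (Suc n))))"
  proof (rule Lim_measure_decseq)
    have c: "compact (V (inverse (real (Suc n))))" for n by (rule cV) simp
    then show "range (\<lambda>n. V (inverse (real (Suc n)))) \<subseteq> sets lborel"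
      by (auto intro: borel_compact)
    show "emeasure lborel (V (inverse (real (Suc n)))) \<noteq> \<infinity>" for n
      using fin[OF c[of n]] by simp
    show "decseq (\<lambda>n. V (inverse (real (Suc n))))"
    proof (rule decseq_SucI)
      fix n
      have le: "inverse (real (Suc (Suc n))) \<le> inverse (real (Suc n))" by simp
      show "V (inverse (real (Suc (Suc n)))) \<subseteq> V (inverse (real (Suc n)))"
        unfolding V_def by (auto intro: order_trans[OF _ le] simp del: of_nat_Suc)
    qed
  qed
  also have "(\<Inter>n. V (inverse (real (Suc n)))) = D"
  proof (intro equalityI subsetI)
    fix x assume x: "x \<in> (\<Inter>n. V (inverse (real (Suc n))))"
    have "infdist x D \<le> 0"
    proof (rule ccontr)
      assume "\<not> ?thesis"
      then obtain n where "inverse (real (Suc n)) < infdist x D" using reals_Archimedean[of "infdist x D"] by auto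
      moreover have "infdist x D \<le> inverse (real (Suc n))" using x unfolding V_def by blast
      ultimately show False by simp
    qed
    then obtain y where "y \<in> D" "\<bar>x - y\<bar> \<le> 0" by (rule infdist_le_obtain[OF D])
    then show "x \<in> D" by simp
  qed (auto simp: V_def)
  finally have "\<forall>\<^sub>F n in sequentially. measure lborel (V (inverse (real (Suc n)))) < measure lborel D + \<zeta>"
    using \<open>0 < \<zeta>\<close> by (intro order_tendstoD) auto
  moreover have "\<forall>\<^sub>F n in sequentially. inverse (real (Suc n)) < min (\<eta> / 4) (\<zeta> / 2)"
    using \<eta> \<open>0 < \<zeta>\<close> by (intro order_tendstoD(2)[OF LIMSEQ_inverse_real_of_nat]) auto
  ultimately obtain n where n: "measure lborel (V (inverse (real (Suc n)))) < measure lborel D + \<zeta>"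
    "inverse (real (Suc n)) < min (\<eta> / 4) (\<zeta> / 2)"
    by (metis (mono_tags, lifting) eventually_conj eventually_happens' sequentially_bot)
  define \<epsilon> where "\<epsilon> = inverse (real (Suc n)) / 2"
  have \<epsilon>: "0 < \<epsilon>" "\<epsilon> < \<eta> / 8" "\<epsilon> < \<zeta> / 4" and V\<epsilon>: "measure lborel (V (2 * \<epsilon>)) < measure lborel D + \<zeta>"
    using n by (auto simp: \<epsilon>_def simp del: of_nat_Suc)
  have bD: "D \<in> sets borel" and bV: "V (2 * \<epsilon>) \<in> sets borel"
    using D cV[of "2 * \<epsilon>"] \<epsilon> by (auto intro: borel_compact)
  have far: "\<eta> \<le> \<bar>x - t\<bar> + 3 * \<epsilon>" if xA: "infdist x A \<le> \<epsilon>" and tD: "infdist t D \<le> 2 * \<epsilon>" for x t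
  proof -
    obtain x0 where "x0 \<in> A" "\<bar>x - x0\<bar> \<le> \<epsilon>" using infdist_le_obtain[OF A xA] .
    moreover obtain d where "d \<in> D" "\<bar>t - d\<bar> \<le> 2 * \<epsilon>" using infdist_le_obtain[OF D tD] .
    ultimately show ?thesis using \<eta>(2)[of x0 d] by linarith
  qed
  show thesis
  proof (rule that[OF \<epsilon>(1)])
    show "2 * \<epsilon> < infdist x D" if "infdist x A \<le> \<epsilon>" for x
      using far[OF that, of x] \<epsilon> by force
    show "measure lborel ({t. infdist t D \<le> 2 * \<epsilon>} \<inter> {min x y..max x y}) \<le> a' * \<bar>x - y\<bar>"
      if x: "infdist x A \<le> \<epsilon>" for x y
    proof (cases "\<bar>x - y\<bar> < \<eta> / 2")
      case True
      have "t \<notin> V (2 * \<epsilon>)" if t: "t \<in> {min x y..max x y}" for t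
      proof
        assume "t \<in> V (2 * \<epsilon>)"
        then have "\<eta> \<le> \<bar>x - t\<bar> + 3 * \<epsilon>" using far[OF x, of t] by (simp add: V_def)
        moreover have "\<bar>x - t\<bar> \<le> \<bar>x - y\<bar>" using t by auto
        ultimately show False using True \<epsilon> by linarith
      qed
      then have "V (2 * \<epsilon>) \<inter> {min x y..max x y} = {}" by blast
      then show ?thesis using a by (simp add: V_def)
    next
      case False
      obtain x0 where x0: "x0 \<in> A" "\<bar>x - x0\<bar> \<le> \<epsilon>" using infdist_le_obtain[OF A x] .
      let ?I0 = "{min x0 y..max x0 y}" and ?J = "{min x x0..max x x0}"
      have "measure lborel (V (2 * \<epsilon>) \<inter> {min x y..max x y})
        \<le> measure lborel ((D \<inter> ?I0) \<union> (V (2 * \<epsilon>) - D) \<union> ?J)"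
      proof (rule measure_mono_fmeasurable)
        show "V (2 * \<epsilon>) \<inter> {min x y..max x y} \<subseteq> (D \<inter> ?I0) \<union> (V (2 * \<epsilon>) - D) \<union> ?J" by auto
        show "V (2 * \<epsilon>) \<inter> {min x y..max x y} \<in> sets lborel" using bV by simp
        have "emeasure lborel ((D \<inter> ?I0) \<union> (V (2 * \<epsilon>) - D) \<union> ?J) \<le> emeasure lborel (D \<union> V (2 * \<epsilon>) \<union> ?J)"
          using bD bV by (intro emeasure_mono) auto
        also have "\<dots> < \<infinity>" using D cV[of "2 * \<epsilon>"] \<epsilon> by (intro fin compact_Un) auto
        finally show "(D \<inter> ?I0) \<union> (V (2 * \<epsilon>) - D) \<union> ?J \<in> fmeasurable lborel"
          using bD bV by (auto simp: fmeasurable_def)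
      qed
      also have "\<dots> \<le> measure lborel (D \<inter> ?I0) + measure lborel (V (2 * \<epsilon>) - D) + measure lborel ?J"
      proof -
        have "measure lborel ((D \<inter> ?I0) \<union> (V (2 * \<epsilon>) - D) \<union> ?J)
          \<le> measure lborel ((D \<inter> ?I0) \<union> (V (2 * \<epsilon>) - D)) + measure lborel ?J"
          using bD bV by (intro measure_Un_le) auto
        also have "measure lborel ((D \<inter> ?I0) \<union> (V (2 * \<epsilon>) - D)) \<le> measure lborel (D \<inter> ?I0) + measure lborel (V (2 * \<epsilon>) - D)"
          using bD bV by (intro measure_Un_le) auto
        finally show ?thesis by simp
      qed
      also have "measure lborel (V (2 * \<epsilon>) - D) \<le> \<zeta>"
      proof -
        have "D \<subseteq> V (2 * \<epsilon>)" using \<epsilon> by (auto simp: V_def)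
        then have "measure lborel (V (2 * \<epsilon>) - D) = measure lborel (V (2 * \<epsilon>)) - measure lborel D"
          using fin[of "V (2 * \<epsilon>)"] cV[of "2 * \<epsilon>"] \<epsilon> bD bV by (intro measure_Diff) auto
        then show ?thesis using V\<epsilon> by simp
      qed
      also have "measure lborel (D \<inter> ?I0) \<le> a * (\<bar>x - y\<bar> + \<epsilon>)"
      proof -
        have "measure lborel (D \<inter> ?I0) \<le> a * \<bar>x0 - y\<bar>" by (rule sparse[OF x0(1)])
        also have "\<dots> \<le> a * (\<bar>x - y\<bar> + \<epsilon>)" using x0 a by (intro mult_left_mono) auto
        finally show ?thesis .
      qed
      also have "measure lborel ?J \<le> \<epsilon>" using x0(2) by (auto simp: max_def min_def abs_if split: if_splits)
      finally have "measure lborel (V (2 * \<epsilon>) \<inter> {min x y..max x y}) \<le> a * (\<bar>x - y\<bar> + \<epsilon>) + \<zeta> + \<epsilon>" by simp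
      also have "\<dots> \<le> a * \<bar>x - y\<bar> + 2 * \<zeta>"
        using a \<epsilon> mult_right_mono[of a 1 \<epsilon>] unfolding distrib_left by linarith
      also have "2 * \<zeta> = (a' - a) * (\<eta> / 2)" by (simp add: \<zeta>_def)
      also have "\<dots> \<le> (a' - a) * \<bar>x - y\<bar>" using False a by (intro mult_left_mono) auto
      finally show ?thesis by (simp add: V_def algebra_simps)
    qed
  qed
qed

section \<open>Sparsity along oriented lines\<close>

lemma measure_lborel_shift:
  fixes S :: "real set"
  assumes "S \<in> sets borel"
  shows "measure lborel {t. t - c \<in> S} = measure lborel S" "measure lborel {t. c - t \<in> S} = measure lborel S"
proof -
  have "measure lborel S = measure (distr lborel borel ((+) (- c))) S" by (simp add: lborel_distr_plus)
  also have "\<dots> = measure lborel ((+) (- c) -` S)" using assms by (simp add: measure_distr)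
  also have "(+) (- c) -` S = {t. t - c \<in> S}" by auto
  finally show "measure lborel {t. t - c \<in> S} = measure lborel S" by simp
  have S': "uminus -` S \<in> sets borel"
    using measurable_sets[of uminus borel borel S] assms by simp
  have "measure lborel S = measure (distr lborel borel uminus) S" by (simp add: lborel_distr_uminus)
  also have "\<dots> = measure lborel (uminus -` S)" using assms by (simp add: measure_distr)
  also have "\<dots> = measure (distr lborel borel ((+) (- c))) (uminus -` S)" by (simp add: lborel_distr_plus)
  also have "\<dots> = measure lborel ((+) (- c) -` uminus -` S)" using S' by (simp add: measure_distr)
  also have "(+) (- c) -` uminus -` S = {t. c - t \<in> S}" by auto
  finally show "measure lborel {t. c - t \<in> S} = measure lborel S" by simp
qed

text \<open>Both orientations of a line are covered, since \<open>u\<close> may be replaced by \<open>- u\<close>.\<close>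
definition sparse_from :: "real \<Rightarrow> 'a::euclidean_space set \<Rightarrow> 'a set \<Rightarrow> bool" where
  "sparse_from a B F \<longleftrightarrow> (\<forall>x\<in>B. \<forall>u \<rho>. norm u = 1 \<longrightarrow> 0 \<le> \<rho> \<longrightarrow>
     measure lborel {t \<in> {0..\<rho>}. x + t *\<^sub>R u \<in> F} \<le> a * \<rho>)"

lemma sparse_from_line:
  assumes sp: "sparse_from a B F" and F: "F \<in> sets borel" and u: "norm u = 1" and B: "z + x *\<^sub>R u \<in> B"
    and D: "D \<in> sets borel" "\<And>t. t \<in> D \<Longrightarrow> z + t *\<^sub>R u \<in> F"
  shows "measure lborel (D \<inter> {min x y..max x y}) \<le> a * \<bar>x - y\<bar>"
proof -
  define S where "S v = {t \<in> {0..\<bar>x - y\<bar>}. (z + x *\<^sub>R u) + t *\<^sub>R v \<in> F}" for v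
  have S: "S v \<in> sets borel" for v
  proof -
    have "(\<lambda>t. (z + x *\<^sub>R u) + t *\<^sub>R v) -` F \<in> sets borel"
      using measurable_sets[of "\<lambda>t. (z + x *\<^sub>R u) + t *\<^sub>R v" borel borel F] F by simp
    moreover have "S v = {0..\<bar>x - y\<bar>} \<inter> (\<lambda>t. (z + x *\<^sub>R u) + t *\<^sub>R v) -` F" by (auto simp: S_def)
    ultimately show ?thesis by simp
  qed
  have fm: "S v \<in> fmeasurable lborel" for v
  proof -
    have "emeasure lborel (S v) \<le> emeasure lborel {0..\<bar>x - y\<bar>}" by (intro emeasure_mono) (auto simp: S_def)
    also have "\<dots> < \<infinity>" by simp
    finally show ?thesis using S by (simp add: fmeasurable_def)
  qed
  have le: "measure lborel (S v) \<le> a * \<bar>x - y\<bar>" if "norm v = 1" for v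
    using sp B that unfolding sparse_from_def S_def by auto
  show ?thesis
  proof (cases "x \<le> y")
    case True
    have "emeasure lborel {t. t - x \<in> S u} \<noteq> \<infinity>"
    proof -
      have "emeasure lborel {t. t - x \<in> S u} \<le> emeasure lborel {x..x + \<bar>x - y\<bar>}"
        by (intro emeasure_mono) (auto simp: S_def)
      then show ?thesis by (auto simp: top_unique)
    qed
    moreover have m: "{t. t - x \<in> S u} \<in> sets borel"
      using measurable_sets[of "\<lambda>t. t - x" borel borel "S u"] S by (simp add: vimage_def)
    ultimately have "{t. t - x \<in> S u} \<in> fmeasurable lborel" by (simp add: fmeasurable_def less_top)
    then have "measure lborel (D \<inter> {min x y..max x y}) \<le> measure lborel {t. t - x \<in> S u}"
      using True D by (intro measure_mono_fmeasurable) (auto simp: S_def algebra_simps)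
    then show ?thesis using measure_lborel_shift(1)[OF S, of x u] le[OF u] by simp
  next
    case False
    have "emeasure lborel {t. x - t \<in> S (- u)} \<noteq> \<infinity>"
    proof -
      have "emeasure lborel {t. x - t \<in> S (- u)} \<le> emeasure lborel {x - \<bar>x - y\<bar>..x}"
        by (intro emeasure_mono) (auto simp: S_def)
      then show ?thesis by (auto simp: top_unique)
    qed
    moreover have m: "{t. x - t \<in> S (- u)} \<in> sets borel"
      using measurable_sets[of "\<lambda>t. x - t" borel borel "S (- u)"] S by (simp add: vimage_def)
    ultimately have "{t. x - t \<in> S (- u)} \<in> fmeasurable lborel" by (simp add: fmeasurable_def less_top)
    then have "measure lborel (D \<inter> {min x y..max x y}) \<le> measure lborel {t. x - t \<in> S (- u)}"
      using False D by (intro measure_mono_fmeasurable) (auto simp: S_def algebra_simps)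
    then show ?thesis using measure_lborel_shift(2)[OF S, of x "- u"] le[of "- u"] u by simp
  qed
qed

text \<open>By continuity in the weight a strict inequality survives a small increase of
  \<open>a\<close>; this supplies the \<open>a'\<close> of \<open>sparse_fattening\<close>.\<close>

lemma pmean_increase_weight:
  assumes "s < 0" "0 < b" "0 \<le> a" "a < 1" "c < pmean s a b 1"
  obtains a' where "a < a'" "a' < 1" "c < pmean s a' b 1"
proof -
  interpret neg_power_mean s a using assms by unfold_locales auto
  have "((\<lambda>a. pmean s a b 1) \<longlongrightarrow> pmean s a b 1) (at_right a)"
    unfolding pmean_def using base_pos[of b 1] assms by (intro tendsto_intros) auto
  then have "\<forall>\<^sub>F a' in at_right a. c < pmean s a' b 1" by (rule order_tendstoD(1)[OF _ assms(5)])
  moreover have "\<forall>\<^sub>F a' in at_right a. a' \<in> {a<..<1}" by (rule eventually_at_right_real[OF assms(4)])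
  ultimately have "\<forall>\<^sub>F a' in at_right a. c < pmean s a' b 1 \<and> a' \<in> {a<..<1}" by (rule eventually_conj)
  then have "\<exists>a'. c < pmean s a' b 1 \<and> a' \<in> {a<..<1}"
    using eventually_happens'[OF trivial_limit_at_right_real] by blast
  then show thesis using that by auto
qed

lemma ray_section_fmeasurable:
  fixes x u :: "'a::euclidean_space"
  assumes "F \<in> sets borel"
  shows "{t \<in> {0..\<rho>}. x + t *\<^sub>R u \<in> F} \<in> fmeasurable lborel"
proof -
  have "(\<lambda>t. x + t *\<^sub>R u) -` F \<in> sets borel"
    using measurable_sets[of "\<lambda>t. x + t *\<^sub>R u" borel borel F] assms by simp
  moreover have "{t \<in> {0..\<rho>}. x + t *\<^sub>R u \<in> F} = {0..\<rho>} \<inter> (\<lambda>t. x + t *\<^sub>R u) -` F" by auto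
  ultimately have "{t \<in> {0..\<rho>}. x + t *\<^sub>R u \<in> F} \<in> sets lborel" by simp
  moreover have "emeasure lborel {t \<in> {0..\<rho>}. x + t *\<^sub>R u \<in> F} \<le> emeasure lborel {0..\<rho>}"
    by (intro emeasure_mono) auto
  ultimately show ?thesis by (auto simp: fmeasurable_def emeasure_lborel_Icc_eq intro: le_less_trans split: if_splits)
qed

lemma sparse_from_subset:
  fixes B B' F F' :: "'a::euclidean_space set"
  assumes "sparse_from a B F" "B' \<subseteq> B" "F' \<subseteq> F" "F \<in> sets borel" "F' \<in> sets borel"
  shows "sparse_from a B' F'"
proof (unfold sparse_from_def, intro ballI allI impI)
  fix x u :: 'a and \<rho> :: real assume x: "x \<in> B'" and u: "norm u = 1" "0 \<le> \<rho>"
  have "measure lborel {t \<in> {0..\<rho>}. x + t *\<^sub>R u \<in> F'} \<le> measure lborel {t \<in> {0..\<rho>}. x + t *\<^sub>R u \<in> F}"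
    using assms ray_section_fmeasurable[OF assms(4)] ray_section_fmeasurable[OF assms(5), THEN fmeasurableD]
    by (intro measure_mono_fmeasurable) auto
  also have "\<dots> \<le> a * \<rho>" using assms(1,2) x u unfolding sparse_from_def by blast
  finally show "measure lborel {t \<in> {0..\<rho>}. x + t *\<^sub>R u \<in> F'} \<le> a * \<rho>" .
qed

text \<open>
  A nondegenerate triangle in \<open>\<sigma>\<close> would project onto a coordinate plane with nonempty interior,
  hence meet one of the axes in a relative interior point.
\<close>
lemma collinear_of_rational_axes:
  fixes \<sigma> :: "'a::euclidean_space set"
  assumes "convex \<sigma>" "\<sigma> \<noteq> {}"
    and axes: "\<And>i j p q. i \<in> Basis \<Longrightarrow> j \<in> Basis \<Longrightarrow> i \<noteq> j \<Longrightarrow> p \<in> \<rat> \<Longrightarrow> q \<in> \<rat> \<Longrightarrow>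
      \<exists>\<theta>. \<forall>x\<in>\<sigma>. 0 \<le> (x - (p *\<^sub>R i + q *\<^sub>R j)) \<bullet> (cos \<theta> *\<^sub>R i + sin \<theta> *\<^sub>R j)"
  obtains z u where "norm u = 1" "\<sigma> \<subseteq> range (\<lambda>\<tau>. z + \<tau> *\<^sub>R u)"
proof -
  note result = that
  obtain x where x: "x \<in> \<sigma>" using assms(2) by blast
  show thesis
  proof (cases "\<sigma> = {x}")
    case True
    obtain u :: 'a where "u \<in> Basis" using nonempty_Basis by blast
    then show thesis using True by (intro result[of u x]) (auto intro!: range_eqI[of _ _ 0])
  next
    case False
    then obtain y where y: "y \<in> \<sigma>" "y \<noteq> x" using x by blast
    define u where "u = y - x"
    have u: "u \<noteq> 0" using y by (simp add: u_def)
    have "\<exists>r. w - x = r *\<^sub>R u" if w: "w \<in> \<sigma>" for w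
    proof (rule ccontr)
      assume nopar: "\<nexists>r. w - x = r *\<^sub>R u"
      define v where "v = w - x"
      obtain i where i: "i \<in> Basis" "u \<bullet> i \<noteq> 0" using u by (metis euclidean_all_zero_iff)
      have "\<exists>j\<in>Basis. (u \<bullet> i) * (v \<bullet> j) \<noteq> (u \<bullet> j) * (v \<bullet> i)"
      proof (rule ccontr)
        assume "\<not> ?thesis"
        then have "v \<bullet> j = (((v \<bullet> i) / (u \<bullet> i)) *\<^sub>R u) \<bullet> j" if "j \<in> Basis" for j
          using that i by (simp add: field_simps)
        then have "v = ((v \<bullet> i) / (u \<bullet> i)) *\<^sub>R u" by (rule euclidean_eqI)
        then show False using nopar by (auto simp: v_def)
      qed
      then obtain j where j: "j \<in> Basis" "(u \<bullet> i) * (v \<bullet> j) \<noteq> (u \<bullet> j) * (v \<bullet> i)" by blast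
      then have "i \<noteq> j" by auto
      define D where "D = (u \<bullet> i) * (v \<bullet> j) - (u \<bullet> j) * (v \<bullet> i)"
      have D: "D \<noteq> 0" using j by (simp add: D_def)
      define S where "S = \<bar>u \<bullet> i\<bar> + \<bar>u \<bullet> j\<bar> + \<bar>v \<bullet> i\<bar> + \<bar>v \<bullet> j\<bar>"
      have S: "0 < S" using i by (simp add: S_def)
      \<comment> \<open>\<open>P\<close> gives the coordinates of the centroid of the triangle and
        \<open>D\<close> is the determinant of the projected sides. By Cramer's rule a target within
        \<open>e\<close> of the centroid changes the barycentric coefficients by
        \<open>\<alpha>\<close> and \<open>\<beta>\<close> of size at most 1/12. Since 2/3 + 4/12 =
        1, there remains room for moves \<open>r\<close> and \<open>t\<close> of size 1/12.\<close>
      define e where "e = \<bar>D\<bar> / (12 * S)"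
      have e: "0 < e" using D S by (simp add: e_def)
      define P where "P k = x \<bullet> k + (u \<bullet> k + v \<bullet> k) / 3" for k
      obtain p where p: "p \<in> \<rat>" "P i < p" "p < P i + e" using Rats_dense_in_real[of "P i" "P i + e"] e by auto
      obtain q where q: "q \<in> \<rat>" "P j < q" "q < P j + e" using Rats_dense_in_real[of "P j" "P j + e"] e by auto
      define dp dq where "dp = p - P i" and "dq = q - P j"
      have dpq: "\<bar>dp\<bar> \<le> e" "\<bar>dq\<bar> \<le> e" using p q by (auto simp: dp_def dq_def)
      define \<alpha> where "\<alpha> = (dp * (v \<bullet> j) - dq * (v \<bullet> i)) / D"
      define \<beta> where "\<beta> = (dq * (u \<bullet> i) - dp * (u \<bullet> j)) / D"
      have sol: "\<alpha> * (u \<bullet> i) + \<beta> * (v \<bullet> i) = dp" "\<alpha> * (u \<bullet> j) + \<beta> * (v \<bullet> j) = dq"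
        using D by (auto simp: \<alpha>_def \<beta>_def field_simps) (auto simp: D_def algebra_simps)
      have bnd: "\<bar>(s * a - t * b) / D\<bar> \<le> 1 / 12" if "\<bar>s\<bar> \<le> e" "\<bar>t\<bar> \<le> e" "\<bar>a\<bar> + \<bar>b\<bar> \<le> S" for s t a b
      proof -
        have "\<bar>s * a - t * b\<bar> \<le> \<bar>s\<bar> * \<bar>a\<bar> + \<bar>t\<bar> * \<bar>b\<bar>"
          by (metis abs_mult abs_triangle_ineq4)
        also have "\<dots> \<le> e * \<bar>a\<bar> + e * \<bar>b\<bar>" using that by (intro add_mono mult_right_mono) auto
        also have "\<dots> \<le> e * S" using that e by (simp add: distrib_left[symmetric])
        also have "\<dots> = \<bar>D\<bar> / 12" using S by (simp add: e_def)
        finally show ?thesis using D by (simp add: field_simps)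
      qed
      have \<alpha>: "\<bar>\<alpha>\<bar> \<le> 1 / 12" unfolding \<alpha>_def by (rule bnd) (use dpq in \<open>auto simp: S_def\<close>)
      have \<beta>: "\<bar>\<beta>\<bar> \<le> 1 / 12" unfolding \<beta>_def by (rule bnd) (use dpq in \<open>auto simp: S_def\<close>)
      define pt where "pt r t = x + (1 / 3 + \<alpha> + r) *\<^sub>R u + (1 / 3 + \<beta> + t) *\<^sub>R v" for r t
      have pt: "pt r t \<in> \<sigma>" if "\<bar>r\<bar> \<le> 1 / 12" "\<bar>t\<bar> \<le> 1 / 12" for r t
      proof -
        have "0 \<le> 1 / 3 + \<alpha> + r" "0 \<le> 1 / 3 + \<beta> + t" "(1 / 3 + \<alpha> + r) + (1 / 3 + \<beta> + t) \<le> 1"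
          using that \<alpha> \<beta> by (auto simp: abs_le_iff)
        then have "pt r t \<in> convex hull {x, y, w}"
          unfolding convex_hull_3_alt pt_def u_def v_def by blast
        also have "\<dots> \<subseteq> \<sigma>" using x y(1) w by (intro hull_minimal assms(1)) auto
        finally show ?thesis .
      qed
      obtain \<theta> where \<theta>: "\<And>x. x \<in> \<sigma> \<Longrightarrow> 0 \<le> (x - (p *\<^sub>R i + q *\<^sub>R j)) \<bullet> (cos \<theta> *\<^sub>R i + sin \<theta> *\<^sub>R j)"
        using axes[OF i(1) j(1) \<open>i \<noteq> j\<close> p(1) q(1)] by blast
      have ij: "i \<bullet> i = 1" "j \<bullet> j = 1" "i \<bullet> j = 0" "j \<bullet> i = 0"
        using i j \<open>i \<noteq> j\<close> by (auto simp: inner_Basis)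
      have pti: "pt r t \<bullet> i = p + r * (u \<bullet> i) + t * (v \<bullet> i)" for r t
        using sol(1) by (simp add: pt_def dp_def P_def inner_left_distrib field_simps)
      have ptj: "pt r t \<bullet> j = q + r * (u \<bullet> j) + t * (v \<bullet> j)" for r t
        using sol(2) by (simp add: pt_def dq_def P_def inner_left_distrib field_simps)
      have val: "(pt r t - (p *\<^sub>R i + q *\<^sub>R j)) \<bullet> (cos \<theta> *\<^sub>R i + sin \<theta> *\<^sub>R j)
         = r * (cos \<theta> * (u \<bullet> i) + sin \<theta> * (u \<bullet> j)) + t * (cos \<theta> * (v \<bullet> i) + sin \<theta> * (v \<bullet> j))" for r t
        by (simp add: inner_diff_left inner_left_distrib inner_right_distrib pti ptj ij)
          (simp add: algebra_simps)
      \<comment> \<open>By \<open>val\<close> the functional is linear in \<open>(r, t)\<close>.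
        Being nonnegative for both signs of \<open>r\<close>, it has coefficient 0 there, and
        likewise for \<open>t\<close>; a unit vector would then annihilate two independent projected
        sides.\<close>
      have 1: "cos \<theta> * (u \<bullet> i) + sin \<theta> * (u \<bullet> j) = 0"
        using \<theta>[OF pt[of "1/12" 0]] \<theta>[OF pt[of "-1/12" 0]] by (simp add: val)
      have 2: "cos \<theta> * (v \<bullet> i) + sin \<theta> * (v \<bullet> j) = 0"
        using \<theta>[OF pt[of 0 "1/12"]] \<theta>[OF pt[of 0 "-1/12"]] by (simp add: val)
      have "cos \<theta> * D = (cos \<theta> * (u \<bullet> i) + sin \<theta> * (u \<bullet> j)) * (v \<bullet> j) - (cos \<theta> * (v \<bullet> i) + sin \<theta> * (v \<bullet> j)) * (u \<bullet> j)"
        "sin \<theta> * D = (cos \<theta> * (v \<bullet> i) + sin \<theta> * (v \<bullet> j)) * (u \<bullet> i) - (cos \<theta> * (u \<bullet> i) + sin \<theta> * (u \<bullet> j)) * (v \<bullet> i)"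
        by (simp_all add: D_def algebra_simps)
      then have "cos \<theta> * D = 0" "sin \<theta> * D = 0" unfolding 1 2 by simp_all
      then have "cos \<theta> = 0" "sin \<theta> = 0" using D by simp_all
      then show False using sin_cos_squared_add[of \<theta>] by simp
    qed
    then have line: "\<exists>r. w = x + r *\<^sub>R u" if "w \<in> \<sigma>" for w
      using that by (metis add.commute diff_add_cancel)
    show thesis
    proof (rule result[of "u /\<^sub>R norm u" x])
      show "\<sigma> \<subseteq> range (\<lambda>\<tau>. x + \<tau> *\<^sub>R (u /\<^sub>R norm u))"
      proof
        fix w assume "w \<in> \<sigma>"
        then obtain r where "w = x + r *\<^sub>R u" using line by blast
        then have "w = x + (r * norm u) *\<^sub>R (u /\<^sub>R norm u)" using u by simp
        then show "w \<in> range (\<lambda>\<tau>. x + \<tau> *\<^sub>R (u /\<^sub>R norm u))" by blast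
      qed
    qed (use u in simp)
  qed
qed

text \<open>Otherwise the points of \<open>C \<inter> K n\<close> whose projections stay
  \<open>\<epsilon>\<close> away from those of the limit set form a nest of nonempty compact sets. A
  common point belongs to the limit set, yet would have distance at least \<open>\<epsilon>\<close>
  from itself.\<close>

lemma compact_nest_projection:
  fixes K :: "nat \<Rightarrow> 'a::euclidean_space set" and \<pi> :: "'a \<Rightarrow> real"
  assumes K: "\<And>n. compact (K n)" "decseq K" and "closed C" and \<pi>: "continuous_on UNIV \<pi>" and "0 < \<epsilon>"
  shows "\<exists>n. \<forall>x\<in>C \<inter> K n. \<exists>y\<in>C \<inter> (\<Inter>n. K n). dist (\<pi> x) (\<pi> y) < \<epsilon>"
proof (rule ccontr)
  assume no: "\<nexists>n. \<forall>x\<in>C \<inter> K n. \<exists>y\<in>C \<inter> (\<Inter>n. K n). dist (\<pi> x) (\<pi> y) < \<epsilon>"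
  define T where "T n = K n \<inter> (C \<inter> (\<Inter>y\<in>C \<inter> (\<Inter>n. K n). {x. \<epsilon> \<le> dist (\<pi> x) (\<pi> y)}))" for n
  have "\<Inter>(range T) \<noteq> {}"
  proof (rule compact_nest)
    show "compact (T n)" for n unfolding T_def
      by (intro compact_Int_closed K closed_Int assms(3) closed_INT ballI closed_Collect_le continuous_intros \<pi>)
    show "T n \<noteq> {}" for n using no by (fastforce simp: T_def not_less)
    show "T n \<subseteq> T m" if "m \<le> n" for m n
      using decseqD[OF K(2) that] by (auto simp: T_def)
  qed
  then obtain x where x: "\<And>n. x \<in> T n" by blast
  then have "x \<in> C \<inter> (\<Inter>n. K n)" by (auto simp: T_def)
  then have "\<epsilon> \<le> dist (\<pi> x) (\<pi> x)" using x[of 0] unfolding T_def by blast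
  then show False using \<open>0 < \<epsilon>\<close> by simp
qed

subsection \<open>Localization and the dilation inequality\<close>

lemma pmean_le_of_s_concave:
  assumes "s_concave s \<mu>" "compact A" "compact B" "0 < measure \<mu> A" "0 < measure \<mu> B"
    "0 \<le> a" "a \<le> 1"
  shows "pmean s a (measure \<mu> A) (measure \<mu> B) \<le> measure \<mu> {a *\<^sub>R x + (1 - a) *\<^sub>R y | x y. x \<in> A \<and> y \<in> B}"
  using assms by (auto simp: s_concave_def pmean_def)

section \<open>Hyperplanes, half-spaces and bisection\<close>

locale s_concave_measure = finite_measure \<mu> for \<mu> :: "'a::euclidean_space measure" +
  fixes s :: real
  assumes s_neg: "s < 0" and sets_eq [simp, measurable_cong]: "sets \<mu> = sets borel"
    and s_concave: "s_concave s \<mu>"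
begin

lemma space_eq [simp]: "space \<mu> = UNIV"
  using sets_eq_imp_space_eq[OF sets_eq] by simp

lemma measure_mono:
  assumes "A \<subseteq> B" "B \<in> sets borel"
  shows "measure \<mu> A \<le> measure \<mu> B"
  using finite_measure_mono[of A B] assms by simp

lemma measure_Int_split:
  assumes "S \<in> sets borel" "H \<in> sets borel" "H' \<in> sets borel" "H \<union> H' = UNIV" "measure \<mu> (S \<inter> (H \<inter> H')) = 0"
  shows "measure \<mu> S = measure \<mu> (S \<inter> H) + measure \<mu> (S \<inter> H')"
proof -
  have "S = (S \<inter> H - S \<inter> (H \<inter> H')) \<union> (S \<inter> H')" using assms(4) by auto
  then have "measure \<mu> S = measure \<mu> ((S \<inter> H - S \<inter> (H \<inter> H')) \<union> (S \<inter> H'))" by simp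
  also have "\<dots> = measure \<mu> (S \<inter> H - S \<inter> (H \<inter> H')) + measure \<mu> (S \<inter> H')"
    using assms by (intro finite_measure_Union) auto
  also have "measure \<mu> (S \<inter> H - S \<inter> (H \<inter> H')) = measure \<mu> (S \<inter> H)"
    using finite_measure_Diff[of "S \<inter> H" "S \<inter> (H \<inter> H')"] assms by (simp add: Int_assoc) (simp add: subset_iff)
  finally show ?thesis .
qed

text \<open>
  Interpolating between a charged hyperplane section and a charged set on one side of it yields
  sets of measure bounded below in arbitrarily thin slabs, which is impossible.
\<close>
lemma hyperplane_side_null:
  assumes K: "compact K" "convex K" and pos: "0 < measure \<mu> (K \<inter> {x. (x - c) \<bullet> v = 0})"
  shows "measure \<mu> (K \<inter> {x. 0 < (x - c) \<bullet> v}) = 0"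
proof (rule ccontr)
  let ?h = "\<lambda>x. (x - c) \<bullet> v"
  have cont: "continuous_on S ?h" for S by (intro continuous_intros)
  have Kb: "K \<in> sets borel" using K by (simp add: borel_compact)
  have hm [measurable]: "?h \<in> borel_measurable borel" by measurable
  assume "measure \<mu> (K \<inter> {x. 0 < ?h x}) \<noteq> 0"
  then have nz: "0 < measure \<mu> (K \<inter> {x. 0 < ?h x})" by (simp add: zero_less_measure_iff)
  \<comment> \<open>The concavity inequality is about compact sets, so the open side is exhausted by
    compact sets at positive height.\<close>
  define D where "D n = K \<inter> {x. inverse (real (Suc n)) \<le> ?h x}" for n
  have "(\<lambda>n. measure \<mu> (D n)) \<longlonglongrightarrow> measure \<mu> (\<Union>n. D n)"
  proof (rule finite_Lim_measure_incseq)
    show "range D \<subseteq> sets \<mu>" using Kb unfolding D_def by (auto simp: Int_def)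
    show "incseq D"
    proof (rule incseq_SucI)
      fix n
      have le: "inverse (real (Suc (Suc n))) \<le> inverse (real (Suc n))" by simp
      show "D n \<subseteq> D (Suc n)" unfolding D_def by (auto intro: order_trans[OF le] simp del: of_nat_Suc)
    qed
  qed
  also have "(\<Union>n. D n) = K \<inter> {x. 0 < ?h x}"
  proof (intro equalityI subsetI)
    fix x assume "x \<in> K \<inter> {x. 0 < ?h x}"
    then show "x \<in> (\<Union>n. D n)"
      using reals_Archimedean[of "?h x"] by (auto simp: D_def intro: less_imp_le)
  next
    fix x assume "x \<in> (\<Union>n. D n)"
    then obtain n where n: "x \<in> K" "inverse (real (Suc n)) \<le> ?h x" by (auto simp: D_def)
    have "0 < inverse (real (Suc n))" by simp
    from less_le_trans[OF this n(2)] n(1) show "x \<in> K \<inter> {x. 0 < ?h x}" by simp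
  qed
  finally have "\<forall>\<^sub>F n in sequentially. 0 < measure \<mu> (D n)"
    using nz by (intro order_tendstoD) auto
  then obtain n where Dn: "0 < measure \<mu> (D n)"
    using eventually_sequentially by auto
  define C where "C = K \<inter> {x. ?h x = 0}"
  have cC: "compact C"
    unfolding C_def by (intro compact_Int_closed K closed_Collect_eq continuous_intros)
  have cD: "compact (D n)"
    unfolding D_def by (intro compact_Int_closed K closed_Collect_le continuous_intros)
  define \<kappa> where "\<kappa> = min (measure \<mu> C) (measure \<mu> (D n))"
  have \<kappa>: "0 < \<kappa>" using Dn pos by (simp add: \<kappa>_def C_def)
  obtain M where M: "0 < M" "\<And>x. x \<in> K \<Longrightarrow> ?h x \<le> M"
  proof -
    have "bounded (?h ` K)" by (intro compact_imp_bounded compact_continuous_image cont K)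
    then obtain M where "0 < M" "\<forall>x\<in>?h ` K. norm x \<le> M" unfolding bounded_pos by blast
    then show thesis using that[of M] by (auto simp: abs_le_iff)
  qed
  \<comment> \<open>Weight \<open>inverse (real (Suc k))\<close> on a point of \<open>D n\<close>
    scales its height by this factor, which places the combination in \<open>T k\<close>; the lower
    bound \<open>\<kappa>\<close> does not depend on \<open>k\<close>.\<close>
  define T where "T k = K \<inter> {x. 0 < ?h x \<and> ?h x \<le> M * inverse (real (Suc k))}" for k
  have T_ge: "\<kappa> \<le> measure \<mu> (T k)" for k
  proof -
    define a where "a = 1 - inverse (real (Suc k))"
    have a: "0 \<le> a" "a \<le> 1" "1 - a = inverse (real (Suc k))"
      by (auto simp: a_def field_simps)
    interpret neg_power_mean s a using s_neg a by unfold_locales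
    have "\<kappa> \<le> pmean s a (measure \<mu> C) (measure \<mu> (D n))"
      using pmean_ge_min Dn pos by (auto simp: \<kappa>_def C_def)
    also have "\<dots> \<le> measure \<mu> {a *\<^sub>R x + (1 - a) *\<^sub>R y | x y. x \<in> C \<and> y \<in> D n}"
      using Dn pos a by (intro pmean_le_of_s_concave s_concave cC cD) (auto simp: C_def)
    also have "\<dots> \<le> measure \<mu> (T k)"
    proof (rule measure_mono)
      show "T k \<in> sets borel" using Kb unfolding T_def by measurable
      show "{a *\<^sub>R x + (1 - a) *\<^sub>R y | x y. x \<in> C \<and> y \<in> D n} \<subseteq> T k"
      proof safe
        fix x y assume x: "x \<in> C" and y: "y \<in> D n"
        have hy: "0 < ?h y"
          using y unfolding D_def by (smt (verit) IntD2 inverse_positive_iff_positive mem_Collect_eq of_nat_0_less_iff zero_less_Suc)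
        have "a *\<^sub>R x + (1 - a) *\<^sub>R y - c = a *\<^sub>R (x - c) + (1 - a) *\<^sub>R (y - c)"
          by (simp add: algebra_simps)
        then have "?h (a *\<^sub>R x + (1 - a) *\<^sub>R y) = a * ?h x + (1 - a) * ?h y"
          by (simp add: inner_left_distrib)
        then have "?h (a *\<^sub>R x + (1 - a) *\<^sub>R y) = ?h y * inverse (real (Suc k))"
          using x a(3) by (simp add: C_def mult.commute)
        moreover have "a *\<^sub>R x + (1 - a) *\<^sub>R y \<in> K"
          by (rule convexD[OF K(2)]) (use x y a(1,2) in \<open>auto simp: C_def D_def\<close>)
        moreover have "?h y \<le> M" using M(2) y by (simp add: D_def)
        ultimately show "a *\<^sub>R x + (1 - a) *\<^sub>R y \<in> T k"
          using hy by (auto simp: T_def intro!: mult_right_mono mult_pos_pos)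
      qed
    qed
    finally show ?thesis .
  qed
  have "(\<lambda>k. measure \<mu> (T k)) \<longlonglongrightarrow> measure \<mu> (\<Inter>k. T k)"
  proof (rule finite_Lim_measure_decseq)
    have "T k \<in> sets borel" for k using Kb unfolding T_def by measurable
    then show "range T \<subseteq> sets \<mu>" by auto
    show "decseq T"
    proof (rule decseq_SucI)
      fix k
      have "M * inverse (real (Suc (Suc k))) \<le> M * inverse (real (Suc k))" using M by simp
      then show "T (Suc k) \<subseteq> T k" unfolding T_def by (auto simp del: of_nat_Suc)
    qed
  qed
  moreover have "(\<Inter>k. T k) = {}"
  proof safe
    fix x assume x: "x \<in> (\<Inter>k. T k)"
    then have "0 < ?h x" by (auto simp: T_def)
    then obtain k where "inverse (real (Suc k)) < ?h x / M" using reals_Archimedean[of "?h x / M"] M by auto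
    then have "M * inverse (real (Suc k)) < ?h x" using M by (simp add: pos_less_divide_eq mult.commute)
    moreover have "?h x \<le> M * inverse (real (Suc k))" using x by (auto simp: T_def)
    ultimately show "x \<in> {}" by simp
  qed
  ultimately have "(\<lambda>k. measure \<mu> (T k)) \<longlonglongrightarrow> 0" by simp
  then have "\<kappa> \<le> 0" using T_ge by (intro LIMSEQ_le_const) auto
  then show False using \<kappa> by simp
qed

text \<open>Replacing \<open>v\<close> by \<open>- v\<close> makes both open sides null. Within a
  convex body a hyperplane is therefore either null or carries everything.\<close>

lemma hyperplane_section_full:
  assumes K: "compact K" "convex K" and pos: "0 < measure \<mu> (K \<inter> {x. (x - c) \<bullet> v = 0})"
    and S: "S \<in> sets borel" "S \<subseteq> K"
  shows "measure \<mu> (S \<inter> {x. (x - c) \<bullet> v = 0}) = measure \<mu> S"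
proof -
  have Kb: "K \<in> sets borel" using K by (simp add: borel_compact)
  let ?P = "K \<inter> {x. 0 < (x - c) \<bullet> v}" and ?N = "K \<inter> {x. 0 < (x - c) \<bullet> (- v)}"
  have "measure \<mu> ?P = 0" "measure \<mu> ?N = 0"
    using hyperplane_side_null[OF K pos] hyperplane_side_null[OF K, of c "- v"] pos by simp_all
  moreover have [measurable]: "?P \<in> sets borel" "?N \<in> sets borel" using Kb by auto
  ultimately have "measure \<mu> (?P \<union> ?N) = 0"
    using measure_Un_le[of ?P \<mu> ?N] by (simp add: measure_le_0_iff)
  have "measure \<mu> S \<le> measure \<mu> (S \<inter> {x. (x - c) \<bullet> v = 0} \<union> (?P \<union> ?N))"
    using S Kb by (intro measure_mono) auto
  also have "\<dots> \<le> measure \<mu> (S \<inter> {x. (x - c) \<bullet> v = 0}) + measure \<mu> (?P \<union> ?N)"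
    using S Kb by (intro measure_Un_le) auto
  finally have "measure \<mu> S \<le> measure \<mu> (S \<inter> {x. (x - c) \<bullet> v = 0})"
    using \<open>measure \<mu> (?P \<union> ?N) = 0\<close> by simp
  moreover have "measure \<mu> (S \<inter> {x. (x - c) \<bullet> v = 0}) \<le> measure \<mu> S"
    using S by (intro measure_mono) auto
  ultimately show ?thesis by simp
qed

lemma tendsto_measure_halfspace:
  assumes S: "S \<in> sets borel" and null: "measure \<mu> (S \<inter> {x. (x - c) \<bullet> v = 0}) = 0"
    and lim: "u \<longlonglongrightarrow> v"
  shows "(\<lambda>n. measure \<mu> (S \<inter> {x. 0 \<le> (x - c) \<bullet> u n})) \<longlonglongrightarrow> measure \<mu> (S \<inter> {x. 0 \<le> (x - c) \<bullet> v})"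
proof -
  have "(\<lambda>n. integral\<^sup>L \<mu> (indicator (S \<inter> {x. 0 \<le> (x - c) \<bullet> u n}) :: 'a \<Rightarrow> real))
      \<longlonglongrightarrow> integral\<^sup>L \<mu> (indicator (S \<inter> {x. 0 \<le> (x - c) \<bullet> v}))"
  proof (rule integral_dominated_convergence[where w = "\<lambda>_. 1"])
    have "S \<inter> {x. (x - c) \<bullet> v = 0} \<in> null_sets \<mu>"
      using null S by (auto simp: emeasure_eq_measure)
    then have "AE x in \<mu>. x \<notin> S \<inter> {x. (x - c) \<bullet> v = 0}" by (rule AE_not_in)
    then show "AE x in \<mu>. (\<lambda>n. indicator (S \<inter> {x. 0 \<le> (x - c) \<bullet> u n}) x :: real)
        \<longlonglongrightarrow> indicator (S \<inter> {x. 0 \<le> (x - c) \<bullet> v}) x"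
    proof eventually_elim
      case (elim x)
      have t: "(\<lambda>n. (x - c) \<bullet> u n) \<longlonglongrightarrow> (x - c) \<bullet> v" by (intro tendsto_intros lim)
      consider "x \<notin> S" | "0 < (x - c) \<bullet> v" | "(x - c) \<bullet> v < 0" using elim by fastforce
      then show ?case
      proof cases
        case 2
        have ev: "\<forall>\<^sub>F n in sequentially. 0 < (x - c) \<bullet> u n" using order_tendstoD(1)[OF t 2] .
        show ?thesis
          by (rule tendsto_eventually, rule eventually_mono[OF ev]) (use 2 in \<open>auto simp: indicator_def\<close>)
      next
        case 3
        have ev: "\<forall>\<^sub>F n in sequentially. (x - c) \<bullet> u n < 0" using order_tendstoD(2)[OF t 3] .
        show ?thesis
          by (rule tendsto_eventually, rule eventually_mono[OF ev]) (use 3 in \<open>auto simp: indicator_def\<close>)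
      qed simp
    qed
  qed (use S in auto)
  then show ?thesis by simp
qed

text \<open>A hyperplane turning about an axis has one degree of freedom, enough to keep one share
  exactly: that of \<open>B\<close>. For \<open>F\<close> an inequality is kept, because of two
  halves at least one does not fall below the average.\<close>

definition balanced :: "'a set \<Rightarrow> 'a set \<Rightarrow> real \<Rightarrow> real \<Rightarrow> 'a set \<Rightarrow> bool" where
  "balanced B F b \<phi> K \<longleftrightarrow> compact K \<and> convex K \<and> 0 < measure \<mu> K \<and>
     measure \<mu> (B \<inter> K) = b * measure \<mu> K \<and> \<phi> * measure \<mu> K \<le> measure \<mu> (F \<inter> K)"

text \<open>Turning by \<open>pi\<close> exchanges the halves and changes the sign of
  \<open>\<Phi>\<close>, so \<open>\<Phi>\<close> has a zero, where \<open>B\<close> has its share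
  in both halves. Continuity requires null hyperplanes; if one of them is charged, its section with
  \<open>K\<close> has all the mass, lies in the half-space, and serves as
  \<open>K'\<close>.\<close>

lemma bisection:
  assumes bal: "balanced B F b \<phi> K" and BF: "B \<in> sets borel" "F \<in> sets borel"
  obtains K' \<theta> where "K' \<subseteq> K" "balanced B F b \<phi> K'"
    "\<And>x. x \<in> K' \<Longrightarrow> 0 \<le> (x - c) \<bullet> (cos \<theta> *\<^sub>R e1 + sin \<theta> *\<^sub>R e2)"
proof -
  note select = that
  have K: "compact K" "convex K" "0 < measure \<mu> K" "measure \<mu> (B \<inter> K) = b * measure \<mu> K"
    "\<phi> * measure \<mu> K \<le> measure \<mu> (F \<inter> K)" using bal by (auto simp: balanced_def)
  have Kb: "K \<in> sets borel" using K by (simp add: borel_compact)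
  have S: "B \<inter> K \<in> sets borel" "F \<inter> K \<in> sets borel" using BF Kb by auto
  define v where "v \<theta> = cos \<theta> *\<^sub>R e1 + sin \<theta> *\<^sub>R e2" for \<theta>
  define H where "H \<theta> = {x. 0 \<le> (x - c) \<bullet> v \<theta>}" for \<theta>
  define P where "P \<theta> = {x. (x - c) \<bullet> v \<theta> = 0}" for \<theta>
  have [simp]: "H \<theta> \<in> sets borel" "P \<theta> \<in> sets borel" for \<theta> unfolding H_def P_def by measurable
  have clP: "closed (P \<theta>)" "closed (H \<theta>)" for \<theta>
    unfolding P_def H_def by (intro closed_Collect_eq closed_Collect_le continuous_intros)+
  have vpi: "v (\<theta> + pi) = - v \<theta>" for \<theta> by (simp add: v_def)
  have cvP: "convex (P \<theta>)" "convex (H \<theta>)" for \<theta>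
  proof -
    have "P \<theta> = {x. v \<theta> \<bullet> x = v \<theta> \<bullet> c}" "H \<theta> = {x. v \<theta> \<bullet> x \<ge> v \<theta> \<bullet> c}"
      by (auto simp: P_def H_def inner_diff_left inner_commute[of "v \<theta>"])
    then show "convex (P \<theta>)" "convex (H \<theta>)"
      by (simp_all add: convex_hyperplane convex_halfspace_ge)
  qed
  show thesis
  proof (cases "\<exists>\<theta>. 0 < measure \<mu> (K \<inter> P \<theta>)")
    case True
    then obtain \<theta> where \<theta>: "0 < measure \<mu> (K \<inter> P \<theta>)" by blast
    have full: "measure \<mu> (S \<inter> P \<theta>) = measure \<mu> S" if "S \<in> sets borel" "S \<subseteq> K" for S
      using hyperplane_section_full[OF K(1,2) \<theta>[unfolded P_def] that] by (simp add: P_def)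
    show thesis
    proof (rule that[of "K \<inter> P \<theta>" \<theta>])
      show "balanced B F b \<phi> (K \<inter> P \<theta>)"
        unfolding balanced_def
        using K full[OF Kb] full[OF S(1)] full[OF S(2)] clP cvP
        by (simp add: Int_assoc compact_Int_closed convex_Int)
      show "0 \<le> (x - c) \<bullet> (cos \<theta> *\<^sub>R e1 + sin \<theta> *\<^sub>R e2)" if "x \<in> K \<inter> P \<theta>" for x
        using that by (simp add: P_def v_def)
    qed auto
  next
    case False
    have null: "measure \<mu> (S \<inter> P \<theta>) = 0" if "S \<in> sets borel" "S \<subseteq> K" for S \<theta>
    proof -
      have "measure \<mu> (S \<inter> P \<theta>) \<le> measure \<mu> (K \<inter> P \<theta>)" using that Kb by (intro measure_mono) auto
      moreover have "measure \<mu> (K \<inter> P \<theta>) = 0" using False by (auto simp: zero_less_measure_iff)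
      ultimately show ?thesis by (simp add: measure_le_0_iff)
    qed
    have split: "measure \<mu> S = measure \<mu> (S \<inter> H \<theta>) + measure \<mu> (S \<inter> H (\<theta> + pi))"
      if "S \<in> sets borel" "S \<subseteq> K" for S \<theta>
    proof (rule measure_Int_split)
      have "H \<theta> \<inter> H (\<theta> + pi) = P \<theta>" by (auto simp: H_def P_def vpi)
      then show "measure \<mu> (S \<inter> (H \<theta> \<inter> H (\<theta> + pi))) = 0" using null[OF that] by simp
      show "H \<theta> \<union> H (\<theta> + pi) = UNIV" by (auto simp: H_def vpi)
    qed (use that in auto)
    have cont: "continuous_on UNIV (\<lambda>\<theta>. measure \<mu> (S \<inter> H \<theta>))" if "S \<in> sets borel" "S \<subseteq> K" for S
    proof (clarsimp simp: continuous_on_sequentially comp_def)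
      fix x :: "nat \<Rightarrow> real" and a assume "x \<longlonglongrightarrow> a"
      then have "(\<lambda>n. v (x n)) \<longlonglongrightarrow> v a" unfolding v_def by (intro tendsto_intros)
      then show "(\<lambda>n. measure \<mu> (S \<inter> H (x n))) \<longlonglongrightarrow> measure \<mu> (S \<inter> H a)"
        using tendsto_measure_halfspace[OF that(1), of c "v a" "\<lambda>n. v (x n)"] null[OF that, of a]
        by (simp add: P_def H_def)
    qed
    define \<Phi> where "\<Phi> \<theta> = measure \<mu> ((B \<inter> K) \<inter> H \<theta>) - b * measure \<mu> (K \<inter> H \<theta>)" for \<theta>
    have \<Phi>_cont: "continuous_on {0..pi} \<Phi>"
      unfolding \<Phi>_def
      by (rule continuous_on_subset[OF _ subset_UNIV], intro continuous_intros cont) (use S Kb in auto)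
    have \<Phi>_anti: "\<Phi> (\<theta> + pi) = - \<Phi> \<theta>" for \<theta>
    proof -
      have "b * measure \<mu> K = b * measure \<mu> (K \<inter> H \<theta>) + b * measure \<mu> (K \<inter> H (\<theta> + pi))"
        using split[OF Kb, of \<theta>] by (simp add: distrib_left[symmetric])
      then show ?thesis using split[OF S(1), of \<theta>] K(4) by (simp add: \<Phi>_def)
    qed
    have "\<exists>\<theta>. \<Phi> \<theta> = 0"
      using IVT'[of \<Phi> 0 0 pi] IVT2'[of \<Phi> pi 0 0] \<Phi>_cont \<Phi>_anti[of 0]
      by (cases "\<Phi> 0 \<le> 0") force+
    then obtain \<theta> where \<theta>: "\<Phi> \<theta> = 0" by blast
    have good: thesis if "\<Phi> \<theta> = 0" "0 < measure \<mu> (K \<inter> H \<theta>)"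
      "\<phi> * measure \<mu> (K \<inter> H \<theta>) \<le> measure \<mu> (F \<inter> K \<inter> H \<theta>)" for \<theta>
    proof (rule select[of "K \<inter> H \<theta>" \<theta>])
      show "balanced B F b \<phi> (K \<inter> H \<theta>)"
        unfolding balanced_def using K clP cvP that
        by (simp add: Int_assoc compact_Int_closed convex_Int \<Phi>_def)
      show "0 \<le> (x - c) \<bullet> (cos \<theta> *\<^sub>R e1 + sin \<theta> *\<^sub>R e2)" if "x \<in> K \<inter> H \<theta>" for x
        using that by (simp add: H_def v_def)
    qed auto
    show thesis
    proof (cases "0 < measure \<mu> (K \<inter> H \<theta>) \<and> \<phi> * measure \<mu> (K \<inter> H \<theta>) \<le> measure \<mu> (F \<inter> K \<inter> H \<theta>)")
      case True
      then show thesis using good[OF \<theta>] by simp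
    next
      case False
      let ?m = "measure \<mu> (K \<inter> H \<theta>)" and ?m' = "measure \<mu> (K \<inter> H (\<theta> + pi))"
      let ?f = "measure \<mu> (F \<inter> K \<inter> H \<theta>)" and ?f' = "measure \<mu> (F \<inter> K \<inter> H (\<theta> + pi))"
      have m: "measure \<mu> K = ?m + ?m'" using split[OF Kb, of \<theta>] by simp
      have f: "measure \<mu> (F \<inter> K) = ?f + ?f'" using split[OF S(2), of \<theta>] by simp
      have ff: "?f \<le> ?m" "?f' \<le> ?m'" using Kb by (auto intro!: measure_mono)
      have tot: "\<phi> * ?m + \<phi> * ?m' \<le> ?f + ?f'" using K(5) m f by (simp add: distrib_left)
      \<comment> \<open>A half that fails is null, and then the other has everything, or it has less
        than the share \<open>\<phi>\<close> of \<open>F\<close>, and then the other has more than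
        that share and in particular positive mass.\<close>
      have "0 < ?m' \<and> \<phi> * ?m' \<le> ?f'"
      proof (cases "?m = 0")
        case True
        then have "?f = 0" using ff by (simp add: measure_le_0_iff)
        then show ?thesis using True m tot K(3) by simp
      next
        case nz: False
        then have "?f < \<phi> * ?m" using False by (auto simp: zero_less_measure_iff)
        then have "\<phi> * ?m' < ?f'" using tot by linarith
        moreover have "?m' \<noteq> 0"
          using calculation ff(2) by auto
        ultimately show ?thesis by (simp add: zero_less_measure_iff less_imp_le)
      qed
      then show thesis using good[of "\<theta> + pi"] \<theta> \<Phi>_anti[of \<theta>] by simp
    qed
  qed
qed

text \<open>As the bodies are nested, one bisection through an axis keeps all later bodies on one
  side of some hyperplane containing it. Enumerating the countably many rational axes therefore
  treats all of them.\<close>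

lemma localization:
  assumes bal: "balanced B F b \<phi> K0" and BF: "B \<in> sets borel" "F \<in> sets borel"
  obtains K z u where "decseq K" "\<And>n. balanced B F b \<phi> (K n)" "norm u = 1"
    "(\<Inter>n. K n) \<subseteq> range (\<lambda>\<tau>. z + \<tau> *\<^sub>R u)"
proof -
  define I where "I = (Basis :: 'a set) \<times> (Basis :: 'a set) \<times> (\<rat> :: real set) \<times> (\<rat> :: real set)"
  have "countable I" unfolding I_def by (intro countable_SIGMA countable_finite finite_Basis countable_rat)
  have "I \<noteq> {}" unfolding I_def using nonempty_Basis Rats_0 by (metis SigmaI empty_iff ex_in_conv)
  define Q where "Q n K' = (case from_nat_into I n of (i, j, p, q) \<Rightarrow>
    \<exists>\<theta>. \<forall>x\<in>K'. 0 \<le> (x - (p *\<^sub>R i + q *\<^sub>R j)) \<bullet> (cos \<theta> *\<^sub>R i + sin \<theta> *\<^sub>R j))" for n K'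
  have "\<exists>K. \<forall>n. balanced B F b \<phi> (K n) \<and> (K (Suc n) \<subseteq> K n \<and> Q n (K (Suc n)))"
  proof (rule dependent_nat_choice)
    show "\<exists>K. balanced B F b \<phi> K" using bal by blast
    show "\<exists>K'. balanced B F b \<phi> K' \<and> K' \<subseteq> K \<and> Q n K'" if "balanced B F b \<phi> K" for K n
    proof -
      obtain i j p q where ijpq: "from_nat_into I n = (i, j, p, q)" by (metis prod_cases4)
      from bisection[OF that BF, of "p *\<^sub>R i + q *\<^sub>R j" i j]
      obtain K' \<theta> where "K' \<subseteq> K" "balanced B F b \<phi> K'"
        "\<And>x. x \<in> K' \<Longrightarrow> 0 \<le> (x - (p *\<^sub>R i + q *\<^sub>R j)) \<bullet> (cos \<theta> *\<^sub>R i + sin \<theta> *\<^sub>R j)"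
        by metis
      then show ?thesis unfolding Q_def ijpq by auto
    qed
  qed
  then obtain K where K: "\<And>n. balanced B F b \<phi> (K n)" "\<And>n. K (Suc n) \<subseteq> K n" "\<And>n. Q n (K (Suc n))"
    by blast
  have dec: "decseq K" using K(2) by (rule decseq_SucI)
  have cK: "compact (K n)" "convex (K n)" "K n \<noteq> {}" for n
    using K(1)[of n] by (auto simp: balanced_def)
  obtain z u where "norm u = 1" "(\<Inter>n. K n) \<subseteq> range (\<lambda>\<tau>. z + \<tau> *\<^sub>R u)"
  proof (rule collinear_of_rational_axes[of "\<Inter>n. K n"])
    show "convex (\<Inter>n. K n)" using cK by (intro convex_INT) auto
    show "(\<Inter>n. K n) \<noteq> {}" using cK dec by (intro compact_nest) (auto simp: decseq_def)
    show "\<exists>\<theta>. \<forall>x\<in>\<Inter>n. K n. 0 \<le> (x - (p *\<^sub>R i + q *\<^sub>R j)) \<bullet> (cos \<theta> *\<^sub>R i + sin \<theta> *\<^sub>R j)"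
      if "i \<in> Basis" "j \<in> Basis" "i \<noteq> j" "p \<in> \<rat>" "q \<in> \<rat>" for i j p q
    proof -
      have "(i, j, p, q) \<in> I" using that by (simp add: I_def)
      then obtain n where "from_nat_into I n = (i, j, p, q)"
        using from_nat_into_surj[OF \<open>countable I\<close>] by blast
      then show ?thesis using K(3)[of n] unfolding Q_def by (auto 4 3)
    qed
  qed blast
  then show thesis using that dec K(1) by blast
qed

section \<open>Projection of a thin body to a line\<close>

definition projection :: "'a set \<Rightarrow> 'a \<Rightarrow> 'a \<Rightarrow> real measure" where
  "projection K z u = distr (density \<mu> (indicator K)) borel (\<lambda>x. (x - z) \<bullet> u)"

lemma measure_projection:
  assumes "K \<in> sets borel" "S \<in> sets borel"
  shows "measure (projection K z u) S = measure \<mu> (K \<inter> {x. (x - z) \<bullet> u \<in> S})"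
proof -
  have m: "(\<lambda>x. (x - z) \<bullet> u) \<in> density \<mu> (indicator K) \<rightarrow>\<^sub>M borel" by measurable
  have v: "(\<lambda>x. (x - z) \<bullet> u) -` S \<in> sets borel"
    using measurable_sets[of "\<lambda>x. (x - z) \<bullet> u" borel borel S] assms by simp
  have "measure (projection K z u) S = measure (density \<mu> (indicator K)) ((\<lambda>x. (x - z) \<bullet> u) -` S)"
    unfolding projection_def using assms by (subst measure_distr[OF m]) simp_all
  also have "\<dots> = measure \<mu> (K \<inter> (\<lambda>x. (x - z) \<bullet> u) -` S)"
    using assms v by (intro measure_restricted) auto
  finally show ?thesis by (simp add: vimage_def)
qed

text \<open>The part of \<open>K\<close> over a closed interval is compact, and by linearity and
  convexity the combination of two such parts lies over the combined interval. The concavity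
  inequality descends in this way; \<open>null\<close> excludes atoms.\<close>

lemma interval_concave_projection:
  assumes K: "compact K" "convex K" and R: "0 < R" "\<And>x. x \<in> K \<Longrightarrow> \<bar>(x - z) \<bullet> u\<bar> \<le> R"
    and null: "\<And>t. measure \<mu> (K \<inter> {x. (x - z) \<bullet> u = t}) = 0"
  shows "interval_concave (projection K z u) s R"
proof -
  have Kb: "K \<in> sets borel" using K by (simp add: borel_compact)
  note m = measure_projection[OF Kb, of _ z u]
  have "finite_measure (projection K z u)"
    unfolding projection_def
    by (intro finite_measure.finite_measure_distr finite_measureI) (use Kb in \<open>auto simp: emeasure_restricted\<close>)
  moreover have "interval_concave_axioms (projection K z u) s R"
  proof
    show "s < 0" by (rule s_neg)
    show "0 < R" by (rule R)
    show "sets (projection K z u) = sets borel" by (simp add: projection_def)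
    show "measure (projection K z u) {t} = 0" for t using null by (simp add: m)
    have "K \<inter> {x. (x - z) \<bullet> u \<in> - {- R..R}} = {}" using R(2) by (force simp: abs_le_iff)
    then show "measure (projection K z u) (- {- R..R}) = 0" by (simp add: m)
    show "pmean s a (measure (projection K z u) {x..x'}) (measure (projection K z u) {y..y'})
        \<le> measure (projection K z u) {a * x + (1 - a) * y..a * x' + (1 - a) * y'}"
      if "x \<le> x'" "y \<le> y'" "0 \<le> a" "a \<le> 1"
        "0 < measure (projection K z u) {x..x'}" "0 < measure (projection K z u) {y..y'}" for x x' y y' a
    proof -
      define C where "C p q = K \<inter> {x. (x - z) \<bullet> u \<in> {p..q}}" for p q
      have cC: "compact (C p q)" for p q
      proof -
        have "C p q = K \<inter> ({x. p \<le> (x - z) \<bullet> u} \<inter> {x. (x - z) \<bullet> u \<le> q})" by (auto simp: C_def)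
        then show ?thesis
          by (simp only:) (intro compact_Int_closed K closed_Int closed_Collect_le continuous_intros)
      qed
      have mC: "measure (projection K z u) {p..q} = measure \<mu> (C p q)" for p q by (simp add: m C_def)
      have "pmean s a (measure \<mu> (C x x')) (measure \<mu> (C y y'))
         \<le> measure \<mu> {a *\<^sub>R v + (1 - a) *\<^sub>R w | v w. v \<in> C x x' \<and> w \<in> C y y'}"
        using that by (intro pmean_le_of_s_concave s_concave cC) (auto simp: mC)
      also have "\<dots> \<le> measure \<mu> (C (a * x + (1 - a) * y) (a * x' + (1 - a) * y'))"
      proof (rule measure_mono)
        show "{a *\<^sub>R v + (1 - a) *\<^sub>R w | v w. v \<in> C x x' \<and> w \<in> C y y'}
           \<subseteq> C (a * x + (1 - a) * y) (a * x' + (1 - a) * y')"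
        proof safe
          fix v w assume v: "v \<in> C x x'" and w: "w \<in> C y y'"
          have "a *\<^sub>R v + (1 - a) *\<^sub>R w - z = a *\<^sub>R (v - z) + (1 - a) *\<^sub>R (w - z)"
            by (simp add: algebra_simps)
          then have "(a *\<^sub>R v + (1 - a) *\<^sub>R w - z) \<bullet> u = a * ((v - z) \<bullet> u) + (1 - a) * ((w - z) \<bullet> u)"
            by (simp add: inner_left_distrib)
          moreover have "a *\<^sub>R v + (1 - a) *\<^sub>R w \<in> K"
            by (rule convexD[OF K(2)]) (use v w that in \<open>auto simp: C_def\<close>)
          ultimately show "a *\<^sub>R v + (1 - a) *\<^sub>R w \<in> C (a * x + (1 - a) * y) (a * x' + (1 - a) * y')"
            using v w that by (auto simp: C_def intro!: add_mono mult_left_mono)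
        qed
        show "C (a * x + (1 - a) * y) (a * x' + (1 - a) * y') \<in> sets borel"
          using cC by (rule borel_compact)
      qed
      finally show ?thesis by (simp add: mC)
    qed
  qed
  ultimately show ?thesis by (simp add: interval_concave_def)
qed

theorem dilation_compact:
  assumes K: "compact K" "convex K" "0 < measure \<mu> K" and B: "compact B" and F: "compact F" and "B \<inter> F = {}"
    and a: "0 \<le> a" "a < 1" and sp: "sparse_from a B F" and pos: "0 < measure \<mu> (B \<inter> K)"
  shows "pmean s a (measure \<mu> (B \<inter> K) / measure \<mu> K) 1 \<le> 1 - measure \<mu> (F \<inter> K) / measure \<mu> K"
proof (rule ccontr)
  define b \<phi> where "b = measure \<mu> (B \<inter> K) / measure \<mu> K" and "\<phi> = measure \<mu> (F \<inter> K) / measure \<mu> K"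
  have bor: "B \<in> sets borel" "F \<in> sets borel" "K \<in> sets borel" using B F K by (auto intro: borel_compact)
  have b: "0 < b" "b \<le> 1"
    using pos K(3) measure_mono[of "B \<inter> K" K] bor by (auto simp: b_def)
  assume "\<not> ?thesis"
  \<comment> \<open>The negated claim is strict, which leaves room for the larger fraction
    \<open>a'\<close> that the fattening costs.\<close>
  then have less: "1 - \<phi> < pmean s a b 1" by (simp add: b_def \<phi>_def)
  obtain a' where a': "a < a'" "a' < 1" "1 - \<phi> < pmean s a' b 1"
    using pmean_increase_weight[OF s_neg b(1) a less] .
  interpret pm: neg_power_mean s a' using s_neg a a' by unfold_locales auto
  \<comment> \<open>With a positive share, \<open>F\<close> meets every \<open>L n\<close>, whence
    \<open>D\<close> below is nonempty.\<close>
  have \<phi>: "0 < \<phi>" using pm.pmean_mono[of b 1 1 1] b a' by simp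
  have "balanced B F b \<phi> K" using K pos by (simp add: balanced_def b_def \<phi>_def)
  from localization[OF this bor(1,2)] obtain L z u where dec: "decseq L"
    and bal: "\<And>n. balanced B F b \<phi> (L n)" and u: "norm u = 1"
    and line: "(\<Inter>n. L n) \<subseteq> range (\<lambda>\<tau>. z + \<tau> *\<^sub>R u)" by metis
  define \<pi> where "\<pi> x = (x - z) \<bullet> u" for x
  have \<pi>_cont: "continuous_on S \<pi>" for S unfolding \<pi>_def by (intro continuous_intros)
  define \<sigma> where "\<sigma> = (\<Inter>n. L n)"
  have cL: "compact (L n)" "convex (L n)" for n using bal[of n] by (auto simp: balanced_def)
  have "compact (L 0 \<inter> (\<Inter>n. L n))"
    using cL by (intro compact_Int_closed closed_INT ballI compact_imp_closed) auto
  moreover have "L 0 \<inter> (\<Inter>n. L n) = \<sigma>" by (auto simp: \<sigma>_def)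
  ultimately have c\<sigma>: "compact \<sigma>" by simp
  have on_line: "z + \<pi> x *\<^sub>R u = x" if x: "x \<in> \<sigma>" for x
  proof -
    obtain \<tau> where "x = z + \<tau> *\<^sub>R u" using x line unfolding \<sigma>_def by blast
    then show ?thesis using u by (simp add: \<pi>_def norm_eq_1)
  qed
  define A D where "A = \<pi> ` (B \<inter> \<sigma>)" and "D = \<pi> ` (F \<inter> \<sigma>)"
  have cAD: "compact A" "compact D"
    unfolding A_def D_def using B F c\<sigma>
    by (auto intro!: compact_continuous_image \<pi>_cont compact_Int)
  have near: "\<exists>n. \<forall>x\<in>C \<inter> L n. \<exists>y\<in>C \<inter> \<sigma>. dist (\<pi> x) (\<pi> y) < e" if "closed C" "0 < e" for C e
    unfolding \<sigma>_def by (rule compact_nest_projection[OF cL(1) dec that(1) \<pi>_cont that(2)])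
  have BL: "0 < measure \<mu> (B \<inter> L n)" "0 < measure \<mu> (F \<inter> L n)" for n
    using bal[of n] b \<phi> unfolding balanced_def by (auto intro: less_le_trans[rotated])
  have ne: "A \<noteq> {}" "D \<noteq> {}"
  proof -
    obtain n m where "\<forall>x\<in>B \<inter> L n. \<exists>y\<in>B \<inter> \<sigma>. dist (\<pi> x) (\<pi> y) < 1"
      "\<forall>x\<in>F \<inter> L m. \<exists>y\<in>F \<inter> \<sigma>. dist (\<pi> x) (\<pi> y) < 1"
      using near[OF compact_imp_closed[OF B], of 1] near[OF compact_imp_closed[OF F], of 1] by auto
    moreover have "B \<inter> L n \<noteq> {}" "F \<inter> L m \<noteq> {}" using BL(1)[of n] BL(2)[of m] by auto
    ultimately show "A \<noteq> {}" "D \<noteq> {}" unfolding A_def D_def by auto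
  qed
  have "A \<inter> D = {}"
    using on_line assms(6) by (auto simp: A_def D_def disjoint_iff) (metis)
  have sparse: "measure lborel (D \<inter> {min x y..max x y}) \<le> a * \<bar>x - y\<bar>" if x: "x \<in> A" for x y
  proof (rule sparse_from_line[OF sp bor(2) u])
    show "z + x *\<^sub>R u \<in> B" using x on_line by (auto simp: A_def)
    show "z + t *\<^sub>R u \<in> F" if "t \<in> D" for t using that on_line by (auto simp: D_def)
  qed (use cAD in \<open>simp add: borel_compact\<close>)
  obtain \<epsilon> where \<epsilon>: "0 < \<epsilon>"
    and far: "\<And>x. infdist x A \<le> \<epsilon> \<Longrightarrow> 2 * \<epsilon> < infdist x D"
    and sparse': "\<And>x y. infdist x A \<le> \<epsilon> \<Longrightarrow>
      measure lborel ({t. infdist t D \<le> 2 * \<epsilon>} \<inter> {min x y..max x y}) \<le> a' * \<bar>x - y\<bar>"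
    by (rule sparse_fattening[OF cAD(1) ne(1) cAD(2) ne(2) \<open>A \<inter> D = {}\<close> a(1) a'(1,2) sparse]) auto
  define A' where "A' = {t. infdist t A \<le> \<epsilon>}"
  \<comment> \<open>Radius \<open>\<epsilon>\<close> receives the projection of \<open>F\<close>;
    radius \<open>2 * \<epsilon>\<close> contains the \<open>\<epsilon>\<close>-neighbourhood of
    that set and is the thick set \<open>X\<close> of \<open>dilation_on_line\<close>.\<close>
  define D' where "D' e = {t. infdist t D \<le> e}" for e
  have cA': "compact A'" "compact (D' \<epsilon>)" "compact (D' (2 * \<epsilon>))"
    unfolding A'_def D'_def using cAD ne \<epsilon> by (auto intro: compact_infdist_le)
  obtain n m where n: "\<forall>x\<in>B \<inter> L n. \<exists>y\<in>B \<inter> \<sigma>. dist (\<pi> x) (\<pi> y) < \<epsilon>"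
    and m: "\<forall>x\<in>F \<inter> L m. \<exists>y\<in>F \<inter> \<sigma>. dist (\<pi> x) (\<pi> y) < \<epsilon>"
    using near[OF compact_imp_closed[OF B] \<epsilon>] near[OF compact_imp_closed[OF F] \<epsilon>] by auto
  define N where "N = L (max n m)"
  have N_sub: "N \<subseteq> L n" "N \<subseteq> L m" unfolding N_def using dec by (auto intro!: decseqD[OF dec])
  have BN: "\<pi> x \<in> A'" if x: "x \<in> B \<inter> N" for x
  proof -
    obtain y where "y \<in> B \<inter> \<sigma>" "dist (\<pi> x) (\<pi> y) < \<epsilon>" using n x N_sub by blast
    then show ?thesis unfolding A'_def A_def using infdist_le2[of "\<pi> y" A "\<pi> x" \<epsilon>] by (auto simp: A_def)
  qed
  have FN: "\<pi> x \<in> D' \<epsilon>" if x: "x \<in> F \<inter> N" for x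
  proof -
    obtain y where "y \<in> F \<inter> \<sigma>" "dist (\<pi> x) (\<pi> y) < \<epsilon>" using m x N_sub by blast
    then show ?thesis unfolding D'_def using infdist_le2[of "\<pi> y" D "\<pi> x" \<epsilon>] by (auto simp: D_def)
  qed
  have AD': "A' \<inter> D' (2 * \<epsilon>) = {}" using far by (force simp: A'_def D'_def)
  then have AD: "A' \<inter> D' \<epsilon> = {}" using \<epsilon> by (auto simp: D'_def)
  have N: "compact N" "convex N" "0 < measure \<mu> N" "measure \<mu> (B \<inter> N) = b * measure \<mu> N"
    "\<phi> * measure \<mu> N \<le> measure \<mu> (F \<inter> N)"
    using bal[of "max n m"] by (auto simp: balanced_def N_def)
  have Nb: "N \<in> sets borel" using N by (simp add: borel_compact)
  \<comment> \<open>A charged section would carry all of \<open>B \<inter> N\<close> and of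
    \<open>F \<inter> N\<close>, so its level \<open>t\<close> would lie both in \<open>A'\<close>
    and in \<open>D' \<epsilon>\<close>.\<close>
  have null: "measure \<mu> (N \<inter> {x. \<pi> x = t}) = 0" for t
  proof (rule ccontr)
    assume "measure \<mu> (N \<inter> {x. \<pi> x = t}) \<noteq> 0"
    moreover have eq: "{x. \<pi> x = t} = {x. (x - (z + t *\<^sub>R u)) \<bullet> u = 0}"
      using u by (auto simp: \<pi>_def inner_diff_left inner_left_distrib norm_eq_1)
    ultimately have pos: "0 < measure \<mu> (N \<inter> {x. (x - (z + t *\<^sub>R u)) \<bullet> u = 0})"
      by (simp add: zero_less_measure_iff)
    have "0 < measure \<mu> ((B \<inter> N) \<inter> {x. \<pi> x = t})" "0 < measure \<mu> ((F \<inter> N) \<inter> {x. \<pi> x = t})"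
      using hyperplane_section_full[OF N(1,2) pos, of "B \<inter> N"] hyperplane_section_full[OF N(1,2) pos, of "F \<inter> N"]
        bor Nb BL(1)[of "max n m"] BL(2)[of "max n m"] by (auto simp: eq N_def)
    then obtain x y where xy: "x \<in> B \<inter> N" "\<pi> x = t" "y \<in> F \<inter> N" "\<pi> y = t"
      by (metis (mono_tags, lifting) IntE all_not_in_conv less_irrefl measure_empty mem_Collect_eq)
    then have "t \<in> A'" "t \<in> D' \<epsilon>" using BN[OF xy(1)] FN[OF xy(3)] by (simp_all only: xy(2,4))
    then show False using AD by auto
  qed
  obtain R where R: "0 < R" "\<And>x. x \<in> N \<Longrightarrow> \<bar>\<pi> x\<bar> \<le> R" "A' \<subseteq> {-R<..<R}" "D' \<epsilon> \<subseteq> {-R<..<R}"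
  proof -
    have "bounded (\<pi> ` N \<union> A' \<union> D' \<epsilon>)"
      using cA' N by (intro bounded_Un[THEN iffD2] conjI compact_imp_bounded compact_continuous_image \<pi>_cont) auto
    then obtain r where r: "\<forall>x\<in>\<pi> ` N \<union> A' \<union> D' \<epsilon>. \<bar>x\<bar> \<le> r" by (auto simp: bounded_iff)
    show thesis
    proof (rule that[of "\<bar>r\<bar> + 1"])
      show "\<bar>\<pi> x\<bar> \<le> \<bar>r\<bar> + 1" if "x \<in> N" for x using r that by force
      show "A' \<subseteq> {-(\<bar>r\<bar> + 1)<..<\<bar>r\<bar> + 1}" "D' \<epsilon> \<subseteq> {-(\<bar>r\<bar> + 1)<..<\<bar>r\<bar> + 1}" using r by force+
    qed simp
  qed
  interpret P: interval_concave "projection N z u" s R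
    using N R null by (intro interval_concave_projection) (auto simp: \<pi>_def)
  note mP = measure_projection[OF Nb, of _ z u, folded \<pi>_def]
  have P_UNIV: "measure (projection N z u) UNIV = measure \<mu> N" by (simp add: mP)
  \<comment> \<open>The share of the fattened set \<open>A'\<close> may exceed \<open>b\<close>.
    This is harmless: the mean is monotone, so the bound obtained with \<open>b'\<close> implies the
    one with \<open>b\<close>.\<close>
  define b' where "b' = measure (projection N z u) A' / measure \<mu> N"
  have pre: "{x. \<pi> x \<in> S} \<in> sets borel" if "S \<in> sets borel" for S
  proof -
    have "\<pi> \<in> borel_measurable borel" unfolding \<pi>_def by measurable
    from measurable_sets[OF this that] show ?thesis by (simp add: vimage_def)
  qed
  have borA: "A' \<in> sets borel" "D' \<epsilon> \<in> sets borel" "D' (2 * \<epsilon>) \<in> sets borel"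
    using cA' by (auto intro: borel_compact)
  have "b * measure \<mu> N \<le> measure (projection N z u) A'"
    unfolding mP[OF borA(1)] N(4)[symmetric] using BN Nb pre[OF borA(1)] by (intro measure_mono) auto
  then have b': "b \<le> b'" using N(3) by (simp add: b'_def le_divide_eq)
  have "\<phi> * measure \<mu> N \<le> measure (projection N z u) (D' \<epsilon>)"
  proof -
    have "measure \<mu> (F \<inter> N) \<le> measure (projection N z u) (D' \<epsilon>)"
      unfolding mP[OF borA(2)] using FN Nb pre[OF borA(2)] by (intro measure_mono) auto
    then show ?thesis using N(5) by simp
  qed
  also have "\<dots> \<le> (1 - pmean s a' b' 1) * measure (projection N z u) UNIV"
  proof (rule P.dilation_on_line[where X = "D' (2 * \<epsilon>)" and \<epsilon> = \<epsilon> and B = A'])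
    show "{y - \<epsilon>..y + \<epsilon>} \<subseteq> D' (2 * \<epsilon>)" if y: "y \<in> D' \<epsilon>" for y
    proof
      fix t assume "t \<in> {y - \<epsilon>..y + \<epsilon>}"
      then have "dist t y \<le> \<epsilon>" by (auto simp: dist_real_def)
      then show "t \<in> D' (2 * \<epsilon>)"
        using infdist_triangle[of t D y] y by (simp add: D'_def)
    qed
    show "measure lborel (D' (2 * \<epsilon>) \<inter> {min x y..max x y}) \<le> a' * \<bar>x - y\<bar>" if "x \<in> A'" for x y
      using sparse'[of x y] that by (simp add: A'_def D'_def)
    show "measure (projection N z u) A' = b' * measure (projection N z u) UNIV"
      using N(3) by (simp add: P_UNIV b'_def)
    show "0 < b'" using b b' by simp
  qed (use a a' cA' borA R \<epsilon> AD N(3) P_UNIV in auto)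
  finally have "\<phi> \<le> 1 - pmean s a' b' 1" using N(3) by (simp add: P_UNIV)
  moreover have "pmean s a' b 1 \<le> pmean s a' b' 1" using pm.pmean_mono[of b b' 1 1] b b' by simp
  ultimately show False using a'(3) by linarith
qed

section \<open>From compact sets to Borel sets\<close>

lemma compact_approximation:
  assumes "X \<in> sets borel" "0 < e"
  obtains C where "C \<subseteq> X" "compact C" "measure \<mu> X < measure \<mu> C + e"
proof (cases "measure \<mu> X < e")
  case True
  then show thesis using that[of "{}"] by simp
next
  case False
  have "emeasure \<mu> X = (SUP K \<in> {K. K \<subseteq> X \<and> compact K}. emeasure \<mu> K)"
    by (rule inner_regular) (use assms in auto)
  moreover have "ennreal (measure \<mu> X - e) < emeasure \<mu> X"
    unfolding emeasure_eq_measure using False assms by (intro ennreal_lessI) auto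
  ultimately obtain C where "C \<subseteq> X" "compact C" "ennreal (measure \<mu> X - e) < emeasure \<mu> C"
    by (auto simp: less_SUP_iff)
  then show thesis using that[of C] False by (simp add: emeasure_eq_measure ennreal_less_iff)
qed

text \<open>Sparsity passes to subsets, so \<open>F\<close> and \<open>B\<close> may be approximated
  by compact sets from inside, while large balls play the part of the convex body. The bound is
  affine in the measure of \<open>F\<close>, so an additive error suffices there; for
  \<open>B\<close> the limit uses continuity of the mean at a positive argument.\<close>

theorem dilation:
  assumes prob: "measure \<mu> UNIV = 1" and B: "B \<in> sets borel" and F: "F \<in> sets borel" and "B \<inter> F = {}"
    and a: "0 \<le> a" "a < 1" and sp: "sparse_from a B F" and pos: "0 < measure \<mu> B"
  shows "pmean s a (measure \<mu> B) 1 \<le> 1 - measure \<mu> F"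
proof -
  interpret pm: neg_power_mean s a using s_neg a by unfold_locales auto
  have tends: "(\<lambda>n. pmean s a (X n) 1) \<longlonglongrightarrow> pmean s a x 1" if "X \<longlonglongrightarrow> x" "0 < x" for X :: "nat \<Rightarrow> real" and x
    unfolding pmean_def using pm.base_pos[of x 1] that by (intro tendsto_intros) auto
  have compact_case: "pmean s a (measure \<mu> B') 1 \<le> 1 - measure \<mu> F'"
    if c: "compact B'" "compact F'" "B' \<subseteq> B" "F' \<subseteq> F" "0 < measure \<mu> B'" for B' F'
  proof -
    define K where "K n = cball (0 :: 'a) (real n)" for n
    have Klim: "(\<lambda>n. measure \<mu> (K n)) \<longlonglongrightarrow> 1"
    proof -
      have "(\<lambda>n. measure \<mu> (K n)) \<longlonglongrightarrow> measure \<mu> (\<Union>n. K n)"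
        by (rule finite_Lim_measure_incseq) (auto simp: K_def incseq_def borel_closed)
      moreover have "(\<Union>n. K n) = UNIV" using real_arch_simple by (auto simp: K_def)
      ultimately show ?thesis using prob by simp
    qed
    have "bounded (B' \<union> F')" using c by (simp add: compact_imp_bounded)
    then obtain r where r: "\<forall>x\<in>B' \<union> F'. norm x \<le> r" by (auto simp: bounded_iff)
    have "\<forall>\<^sub>F n in sequentially. r \<le> real n"
      using eventually_ge_at_top[of "nat \<lceil>r\<rceil>"] by eventually_elim linarith
    moreover have "\<forall>\<^sub>F n in sequentially. 0 < measure \<mu> (K n)"
      using order_tendstoD(1)[OF Klim, of 0] by simp
    ultimately have ev: "\<forall>\<^sub>F n in sequentially.
      pmean s a (measure \<mu> B' / measure \<mu> (K n)) 1 \<le> 1 - measure \<mu> F' / measure \<mu> (K n)"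
    proof eventually_elim
      case (elim n)
      have sub: "B' \<inter> K n = B'" "F' \<inter> K n = F'" using r elim by (force simp: K_def)+
      have "sparse_from a B' F'"
        using sparse_from_subset[OF sp c(3,4) F] c by (simp add: borel_compact)
      then show ?case
        using dilation_compact[of "K n" B' F' a] c elim a \<open>B \<inter> F = {}\<close> sub by (auto simp: K_def)
    qed
    have "(\<lambda>n. pmean s a (measure \<mu> B' / measure \<mu> (K n)) 1) \<longlonglongrightarrow> pmean s a (measure \<mu> B' / 1) 1"
      using c by (intro tends tendsto_intros Klim) auto
    moreover have "(\<lambda>n. 1 - measure \<mu> F' / measure \<mu> (K n)) \<longlonglongrightarrow> 1 - measure \<mu> F' / 1"
      by (intro tendsto_intros Klim) auto
    ultimately have "pmean s a (measure \<mu> B' / 1) 1 \<le> 1 - measure \<mu> F' / 1"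
      using ev by (intro tendsto_le[OF sequentially_bot]) auto
    then show ?thesis by simp
  qed
  have F_case: "pmean s a (measure \<mu> B') 1 \<le> 1 - measure \<mu> F"
    if c: "compact B'" "B' \<subseteq> B" "0 < measure \<mu> B'" for B'
  proof (rule field_le_epsilon)
    fix e :: real assume "0 < e"
    from compact_approximation[OF F this] obtain F' where "F' \<subseteq> F" "compact F'" "measure \<mu> F < measure \<mu> F' + e" .
    then show "pmean s a (measure \<mu> B') 1 \<le> 1 - measure \<mu> F + e"
      using compact_case[of B' F'] c by force
  qed
  have "\<forall>n. \<exists>C. C \<subseteq> B \<and> compact C \<and> measure \<mu> B < measure \<mu> C + inverse (real (Suc n))"
  proof
    fix n
    have "0 < inverse (real (Suc n))" by simp
    from compact_approximation[OF B this]
    show "\<exists>C. C \<subseteq> B \<and> compact C \<and> measure \<mu> B < measure \<mu> C + inverse (real (Suc n))" by metis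
  qed
  then obtain C where C: "\<And>n. C n \<subseteq> B" "\<And>n. compact (C n)"
    "\<And>n. measure \<mu> B < measure \<mu> (C n) + inverse (real (Suc n))" by metis
  have lim: "(\<lambda>n. measure \<mu> (C n)) \<longlonglongrightarrow> measure \<mu> B"
  proof (rule tendsto_sandwich)
    show "\<forall>\<^sub>F n in sequentially. measure \<mu> B - inverse (real (Suc n)) \<le> measure \<mu> (C n)"
      using C(3) by (intro always_eventually allI) (smt (verit))
    show "\<forall>\<^sub>F n in sequentially. measure \<mu> (C n) \<le> measure \<mu> B"
      using C(1) B by (intro always_eventually allI measure_mono) auto
    show "(\<lambda>n. measure \<mu> B - inverse (real (Suc n))) \<longlonglongrightarrow> measure \<mu> B"
      using tendsto_diff[OF tendsto_const LIMSEQ_inverse_real_of_nat, of "measure \<mu> B"] by simp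
  qed auto
  have "\<forall>\<^sub>F n in sequentially. 0 < measure \<mu> (C n)" using order_tendstoD(1)[OF lim pos] .
  then have "\<forall>\<^sub>F n in sequentially. pmean s a (measure \<mu> (C n)) 1 \<le> 1 - measure \<mu> F"
    by eventually_elim (use F_case C in auto)
  then show ?thesis
    by (rule tendsto_upperbound[OF tends[OF lim pos] _ sequentially_bot])
qed

end

subsection \<open>Functions of bounded Chebyshev degree\<close>

lemma line_measure_segment:
  assumes "norm u = 1" "0 \<le> \<rho>"
  shows "line_measure x u ((\<lambda>t. x + t *\<^sub>R u) ` {0..\<rho>}) = \<rho>"
proof -
  have "u \<noteq> 0" using assms by auto
  then have "{t. x + t *\<^sub>R u \<in> (\<lambda>t. x + t *\<^sub>R u) ` {0..\<rho>}} = {0..\<rho>}" by auto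
  then show ?thesis using assms by (simp add: line_measure_def)
qed

text \<open>The definition for a closed segment \<open>I\<close> and
  \<open>J = I \<inter> F\<close>. The bound \<open>c\<close> on \<open>F\<close> stands in for the
  supremum over \<open>J\<close>, which leaves an inequality between real numbers.\<close>

lemma chebyshev_pointwise:
  assumes cb: "chebyshev_bound f A d" and u: "norm u = 1" and t: "0 \<le> t" "t \<le> \<rho>"
    and F: "F \<in> sets borel" "\<And>y. y \<in> F \<Longrightarrow> \<bar>f y\<bar> \<le> c" and "0 \<le> c"
    and pos: "0 < measure lborel {\<tau> \<in> {0..\<rho>}. x + \<tau> *\<^sub>R u \<in> F}" (is "0 < ?m")
  shows "\<bar>f (x + t *\<^sub>R u)\<bar> \<le> (A * \<rho> / ?m) powr d * c"
proof -
  define I where "I = (\<lambda>t. x + t *\<^sub>R u) ` {0..\<rho>}"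
  have "u \<noteq> 0" using u by auto
  then have J: "line_measure x u (I \<inter> F) = ?m"
    unfolding line_measure_def I_def by (intro arg_cong[where f = "measure lborel"]) auto
  have I: "compact I" "convex I"
  proof -
    show "compact I" unfolding I_def by (intro compact_continuous_image continuous_intros) auto
    have "I = (+) x ` ((\<lambda>t. t *\<^sub>R u) ` {0..\<rho>})" by (auto simp: I_def image_image)
    moreover have "linear (\<lambda>t. t *\<^sub>R u)" by (rule linearI) (auto simp: algebra_simps)
    ultimately show "convex I" by (simp add: convex_linear_image convex_translation)
  qed
  have "I \<subseteq> range (\<lambda>t. x + t *\<^sub>R u)" "bounded I" "I \<inter> F \<in> sets borel" "I \<inter> F \<subseteq> I"
    using I F by (auto simp: I_def compact_imp_bounded borel_compact)
  with cb u I(2) pos have le: "(SUP y\<in>I. ennreal \<bar>f y\<bar>)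
      \<le> ennreal ((A * line_measure x u I / ?m) powr d) * (SUP y\<in>I \<inter> F. ennreal \<bar>f y\<bar>)"
    unfolding chebyshev_bound_def J[symmetric] by blast
  have "ennreal \<bar>f (x + t *\<^sub>R u)\<bar> \<le> (SUP y\<in>I. ennreal \<bar>f y\<bar>)"
    using t by (intro SUP_upper) (auto simp: I_def)
  also note le
  also have "(SUP y\<in>I \<inter> F. ennreal \<bar>f y\<bar>) \<le> ennreal c"
    using F(2) by (intro SUP_least) (auto intro: ennreal_leI)
  also have "line_measure x u I = \<rho>" unfolding I_def using t by (intro line_measure_segment u) auto
  finally have "ennreal \<bar>f (x + t *\<^sub>R u)\<bar> \<le> ennreal ((A * \<rho> / ?m) powr d * c)"
    using \<open>0 \<le> c\<close> by (simp add: ennreal_mult mult_left_mono)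
  then show ?thesis using \<open>0 \<le> c\<close> by (simp add: ennreal_le_iff)
qed

text \<open>With \<open>J = I\<close> the inequality reads \<open>m \<le> A powr d * m\<close>,
  which forces \<open>1 \<le> A\<close> once the supremum \<open>m\<close> is positive and finite.
  Finiteness is itself a Chebyshev inequality, applied to a sublevel set of positive length in the
  segment.\<close>

lemma chebyshev_const_ge_1:
  fixes f :: "'a::euclidean_space \<Rightarrow> real"
  assumes cb: "chebyshev_bound f A d" and f: "f \<in> borel_measurable borel" and "f x \<noteq> 0"
  shows "1 \<le> A"
proof (rule ccontr)
  assume "\<not> 1 \<le> A"
  have A: "0 < A" "0 < d" using cb by (auto simp: chebyshev_bound_def)
  obtain u :: 'a where u: "norm u = 1" using nonempty_Basis norm_Basis by blast
  define F where "F n = {y. \<bar>f y\<bar> \<le> real n}" for n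
  have F: "F n \<in> sets borel" for n
    using f unfolding F_def by measurable
  define S where "S n = {\<tau> \<in> {0..1}. x + \<tau> *\<^sub>R u \<in> F n}" for n
  have Sf: "S n \<in> fmeasurable lborel" for n unfolding S_def by (rule ray_section_fmeasurable[OF F])
  have "(\<lambda>n. measure lborel (S n)) \<longlonglongrightarrow> measure lborel (\<Union>n. S n)"
  proof (rule Lim_measure_incseq)
    show "range S \<subseteq> sets lborel" using fmeasurableD[OF Sf] by auto
    show "incseq S" by (auto simp: incseq_def S_def F_def)
    have U: "(\<Union>n. S n) = {0..1}" using real_arch_simple by (auto simp: S_def F_def)
    show "emeasure lborel (\<Union>n. S n) \<noteq> \<infinity>" unfolding U by simp
  qed
  also have "(\<Union>n. S n) = {0..1}" using real_arch_simple by (auto simp: S_def F_def)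
  finally have "\<forall>\<^sub>F n in sequentially. 0 < measure lborel (S n)" by (rule order_tendstoD) simp
  then obtain n where n: "0 < measure lborel (S n)" using eventually_sequentially by auto
  define C where "C = (A * 1 / measure lborel (S n)) powr d * real n"
  have C: "\<bar>f (x + t *\<^sub>R u)\<bar> \<le> C" if "0 \<le> t" "t \<le> 1" for t
    using chebyshev_pointwise[OF cb u that F[of n], of "real n" x] n by (simp add: C_def S_def F_def)
  define g where "g t = \<bar>f (x + t *\<^sub>R u)\<bar>" for t
  define m where "m = (SUP t\<in>{0..1}. g t)"
  have bdd: "bdd_above (g ` {0..1})" using C by (intro bdd_aboveI2[of _ _ C]) (simp add: g_def)
  have m: "g t \<le> m" if "t \<in> {0..1}" for t unfolding m_def by (rule cSUP_upper[OF that bdd])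
  have m0: "0 < m" using m[of 0] \<open>f x \<noteq> 0\<close> unfolding g_def by force
  have "g t \<le> A powr d * m" if t: "t \<in> {0..1}" for t
  proof -
    define G where "G = {y. \<bar>f y\<bar> \<le> m}"
    have G: "G \<in> sets borel" using f unfolding G_def by measurable
    have seg: "{\<tau> \<in> {0..1}. x + \<tau> *\<^sub>R u \<in> G} = {0..1}" using m by (auto simp: G_def g_def)
    have "\<bar>f (x + t *\<^sub>R u)\<bar> \<le> (A * 1 / measure lborel {\<tau> \<in> {0..1}. x + \<tau> *\<^sub>R u \<in> G}) powr d * m"
    proof (rule chebyshev_pointwise[OF cb u _ _ G])
      show "\<bar>f y\<bar> \<le> m" if "y \<in> G" for y using that by (simp add: G_def)
      show "0 < measure lborel {\<tau> \<in> {0..1}. x + \<tau> *\<^sub>R u \<in> G}" unfolding seg by simp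
    qed (use t m0 in auto)
    then show ?thesis unfolding seg g_def by simp
  qed
  then have "(SUP t\<in>{0..1}. g t) \<le> A powr d * m" by (intro cSUP_least) simp_all
  then have "m \<le> A powr d * m" by (simp only: m_def[symmetric])
  then have "1 \<le> A powr d" using m0 by simp
  moreover have "A powr d < 1 powr d" using A \<open>\<not> 1 \<le> A\<close> by (intro powr_less_mono2) auto
  ultimately show False by simp
qed

text \<open>If the sublevel set has length \<open>m > 0\<close> on a segment of length
  \<open>\<rho>\<close> from \<open>x\<close>, the inequality to the power \<open>1 / d\<close>
  gives \<open>A * M * t \<le> A * \<rho> / m * M\<close>. The factor \<open>A * M\<close> cancels,
  which is why the level in \<open>?B\<close> contains it.\<close>

lemma sparse_from_sublevel:
  fixes f :: "'a::euclidean_space \<Rightarrow> real"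
  assumes cb: "chebyshev_bound f A d" and f: "f \<in> borel_measurable borel" and M: "0 < M" and t: "0 < t"
  shows "sparse_from (1 / t) {x. A * M * t \<le> \<bar>f x\<bar> powr (1 / d)} {x. \<bar>f x\<bar> powr (1 / d) \<le> M}"
    (is "sparse_from _ ?B ?F")
proof (unfold sparse_from_def, intro ballI allI impI)
  fix x u :: 'a and \<rho> :: real assume x: "x \<in> ?B" and u: "norm u = 1" and \<rho>: "0 \<le> \<rho>"
  have A: "0 < A" "0 < d" using cb by (auto simp: chebyshev_bound_def)
  define m where "m = measure lborel {\<tau> \<in> {0..\<rho>}. x + \<tau> *\<^sub>R u \<in> ?F}"
  have F: "?F \<in> sets borel" using f by measurable
  have "m \<le> 1 / t * \<rho>"
  proof (cases "m = 0")
    case True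
    then show ?thesis using \<rho> t by simp
  next
    case False
    then have m: "0 < m" by (simp add: m_def zero_less_measure_iff)
    have "\<bar>f y\<bar> \<le> M powr d" if "y \<in> ?F" for y
    proof -
      have "(\<bar>f y\<bar> powr (1 / d)) powr d \<le> M powr d" using that A by (intro powr_mono2) auto
      then show ?thesis using A by (simp add: powr_powr)
    qed
    then have "\<bar>f x\<bar> \<le> (A * \<rho> / m) powr d * M powr d"
      using chebyshev_pointwise[OF cb u, of 0 \<rho> ?F "M powr d" x] \<rho> F m by (simp add: m_def)
    also have "\<dots> = (A * \<rho> / m * M) powr d" using A \<rho> m M by (intro powr_mult[symmetric])
    finally have "\<bar>f x\<bar> powr (1 / d) \<le> ((A * \<rho> / m * M) powr d) powr (1 / d)"
      using A by (intro powr_mono2) auto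
    also have "\<dots> = A * \<rho> / m * M" using A \<rho> m M by (simp add: powr_powr)
    finally have "A * M * t \<le> A * \<rho> / m * M" using x by simp
    then have "t * m \<le> \<rho>" using A M m by (simp add: field_simps)
    then show ?thesis using t by (simp add: field_simps)
  qed
  then show "measure lborel {\<tau> \<in> {0..\<rho>}. x + \<tau> *\<^sub>R u \<in> ?F} \<le> 1 / t * \<rho>" by (simp add: m_def)
qed

text \<open>A segment from \<open>x\<close> with zeros of positive length would have supremum 0 by
  the Chebyshev inequality. This takes the place of the previous lemma when the median is 0.\<close>

lemma sparse_from_zeros:
  fixes f :: "'a::euclidean_space \<Rightarrow> real"
  assumes cb: "chebyshev_bound f A d" and f: "f \<in> borel_measurable borel"
  shows "sparse_from 0 {x. f x \<noteq> 0} {x. f x = 0}"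
proof (unfold sparse_from_def, intro ballI allI impI)
  fix x u :: 'a and \<rho> :: real assume x: "x \<in> {x. f x \<noteq> 0}" and u: "norm u = 1" and \<rho>: "0 \<le> \<rho>"
  have F: "{x. f x = 0} \<in> sets borel" using f by measurable
  show "measure lborel {\<tau> \<in> {0..\<rho>}. x + \<tau> *\<^sub>R u \<in> {x. f x = 0}} \<le> 0 * \<rho>"
  proof (rule ccontr)
    assume "\<not> ?thesis"
    then show False
      using chebyshev_pointwise[OF cb u, of 0 \<rho> "{x. f x = 0}" 0 x] \<rho> F x by simp
  qed
qed

text \<open>Layers below level 1 contribute at most 1. Those above contribute at most
  \<open>p * D\<close> times the integral of \<open>t powr (p + r - 1)\<close> over
  \<open>{1..}\<close>, which converges because \<open>p + r < 0\<close> and equals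
  \<open>- 1 / (p + r)\<close>.\<close>

lemma nn_integral_powr_le_of_tail:
  fixes h :: "'a \<Rightarrow> real"
  assumes "prob_space M" and h: "h \<in> borel_measurable M" "\<And>x. 0 \<le> h x"
    and p: "0 < p" "p + r < 0" and "0 \<le> D"
    and tail: "\<And>t. 1 < t \<Longrightarrow> measure M {x \<in> space M. t \<le> h x} \<le> D * t powr r"
  shows "(\<integral>\<^sup>+x. ennreal (h x powr p) \<partial>M) \<le> ennreal (1 - D * (p / (p + r)))"
proof -
  interpret prob_space M by fact
  interpret P: pair_sigma_finite lborel M by unfold_locales
  define k where "k t x = ennreal (p * t powr (p - 1)) * indicator {1..h x} t" for t x
  have k_eq: "k t x = ennreal (p * t powr (p - 1)) * indicator {1..} t * indicator {x \<in> space M. t \<le> h x} x"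
    if "x \<in> space M" for t x
    using that by (auto simp: k_def indicator_def)
  have "(\<lambda>(t, x). k t x) = (\<lambda>q. ennreal (p * fst q powr (p - 1)) * indicator {q. 1 \<le> fst q \<and> fst q \<le> h (snd q)} q)"
    by (auto simp: k_def fun_eq_iff indicator_def)
  also have "\<dots> \<in> borel_measurable (lborel \<Otimes>\<^sub>M M)"
  proof -
    have [measurable]: "(\<lambda>q. h (snd q)) \<in> borel_measurable (lborel \<Otimes>\<^sub>M M)"
      using h(1) by measurable
    have [measurable]: "Measurable.pred (lborel \<Otimes>\<^sub>M M) (\<lambda>q. 1 \<le> fst q \<and> fst q \<le> h (snd q))"
      by measurable
    have "(\<lambda>q. indicator {q. 1 \<le> fst q \<and> fst q \<le> h (snd q)} q :: ennreal) \<in> borel_measurable (lborel \<Otimes>\<^sub>M M)"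
      unfolding indicator_def by measurable
    then show ?thesis by measurable
  qed
  finally have km: "(\<lambda>(t, x). k t x) \<in> borel_measurable (lborel \<Otimes>\<^sub>M M)" .
  have inner: "(\<integral>\<^sup>+t. k t x \<partial>lborel) = ennreal (h x powr p - 1)" if "1 \<le> h x" for x
  proof -
    have "(\<integral>\<^sup>+t. ennreal (p * t powr (p - 1)) * indicator {1..h x} t \<partial>lborel) = ennreal (h x powr p - 1 powr p)"
    proof (rule nn_integral_FTC_Icc)
      show "((\<lambda>t. t powr p) has_real_derivative p * t powr (p - 1)) (at t)" if "t \<in> {1..h x}" for t
        using that by (auto intro!: derivative_eq_intros)
    qed (use that p in auto)
    then show ?thesis by (simp add: k_def)
  qed
  have "(\<integral>\<^sup>+x. ennreal (h x powr p) \<partial>M) \<le> (\<integral>\<^sup>+x. 1 + (\<integral>\<^sup>+t. k t x \<partial>lborel) \<partial>M)"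
  proof (rule nn_integral_mono)
    fix x
    show "ennreal (h x powr p) \<le> 1 + (\<integral>\<^sup>+t. k t x \<partial>lborel)"
    proof (cases "1 \<le> h x")
      case True
      have "ennreal (h x powr p) = ennreal (1 + (h x powr p - 1))" by simp
      also have "\<dots> = 1 + ennreal (h x powr p - 1)"
        using True p by (subst ennreal_plus) (auto simp: ge_one_powr_ge_zero)
      finally show ?thesis using inner[OF True] by simp
    next
      case False
      then have "h x powr p \<le> 1 powr p" using h(2)[of x] p by (intro powr_mono2) auto
      then have "ennreal (h x powr p) \<le> 1" using ennreal_leI[of "h x powr p" 1] by simp
      then show ?thesis by (rule order_trans) simp
    qed
  qed
  also have "\<dots> = 1 + (\<integral>\<^sup>+x. (\<integral>\<^sup>+t. k t x \<partial>lborel) \<partial>M)"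
  proof -
    have "(\<lambda>x. \<integral>\<^sup>+t. k t x \<partial>lborel) \<in> borel_measurable M"
      using lborel.borel_measurable_nn_integral[of "\<lambda>x t. k t x" M] measurable_pair_swap[OF km] by simp
    then show ?thesis by (subst nn_integral_add) (auto simp: emeasure_space_1)
  qed
  also have "(\<integral>\<^sup>+x. (\<integral>\<^sup>+t. k t x \<partial>lborel) \<partial>M) = (\<integral>\<^sup>+t. (\<integral>\<^sup>+x. k t x \<partial>M) \<partial>lborel)"
    by (rule P.Fubini'[OF km])
  also have "\<dots> \<le> (\<integral>\<^sup>+t. ennreal (p * D * t powr (p + r - 1)) * indicator {1..} t \<partial>lborel)"
  proof (rule nn_integral_mono_AE)
    \<comment> \<open>The layers start at 1 while the tail bound is given for \<open>t > 1\<close>;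
      the endpoint is a null set.\<close>
    have "AE t in lborel. t \<noteq> (1 :: real)" by (rule AE_lborel_singleton)
    then show "AE t in lborel. (\<integral>\<^sup>+x. k t x \<partial>M) \<le> ennreal (p * D * t powr (p + r - 1)) * indicator {1..} t"
    proof eventually_elim
      case (elim t)
      have "{x \<in> space M. t \<le> h x} \<in> sets M" using h(1) by measurable
      then have "(\<integral>\<^sup>+x. k t x \<partial>M) = ennreal (p * t powr (p - 1)) * indicator {1..} t * emeasure M {x \<in> space M. t \<le> h x}"
        by (simp add: k_eq nn_integral_cmult cong: nn_integral_cong)
      also have "\<dots> \<le> ennreal (p * D * t powr (p + r - 1)) * indicator {1..} t"
      proof (cases "1 < t")
        case True
        have "p * t powr (p - 1) * measure M {x \<in> space M. t \<le> h x} \<le> p * t powr (p - 1) * (D * t powr r)"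
          using tail[OF True] p by (intro mult_left_mono) auto
        also have "\<dots> = p * D * t powr (p + r - 1)"
          by (simp add: powr_add powr_diff)
        finally have "ennreal (p * t powr (p - 1) * measure M {x \<in> space M. t \<le> h x}) \<le> ennreal (p * D * t powr (p + r - 1))"
          by (rule ennreal_leI)
        then show ?thesis using True p by (simp add: emeasure_eq_measure ennreal_mult)
      qed (use elim in auto)
      finally show ?case .
    qed
  qed
  also have "\<dots> = ennreal (0 - p * D / (p + r) * 1 powr (p + r))"
  proof (rule nn_integral_FTC_atLeast)
    show "((\<lambda>t. p * D / (p + r) * t powr (p + r)) has_real_derivative p * D * t powr (p + r - 1)) (at t)"
      if "1 \<le> t" for t
      using that p by (auto intro!: derivative_eq_intros)
    have "((\<lambda>t. t powr (p + r)) \<longlongrightarrow> 0) at_top"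
      using p by (intro tendsto_neg_powr filterlim_ident) auto
    then have "((\<lambda>t. p * D / (p + r) * t powr (p + r)) \<longlongrightarrow> p * D / (p + r) * 0) at_top"
      by (intro tendsto_mult tendsto_const)
    then show "((\<lambda>t. p * D / (p + r) * t powr (p + r)) \<longlongrightarrow> 0) at_top" by simp
  qed (use p \<open>0 \<le> D\<close> in auto)
  also have "1 + ennreal (0 - p * D / (p + r) * 1 powr (p + r)) = ennreal (1 - D * (p / (p + r)))"
  proof -
    have "p * D / (p + r) \<le> 0" using p \<open>0 \<le> D\<close> by (intro divide_nonneg_neg) auto
    then have "ennreal (1 + (0 - p * D / (p + r))) = 1 + ennreal (0 - p * D / (p + r))"
      by (subst ennreal_plus) auto
    then show ?thesis by (simp add: mult.commute)
  qed
  finally show ?thesis by (simp add: add_left_mono)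
qed

text \<open>For \<open>M\<^sub>f = 0\<close> the set in the tail bound is the whole space, whereas
  the right-hand side is \<open>(t * (2 powr (- s) - 1) + 1) powr (1 / s) < 1\<close>; hence the
  condition \<open>M\<^sub>f \<noteq> 0\<close>. A point mass at a zero of \<open>f\<close> has such
  a median.\<close>

theorem corollary11:
  fixes f :: "real ^ 'n \<Rightarrow> real" and \<mu> :: "(real ^ 'n) measure"
    and s d\<^sub>f A\<^sub>f M\<^sub>f :: real
  assumes "f \<in> borel_measurable borel"
    and "is_chebyshev_degree f d\<^sub>f"
    and "is_chebyshev_const f d\<^sub>f A\<^sub>f"
    and "s < 0"
    and "prob_space \<mu>" and "sets \<mu> = sets borel" and "s_concave s \<mu>"
    and "is_median \<mu> (\<lambda>x. \<bar>f x\<bar> powr (1 / d\<^sub>f)) M\<^sub>f"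
  shows "(\<forall>t>1.
           (M\<^sub>f \<noteq> 0 \<longrightarrow>
             measure \<mu> {x. A\<^sub>f * M\<^sub>f * t \<le> \<bar>f x\<bar> powr (1 / d\<^sub>f)}
               \<le> t powr (1 / s) * (2 powr (- s) - 1 + 1 / t) powr (1 / s)) \<and>
           t powr (1 / s) * (2 powr (- s) - 1 + 1 / t) powr (1 / s) \<le> d_const s * t powr (1 / s))
       \<and> (\<forall>p. 0 < p \<and> p < - (1 / s) \<longrightarrow>
           integrable \<mu> (\<lambda>x. \<bar>\<bar>f x\<bar> powr (1 / d\<^sub>f)\<bar> powr p) \<and>
           Lp_norm \<mu> p (\<lambda>x. \<bar>f x\<bar> powr (1 / d\<^sub>f))
             \<le> A\<^sub>f * M\<^sub>f * (1 - d_const s * (p / (p + 1 / s))) powr (1 / p))"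
proof -
  interpret prob_space \<mu> by fact
  interpret s_concave_measure \<mu> s using assms by unfold_locales auto
  note f = assms(1)
  define g where "g x = \<bar>f x\<bar> powr (1 / d\<^sub>f)" for x
  have g_meas: "g \<in> borel_measurable borel" using f unfolding g_def by measurable
  have g_nonneg: "0 \<le> g x" for x by (simp add: g_def)
  have cb: "chebyshev_bound f A\<^sub>f d\<^sub>f" using assms(3) by (simp add: is_chebyshev_const_def)
  then have A: "0 < A\<^sub>f" "0 < d\<^sub>f" by (auto simp: chebyshev_bound_def)
  have UNIV_1: "measure \<mu> UNIV = 1" using prob_space by simp
  have med: "1 / 2 \<le> measure \<mu> {x. M\<^sub>f \<le> g x}" "1 / 2 \<le> measure \<mu> {x. g x \<le> M\<^sub>f}"
    using assms(8) by (auto simp: is_median_def g_def)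
  have M_nonneg: "0 \<le> M\<^sub>f"
  proof (rule ccontr)
    assume "\<not> 0 \<le> M\<^sub>f"
    then have "{x. g x \<le> M\<^sub>f} = {}" using g_nonneg by (auto simp: not_le intro: less_le_trans)
    then show False using med(2) by simp
  qed
  have q_pos: "0 < 2 powr (- s) - 1" using powr_less_mono[of 0 "- s" 2] s_neg by simp
  have tail: "measure \<mu> {x. A\<^sub>f * M\<^sub>f * t \<le> g x} \<le> t powr (1 / s) * (2 powr (- s) - 1 + 1 / t) powr (1 / s)"
    if t: "1 < t" and M: "0 < M\<^sub>f" for t
  proof (cases "measure \<mu> {x. A\<^sub>f * M\<^sub>f * t \<le> g x} = 0")
    case False
    define B F where "B = {x. A\<^sub>f * M\<^sub>f * t \<le> g x}" and "F = {x. g x \<le> M\<^sub>f}"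
    have BF: "B \<in> sets borel" "F \<in> sets borel" unfolding B_def F_def using g_meas by measurable
    have B: "0 < measure \<mu> B" using False by (simp add: B_def zero_less_measure_iff)
    then obtain x where "x \<in> B" by (metis equals0I less_irrefl measure_empty)
    moreover have "0 < A\<^sub>f * M\<^sub>f * t" using A M t by simp
    ultimately have "g x \<noteq> 0" unfolding B_def by auto
    then have "f x \<noteq> 0" by (auto simp: g_def)
    \<comment> \<open>Together with \<open>t > 1\<close> this separates the levels
      \<open>M\<^sub>f\<close> and \<open>A\<^sub>f * M\<^sub>f * t\<close>, so that
      \<open>B\<close> and \<open>F\<close> are disjoint.\<close>
    then have A1: "1 \<le> A\<^sub>f" using chebyshev_const_ge_1[OF cb f] by blast
    have "M\<^sub>f * 1 < M\<^sub>f * t" "M\<^sub>f * t * 1 \<le> M\<^sub>f * t * A\<^sub>f"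
      using M t A1 by (intro mult_strict_left_mono mult_left_mono; simp)+
    then have "M\<^sub>f < A\<^sub>f * M\<^sub>f * t" by (simp add: mult_ac)
    then have disj: "B \<inter> F = {}" by (auto simp: B_def F_def)
    interpret pm: neg_power_mean s "1 / t" using s_neg t by unfold_locales auto
    have "pmean s (1 / t) (measure \<mu> B) 1 \<le> 1 - measure \<mu> F"
      using sparse_from_sublevel[OF cb f M, of t] t
      by (intro dilation UNIV_1 BF disj B) (auto simp: B_def F_def g_def)
    also have "\<dots> \<le> 1 / 2" using med(2) by (simp add: F_def)
    finally have "(1 / 2) powr s \<le> 1 / t * measure \<mu> B powr s + (1 - 1 / t) * 1 powr s"
      using pm.pmean_le_iff[of "measure \<mu> B" 1 "1 / 2"] B by simp
    moreover have "(1 / 2) powr s = 2 powr (- s)" by (simp add: powr_divide powr_minus_divide)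
    ultimately have "2 powr (- s) - 1 + 1 / t \<le> measure \<mu> B powr s / t" by simp
    then have le: "t * (2 powr (- s) - 1 + 1 / t) \<le> measure \<mu> B powr s"
      using t by (simp add: le_divide_eq mult.commute)
    have pos: "0 < t * (2 powr (- s) - 1 + 1 / t)" using t q_pos by (intro mult_pos_pos add_pos_pos) auto
    have "measure \<mu> B = (measure \<mu> B powr s) powr (1 / s)" using B s_neg by (simp add: powr_powr)
    also have "\<dots> \<le> (t * (2 powr (- s) - 1 + 1 / t)) powr (1 / s)"
      using le pos s_neg by (intro powr_mono2') auto
    also have "\<dots> = t powr (1 / s) * (2 powr (- s) - 1 + 1 / t) powr (1 / s)"
      using t q_pos by (simp only: powr_mult)
    finally show ?thesis by (simp add: B_def)
  qed simp
  have d_bound: "t powr (1 / s) * (2 powr (- s) - 1 + 1 / t) powr (1 / s) \<le> d_const s * t powr (1 / s)"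
    if "1 < t" for t
  proof -
    have "(2 powr (- s) - 1 + 1 / t) powr (1 / s) \<le> d_const s"
      unfolding d_const_def using q_pos that s_neg by (intro powr_mono2') auto
    then show ?thesis by (subst mult.commute) (rule mult_right_mono, auto)
  qed
  have Lp: "integrable \<mu> (\<lambda>x. g x powr p) \<and>
      (\<integral>x. g x powr p \<partial>\<mu>) powr (1 / p) \<le> A\<^sub>f * M\<^sub>f * (1 - d_const s * (p / (p + 1 / s))) powr (1 / p)"
    if p: "0 < p" "p < - (1 / s)" for p
  proof (cases "M\<^sub>f = 0")
    case True
    \<comment> \<open>For \<open>a = 0\<close> the mean is its second argument 1, so the dilation
      inequality would make \<open>{x. f x = 0}\<close> null, against the median. Hence
      \<open>f\<close> vanishes almost everywhere and both sides of the moment bound are 0.\<close>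
    have "measure \<mu> {x. f x \<noteq> 0} = 0"
    proof (rule ccontr)
      assume "measure \<mu> {x. f x \<noteq> 0} \<noteq> 0"
      then have "0 < measure \<mu> {x. f x \<noteq> 0}" by (simp add: zero_less_measure_iff)
      then have "pmean s 0 (measure \<mu> {x. f x \<noteq> 0}) 1 \<le> 1 - measure \<mu> {x. f x = 0}"
        using f by (intro dilation UNIV_1 sparse_from_zeros[OF cb f]) auto
      moreover have "{x. g x \<le> M\<^sub>f} = {x. f x = 0}" using True by (auto simp: g_def)
      ultimately show False using med(2) by (simp add: pmean_def)
    qed
    moreover have "{x. f x \<noteq> 0} \<in> sets \<mu>" using f by simp
    ultimately have "{x. f x \<noteq> 0} \<in> null_sets \<mu>" by (auto simp: emeasure_eq_measure)
    from AE_not_in[OF this] have ae: "AE x in \<mu>. g x powr p = 0" by eventually_elim (auto simp: g_def)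
    have m: "(\<lambda>x. g x powr p) \<in> borel_measurable \<mu>" using g_meas by measurable
    have "integrable \<mu> (\<lambda>x. g x powr p) \<longleftrightarrow> integrable \<mu> (\<lambda>x. 0 :: real)"
      by (rule integrable_cong_AE) (use ae m in auto)
    moreover have "(\<integral>x. g x powr p \<partial>\<mu>) = (\<integral>x. 0 \<partial>\<mu>)"
      by (rule integral_cong_AE) (use ae m in auto)
    ultimately show ?thesis using True by simp
  next
    case False
    then have M: "0 < M\<^sub>f" using M_nonneg by simp
    \<comment> \<open>Dividing \<open>g\<close> by \<open>N\<close> moves the start of the tail
      bound to level 1; it then applies with \<open>r = 1 / s\<close> and
      \<open>D = d_const s\<close>.\<close>
    define N where "N = A\<^sub>f * M\<^sub>f"
    have N: "0 < N" using A M by (simp add: N_def)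
    define C where "C = 1 - d_const s * (p / (p + 1 / s))"
    have "p / (p + 1 / s) \<le> 0" using p by (intro divide_nonneg_neg) auto
    then have "d_const s * (p / (p + 1 / s)) \<le> 0" by (intro mult_nonneg_nonpos) (simp_all add: d_const_def)
    then have C: "0 \<le> C" by (simp add: C_def)
    have "(\<integral>\<^sup>+x. ennreal ((g x / N) powr p) \<partial>\<mu>) \<le> ennreal C"
      unfolding C_def
    proof (rule nn_integral_powr_le_of_tail)
      show "measure \<mu> {x \<in> space \<mu>. t \<le> g x / N} \<le> d_const s * t powr (1 / s)" if "1 < t" for t
      proof -
        have "{x \<in> space \<mu>. t \<le> g x / N} = {x. A\<^sub>f * M\<^sub>f * t \<le> g x}"
          using N by (auto simp: N_def field_simps)
        then show ?thesis using tail[OF that M] d_bound[OF that] by simp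
      qed
    qed (use p N g_nonneg g_meas in \<open>auto simp: prob_space_axioms d_const_def\<close>)
    moreover have "g x powr p = N powr p * (g x / N) powr p" for x
      using N g_nonneg by (simp add: powr_mult[symmetric])
    ultimately have le: "(\<integral>\<^sup>+x. ennreal (g x powr p) \<partial>\<mu>) \<le> ennreal (N powr p * C)"
      using g_meas C by (simp add: ennreal_mult nn_integral_cmult mult_left_mono)
    have int: "integrable \<mu> (\<lambda>x. g x powr p)"
      using g_meas le by (intro integrableI_nonneg) (auto intro: le_less_trans)
    have "ennreal (\<integral>x. g x powr p \<partial>\<mu>) = (\<integral>\<^sup>+x. ennreal (g x powr p) \<partial>\<mu>)"
      using int by (intro nn_integral_eq_integral[symmetric]) auto
    then have "ennreal (\<integral>x. g x powr p \<partial>\<mu>) \<le> ennreal (N powr p * C)" using le by simp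
    then have "(\<integral>x. g x powr p \<partial>\<mu>) \<le> N powr p * C"
      by (subst (asm) ennreal_le_iff) (use C in auto)
    then have "(\<integral>x. g x powr p \<partial>\<mu>) powr (1 / p) \<le> (N powr p * C) powr (1 / p)"
      using p by (intro powr_mono2) auto
    also have "\<dots> = N * C powr (1 / p)" using N p C by (simp add: powr_mult powr_powr)
    finally show ?thesis using int by (simp add: N_def C_def)
  qed
  show ?thesis
    using tail d_bound Lp M_nonneg unfolding Lp_norm_def g_def by (auto simp: less_le)
qed

end
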